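(* Let $g$ be a generalized Hermite kernel on $\mathbb{R}_+^k$ with homogeneity exponent $\alpha\in(-\frac{k+1}{2},-\frac k2)$, and let $\beta\neq 0$ satisfy $-\alpha-\frac k2-1<\beta<-\alpha-\frac k2$. Then the process defined by $Z^\beta(t):=I_k(h_t^\beta)$, namely $$Z^\beta(t)=\int_{\mathbb{R}^k}'\int_{\mathbb{R}}\frac1\beta\left[(t-s)_+^\beta-(-s)_+^\beta\right]g(s-x_1,\ldots,s-x_k)1_{\{s>x_1,\ldots,s>x_k\}}\,ds\;W(dx_1)\cdots W(dx_k),$$ is an $H$-sssi process with $$H=\alpha+\beta+\frac k2+1\in(0,1).$$
   Context: Notation: $\mathbb{R}_+=(0,\infty)$, $\mathbf{1}=(1,\ldots,1)$; vector inequalities are componentwise; $x_+^\beta=x^\beta$ if $x>0$ and $0$ otherwise. A generalized Hermite kernel of order $k\ge1$ is a nonzero measurable function $g:\mathbb{R}_+^k\to\mathbb{R}$ such that (A) $g(\lambda\mathbf{x})=\lambda^\alpha g(\mathbf{x})$ for all $\lambda>0$, where $\alpha\in(-\frac{k+1}{2},-\frac{k}{2})$ (homogeneity exponent); (B) $\int_{\mathbb{R}_+^k}|g(\mathbf{x})g(\mathbf{1}+\mathbf{x})|\,d\mathbf{x}<\infty$. Here $h_t^\beta(\mathbf{x})=\int_{\mathbb{R}}\frac1\beta[(t-s)_+^\beta-(-s)_+^\beta]g(s\mathbf{1}-\mathbf{x})1_{\{s\mathbf{1}>\mathbf{x}\}}ds$, which belongs to $L^2(\mathbb{R}^k)$ for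 the stated range of $\beta$. For $f\in L^2(\mathbb{R}^k)$, $I_k(f)=\int'_{\mathbb{R}^k}f\,W(dx_1)\cdots W(dx_k)$ is the $k$-tuple Wiener-Itô integral with respect to Brownian motion $W$ on $\mathbb{R}$ (diagonals excluded). A real-valued finite-variance process $\{X(t),t\ge0\}$ is $H$-sssi if (self-similarity) for every $a>0$, $\{X(at)\}_{t\ge 0}$ and $\{a^HX(t)\}_{t\ge 0}$ have the same finite-dimensional distributions, and (stationary increments) for every $h\ge0$ the process $\{X(t+h)-X(t),t\ge0\}$ is stationary. *)

theory Defs
  imports "HOL-Probability.Probability"
begin

section \<open>Generalized Hermite kernels\<close>

text \<open>Functions on the open positive orthant are represented by total functions on
  \<^typ>\<open>real ^ 'k\<close> whose values outside the orthant are never used; the order of the kernel is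
  the dimension \<open>CARD('k)\<close>, which is automatically at least one.\<close>

definition pos_orthant :: "(real ^ 'k) set" where
  "pos_orthant = {x. \<forall>i. 0 < x $ i}"

definition generalized_hermite_kernel :: "(real ^ 'k \<Rightarrow> real) \<Rightarrow> real \<Rightarrow> bool" where
  "generalized_hermite_kernel g \<alpha> \<longleftrightarrow>
     set_borel_measurable lborel pos_orthant g \<and>
     (\<exists>x\<in>pos_orthant. g x \<noteq> 0) \<and>
     - (real CARD('k) + 1) / 2 < \<alpha> \<and> \<alpha> < - real CARD('k) / 2 \<and>
     (\<forall>c>0. \<forall>x\<in>pos_orthant. g (c *\<^sub>R x) = c powr \<alpha> * g x) \<and>
     set_integrable lborel pos_orthant (\<lambda>x. \<bar>g x * g (1 + x)\<bar>)"

text \<open>The explicit case distinction is needed because \<open>powr\<close> does not vanish at negative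
  arguments.\<close>

definition plus_powr :: "real \<Rightarrow> real \<Rightarrow> real" where
  "plus_powr x \<beta> = (if 0 < x then x powr \<beta> else 0)"

definition h_kernel :: "(real ^ 'k \<Rightarrow> real) \<Rightarrow> real \<Rightarrow> real \<Rightarrow> real ^ 'k \<Rightarrow> real" where
  "h_kernel g \<beta> t x =
     (\<integral>s. (1 / \<beta>) * (plus_powr (t - s) \<beta> - plus_powr (- s) \<beta>)
            * g (\<chi> i. s - x $ i) * indicator {s. \<forall>i. x $ i < s} s \<partial>lborel)"

section \<open>Brownian motion on the real line\<close>

definition brownian_motion :: "'w measure \<Rightarrow> (real \<Rightarrow> 'w \<Rightarrow> real) \<Rightarrow> bool" where
  "brownian_motion M W \<longleftrightarrow>
     prob_space M \<and>
     (\<forall>t. W t \<in> borel_measurable M) \<and>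
     (AE \<omega> in M. W 0 \<omega> = 0) \<and>
     (AE \<omega> in M. continuous_on UNIV (\<lambda>t. W t \<omega>)) \<and>
     (\<forall>s t. s < t \<longrightarrow>
        distributed M lborel (\<lambda>\<omega>. W t \<omega> - W s \<omega>) (normal_density 0 (sqrt (t - s)))) \<and>
     (\<forall>n \<tau>. strict_mono_on {..n::nat} \<tau> \<longrightarrow>
        prob_space.indep_vars M (\<lambda>_. borel) (\<lambda>i \<omega>. W (\<tau> (Suc i)) \<omega> - W (\<tau> i) \<omega>) {..<n})"

section \<open>Multiple Wiener-Ito integrals\<close>

definition square_integrable :: "'a measure \<Rightarrow> ('a \<Rightarrow> real) \<Rightarrow> bool" where
  "square_integrable M f \<longleftrightarrow> f \<in> borel_measurable M \<and> integrable M (\<lambda>x. (f x)\<^sup>2)"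

text \<open>An off-diagonal step function is given by points \<open>\<tau> 0 < \<dots> < \<tau> n\<close> and by a coefficient
  \<open>a i\<close> for every box
  \<open>\<Prod>j. (\<tau> (i j), \<tau> (i j + 1)]\<close> of the resulting grid, where the multi-index \<open>i\<close> assigns to each
  coordinate \<open>j\<close> the number of a subinterval. Coefficients of boxes with a repeated side vanish,
  which is how the diagonals are excluded.\<close>

definition off_diagonal_grid ::
  "nat \<Rightarrow> (nat \<Rightarrow> real) \<Rightarrow> (('k \<Rightarrow> nat) \<Rightarrow> real) \<Rightarrow> bool" where
  "off_diagonal_grid n \<tau> a \<longleftrightarrow>
     strict_mono_on {..n} \<tau> \<and> (\<forall>i \<in> UNIV \<rightarrow> {..<n}. \<not> inj i \<longrightarrow> a i = 0)"

definition step_function ::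
  "nat \<Rightarrow> (nat \<Rightarrow> real) \<Rightarrow> (('k \<Rightarrow> nat) \<Rightarrow> real) \<Rightarrow> real ^ 'k \<Rightarrow> real" where
  "step_function n \<tau> a x =
     (\<Sum>i \<in> UNIV \<rightarrow> {..<n}. a i * (\<Prod>j\<in>UNIV. indicator {\<tau> (i j)<..\<tau> (Suc (i j))} (x $ j)))"

definition step_integral ::
  "(real \<Rightarrow> 'w \<Rightarrow> real) \<Rightarrow> nat \<Rightarrow> (nat \<Rightarrow> real) \<Rightarrow> (('k::finite \<Rightarrow> nat) \<Rightarrow> real) \<Rightarrow> 'w \<Rightarrow> real" where
  "step_integral W n \<tau> a \<omega> =
     (\<Sum>i \<in> UNIV \<rightarrow> {..<n}. a i * (\<Prod>j\<in>UNIV. W (\<tau> (Suc (i j))) \<omega> - W (\<tau> (i j)) \<omega>))"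

text \<open>Extension from step functions to all of \<open>L\<^sup>2\<close> by continuity. The integral is an almost
  surely determined random variable, so the following is a predicate on its versions;
  \<open>wiener_ito\<close> below picks one of them.\<close>

definition is_wiener_ito ::
  "'w measure \<Rightarrow> (real \<Rightarrow> 'w \<Rightarrow> real) \<Rightarrow> (real ^ 'k \<Rightarrow> real) \<Rightarrow> ('w \<Rightarrow> real) \<Rightarrow> bool" where
  "is_wiener_ito M W f Y \<longleftrightarrow>
     square_integrable lborel f \<and> square_integrable M Y \<and>
     (\<exists>n \<tau> a.
        (\<forall>m::nat. off_diagonal_grid (n m) (\<tau> m) (a m)) \<and>
        (\<lambda>m. \<integral>\<^sup>+x. ennreal ((f x - step_function (n m) (\<tau> m) (a m) x)\<^sup>2) \<partial>lborel)
           \<longlonglongrightarrow> 0 \<and>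
        (\<lambda>m. \<integral>\<^sup>+\<omega>. ennreal ((Y \<omega> - step_integral W (n m) (\<tau> m) (a m) \<omega>)\<^sup>2) \<partial>M)
           \<longlonglongrightarrow> 0)"

definition wiener_ito ::
  "'w measure \<Rightarrow> (real \<Rightarrow> 'w \<Rightarrow> real) \<Rightarrow> (real ^ 'k \<Rightarrow> real) \<Rightarrow> 'w \<Rightarrow> real" where
  "wiener_ito M W f = (SOME Y. is_wiener_ito M W f Y)"

section \<open>Self-similar processes with stationary increments\<close>

text \<open>Processes are indexed by \<open>t \<ge> 0\<close>; values at negative times are irrelevant.\<close>

definition same_fdd ::
  "'w measure \<Rightarrow> (real \<Rightarrow> 'w \<Rightarrow> real) \<Rightarrow> (real \<Rightarrow> 'w \<Rightarrow> real) \<Rightarrow> bool" where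
  "same_fdd M X Y \<longleftrightarrow>
     (\<forall>J. finite J \<and> J \<subseteq> {0..} \<longrightarrow>
        distr M (\<Pi>\<^sub>M t\<in>J. borel) (\<lambda>\<omega>. \<lambda>t\<in>J. X t \<omega>) =
        distr M (\<Pi>\<^sub>M t\<in>J. borel) (\<lambda>\<omega>. \<lambda>t\<in>J. Y t \<omega>))"

definition stationary_process :: "'w measure \<Rightarrow> (real \<Rightarrow> 'w \<Rightarrow> real) \<Rightarrow> bool" where
  "stationary_process M X \<longleftrightarrow> (\<forall>u\<ge>0. same_fdd M (\<lambda>t. X (t + u)) X)"

definition sssi :: "'w measure \<Rightarrow> real \<Rightarrow> (real \<Rightarrow> 'w \<Rightarrow> real) \<Rightarrow> bool" where
  "sssi M H X \<longleftrightarrow>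
     (\<forall>t\<ge>0. square_integrable M (X t)) \<and>
     (\<forall>a>0. same_fdd M (\<lambda>t. X (a * t)) (\<lambda>t \<omega>. a powr H * X t \<omega>)) \<and>
     (\<forall>h\<ge>0. stationary_process M (\<lambda>t \<omega>. X (t + h) \<omega> - X t \<omega>))"

end

theory Submission
  imports Defs
begin

text \<open>Both invariances come from changing the Brownian motion. If \<open>V t = (W (a t + b) - W b) / \<surd>a\<close>,
  then \<open>V\<close> is again a Brownian motion and \<open>I\<^sub>V (f (a x + b)) = a\<^bsup>-k/2\<^esup> I\<^sub>W f\<close>, as one sees on step
  functions. Since the joint law of integrals of given functions does not depend on the Brownian
  motion, a scaling or translation identity for kernels becomes an identity of finite-dimensional
  distributions: \<open>h\<^sub>a\<^sub>t (a x) = a\<^bsup>1+\<alpha>+\<beta>\<^esup> h\<^sub>t x\<close> gives self-similarity, and the increments of \<open>h\<close>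
  are translates of each other. For \<open>h\<^sub>t \<in> L\<^sup>2\<close>, the homogeneity of \<open>g\<close> gives
  \<open>\<integral> \<bar>g (s - x) g (r - x)\<bar> dx = C \<bar>s - r\<bar>\<^bsup>\<gamma>\<^esup>\<close> with \<open>\<gamma> = 2 \<alpha> + k \<in> (-1, 0)\<close>, so the squared norm is
  bounded by a Riesz energy of the weight in \<open>s\<close>; the weight is dominated by powers for which
  this energy is finite exactly in the stated range of \<open>\<beta>\<close>.\<close>

section \<open>Square norms\<close>

text \<open>The integral is given only as a choice among versions, so all arguments run on the
  predicate \<open>is_wiener_ito\<close>, and a version must be shown to exist before
  \<open>wiener_ito\<close> means anything: completeness, a second-moment bound for step integrals
  and density of off-diagonal step functions serve this purpose. Equality of laws survives the
  passage from step integrals to square-mean limits because products of bounded Lipschitz functions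
  are used as test functions. The bounds on \<beta> arise as follows. The weight in \<open>s\<close>
  has singularities of order \<beta> at \<open>s = t\<close> and \<open>s = 0\<close>, while at
  minus infinity its two terms cancel to first order and leave |s|^(\<beta>-1). For a weight s^b the
  energy reduces to the integral of s^(2b+\<gamma>+1). Convergence at 0 with b = \<beta> is the
  lower bound, convergence at infinity with b = \<beta>-1 the upper bound. In H, the summand k/2 is
  the Brownian scaling factor that is added to the degree of the kernel; the two bounds on \<beta>
  also say H > 0 and H < 1.\<close>

definition sqnorm :: "'a measure \<Rightarrow> ('a \<Rightarrow> real) \<Rightarrow> ennreal" where
  "sqnorm M f = (\<integral>\<^sup>+x. ennreal ((f x)\<^sup>2) \<partial>M)"

lemma square_integrable_iff_sqnorm:
  "square_integrable M f \<longleftrightarrow> f \<in> borel_measurable M \<and> sqnorm M f < \<infinity>"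
proof -
  have "integrable M (\<lambda>x. (f x)\<^sup>2) \<longleftrightarrow> sqnorm M f < \<infinity>" if "f \<in> borel_measurable M"
    using that by (subst integrable_iff_bounded) (simp add: sqnorm_def)
  then show ?thesis
    by (auto simp: square_integrable_def)
qed

lemma sqnorm_cong_AE: "AE x in M. f x = g x \<Longrightarrow> sqnorm M f = sqnorm M g"
  unfolding sqnorm_def by (intro nn_integral_cong_AE) auto

text \<open>Squares are kept instead of norms, so this replaces the triangle inequality. The factor
  2 is harmless, since only finiteness and convergence to 0 are ever extracted.\<close>

lemma sqnorm_add_le:
  assumes [measurable]: "f \<in> borel_measurable M" "g \<in> borel_measurable M"
  shows "sqnorm M (\<lambda>x. f x + g x) \<le> 2 * sqnorm M f + 2 * sqnorm M g"
proof -
  have "ennreal ((a + b)\<^sup>2) \<le> 2 * ennreal (a\<^sup>2) + 2 * ennreal (b\<^sup>2)" for a b :: real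
  proof -
    have "(a + b)\<^sup>2 \<le> 2 * a\<^sup>2 + 2 * b\<^sup>2"
      using sum_squares_bound[of a b] by (simp add: power2_sum)
    then have "ennreal ((a + b)\<^sup>2) \<le> ennreal (2 * a\<^sup>2 + 2 * b\<^sup>2)"
      by (rule ennreal_leI)
    then show ?thesis
      by (simp add: ennreal_mult)
  qed
  then have "sqnorm M (\<lambda>x. f x + g x) \<le> (\<integral>\<^sup>+x. 2 * ennreal ((f x)\<^sup>2) + 2 * ennreal ((g x)\<^sup>2) \<partial>M)"
    unfolding sqnorm_def by (intro nn_integral_mono)
  also have "\<dots> = 2 * sqnorm M f + 2 * sqnorm M g"
    unfolding sqnorm_def by (subst nn_integral_add) (auto simp: nn_integral_cmult)
  finally show ?thesis .
qed

lemma sqnorm_cmult: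
  assumes [measurable]: "f \<in> borel_measurable M"
  shows "sqnorm M (\<lambda>x. c * f x) = ennreal (c\<^sup>2) * sqnorm M f"
  unfolding sqnorm_def by (simp add: power_mult_distrib ennreal_mult nn_integral_cmult)

lemma sqnorm_minus_commute: "sqnorm M (\<lambda>x. f x - g x) = sqnorm M (\<lambda>x. g x - f x)"
  by (simp add: sqnorm_def power2_commute)

lemma sqnorm_triangle:
  assumes "f \<in> borel_measurable M" "g \<in> borel_measurable M" "h \<in> borel_measurable M"
  shows "sqnorm M (\<lambda>x. f x - h x) \<le>
    2 * sqnorm M (\<lambda>x. f x - g x) + 2 * sqnorm M (\<lambda>x. g x - h x)"
  using sqnorm_add_le[of "\<lambda>x. f x - g x" M "\<lambda>x. g x - h x"] assms by simp

section \<open>Convergence and completeness in square mean\<close>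

lemma ennreal_cmult_tendsto_0:
  fixes F :: "'b \<Rightarrow> ennreal"
  assumes "(F \<longlongrightarrow> 0) G" "c < \<infinity>"
  shows "((\<lambda>m. c * F m) \<longlongrightarrow> 0) G"
  using tendsto_mult_ennreal[of "\<lambda>_. c" c G F 0] assms by auto

lemma ennreal_tendsto_0_le:
  fixes f g :: "nat \<Rightarrow> ennreal"
  assumes "g \<longlonglongrightarrow> 0" "\<And>m. f m \<le> g m"
  shows "f \<longlonglongrightarrow> 0"
  by (rule tendsto_sandwich[OF _ _ tendsto_const assms(1)]) (simp_all add: assms(2))

lemma sqnorm_tendsto_add:
  assumes "(\<lambda>m. sqnorm M (f m)) \<longlonglongrightarrow> 0" "(\<lambda>m. sqnorm M (g m)) \<longlonglongrightarrow> 0"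
    and "\<And>m. f m \<in> borel_measurable M" "\<And>m. g m \<in> borel_measurable M"
  shows "(\<lambda>m. sqnorm M (\<lambda>x. f m x + g m x)) \<longlonglongrightarrow> 0"
proof (rule tendsto_sandwich[OF _ _ tendsto_const])
  show "(\<lambda>m. 2 * sqnorm M (f m) + 2 * sqnorm M (g m)) \<longlonglongrightarrow> 0"
    using tendsto_add[OF ennreal_cmult_tendsto_0[OF assms(1), of 2] ennreal_cmult_tendsto_0[OF assms(2), of 2]]
    by simp
qed (use assms in \<open>auto intro!: sqnorm_add_le always_eventually\<close>)

lemma sqnorm_tendsto_cmult:
  assumes "(\<lambda>m. sqnorm M (f m)) \<longlonglongrightarrow> 0" "\<And>m. f m \<in> borel_measurable M"
  shows "(\<lambda>m. sqnorm M (\<lambda>x. c * f m x)) \<longlonglongrightarrow> 0"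
  using ennreal_cmult_tendsto_0[OF assms(1), of "ennreal (c\<^sup>2)"] assms(2)
  by (simp add: sqnorm_cmult)

text \<open>The geometric rate makes the sequence converge pointwise almost everywhere, via
  \<open>\<bar>d\<bar> \<le> 2\<^sup>m d\<^sup>2 + 2\<^sup>-\<^sup>m\<close>.\<close>

lemma sqnorm_complete:
  fixes Y :: "nat \<Rightarrow> 'a \<Rightarrow> real"
  assumes [measurable]: "\<And>m. Y m \<in> borel_measurable M"
    and cauchy: "\<And>m n. m \<le> n \<Longrightarrow> sqnorm M (\<lambda>x. Y n x - Y m x) \<le> ennreal (C * (1/4)^m)"
    and C: "0 \<le> C"
  shows "\<exists>Z\<in>borel_measurable M. (\<lambda>m. sqnorm M (\<lambda>x. Z x - Y m x)) \<longlonglongrightarrow> 0"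
proof -
  define d where "d m x = Y (Suc m) x - Y m x" for m x
  have [measurable]: "d m \<in> borel_measurable M" for m
    unfolding d_def by measurable
  have "(\<integral>\<^sup>+x. (\<Sum>m. ennreal (2 ^ m * (d m x)\<^sup>2)) \<partial>M) = (\<Sum>m. ennreal (2 ^ m) * sqnorm M (d m))"
    by (subst nn_integral_suminf) (auto simp: sqnorm_def ennreal_mult nn_integral_cmult)
  also have "\<dots> \<le> (\<Sum>m. ennreal (C * (1/2) ^ m))"
  proof (intro suminf_le summableI)
    fix m
    have "ennreal (2 ^ m) * sqnorm M (d m) \<le> ennreal (2 ^ m) * ennreal (C * (1/4)^m)"
      using cauchy[of m "Suc m"] unfolding d_def by (intro mult_left_mono) auto
    also have "\<dots> = ennreal (C * (1/2) ^ m)"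
      using C by (simp flip: ennreal_mult power_mult_distrib add: mult.left_commute)
    finally show "ennreal (2 ^ m) * sqnorm M (d m) \<le> ennreal (C * (1/2) ^ m)" .
  qed
  also have "\<dots> < \<infinity>"
    using C by (subst suminf_ennreal2) (auto intro!: summable_mult)
  finally have "AE x in M. (\<Sum>m. ennreal (2 ^ m * (d m x)\<^sup>2)) \<noteq> \<infinity>"
    by (intro nn_integral_PInf_AE) auto
  then have conv: "AE x in M. (\<lambda>m. Y m x) \<longlonglongrightarrow> lim (\<lambda>m. Y m x)"
  proof eventually_elim
    case (elim x)
    have "summable (\<lambda>m. 2 ^ m * (d m x)\<^sup>2)"
      using elim by (intro summable_suminf_not_top) auto
    then have "summable (\<lambda>m. 2 ^ m * (d m x)\<^sup>2 + (1/2) ^ m)"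
      by (intro summable_add) auto
    then have "summable (\<lambda>m. d m x)"
    proof (rule summable_comparison_test'[of _ 0])
      fix m :: nat
      have "0 \<le> (2 ^ m * \<bar>d m x\<bar> - 1)\<^sup>2 / 2 ^ m + \<bar>d m x\<bar>"
        by simp
      also have "(2 ^ m * \<bar>d m x\<bar> - 1)\<^sup>2 / 2 ^ m = 2 ^ m * (d m x)\<^sup>2 + (1/2) ^ m - 2 * \<bar>d m x\<bar>"
        by (simp add: power2_eq_square field_simps power_one_over) 
      finally show "norm (d m x) \<le> 2 ^ m * (d m x)\<^sup>2 + (1/2) ^ m"
        by simp
    qed
    then have "convergent (\<lambda>n. \<Sum>m<n. d m x)"
      by (simp add: summable_iff_convergent)
    moreover have "(\<Sum>m<n. d m x) = Y n x - Y 0 x" for n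
      unfolding d_def by (rule sum_lessThan_telescope)
    ultimately have "convergent (\<lambda>n. Y n x)"
      using convergent_add[OF _ convergent_const[of "Y 0 x"]] by fastforce
    then show ?case
      by (simp add: convergent_LIMSEQ_iff)
  qed
  \<comment> \<open>\<open>lim\<close> is total, so \<open>Z\<close> is measurable on the whole
    space although it is a true limit only almost everywhere.\<close>
  define Z where "Z x = lim (\<lambda>m. Y m x)" for x
  have [measurable]: "Z \<in> borel_measurable M"
    unfolding Z_def by (rule borel_measurable_lim_metric) auto
  have bound: "sqnorm M (\<lambda>x. Z x - Y m x) \<le> ennreal (C * (1/4)^m)" for m
  proof -
    \<comment> \<open>Fatou's lemma in \<open>n\<close>, with \<open>m\<close> fixed, transfers the
      Cauchy bound to the limit.\<close>
    have "sqnorm M (\<lambda>x. Z x - Y m x) \<le> (\<integral>\<^sup>+x. liminf (\<lambda>n. ennreal ((Y n x - Y m x)\<^sup>2)) \<partial>M)"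
      unfolding sqnorm_def
    proof (intro nn_integral_mono_AE, use conv in eventually_elim)
      case (elim x)
      have "(\<lambda>n. ennreal ((Y n x - Y m x)\<^sup>2)) \<longlonglongrightarrow> ennreal ((Z x - Y m x)\<^sup>2)"
        unfolding Z_def by (intro tendsto_ennrealI tendsto_intros elim)
      from lim_imp_Liminf[OF sequentially_bot this] show ?case
        by (rule eq_refl[OF sym])
    qed
    also have "\<dots> \<le> liminf (\<lambda>n. \<integral>\<^sup>+x. ennreal ((Y n x - Y m x)\<^sup>2) \<partial>M)"
      by (intro nn_integral_liminf) auto
    also have "\<dots> \<le> liminf (\<lambda>n::nat. ennreal (C * (1/4)^m))"
      using cauchy[unfolded sqnorm_def]
      by (intro Liminf_mono) (auto simp: eventually_sequentially)
    also have "\<dots> = ennreal (C * (1/4)^m)"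
      by (simp add: Liminf_const)
    finally show ?thesis .
  qed
  have lim: "(\<lambda>m. ennreal (C * (1/4)^m)) \<longlonglongrightarrow> ennreal (C * 0)"
    by (intro tendsto_ennrealI tendsto_mult tendsto_const LIMSEQ_power_zero) simp
  have "(\<lambda>m. sqnorm M (\<lambda>x. Z x - Y m x)) \<longlonglongrightarrow> 0"
    by (rule ennreal_tendsto_0_le[OF lim[unfolded mult_zero_right ennreal_0] bound])
  with \<open>Z \<in> borel_measurable M\<close> show ?thesis
    by blast
qed

section \<open>Step functions on grids\<close>

text \<open>Step functions and their integrals are the instances of the following sum for
  \<open>D j s t = 1\<^bsub>(s,t]\<^esub>(x\<^sub>j)\<close> and \<open>D j s t = W t - W s\<close>; additivity in the interval is all that
  refinement of grids needs.\<close>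

definition grid_sum ::
  "('k::finite \<Rightarrow> real \<Rightarrow> real \<Rightarrow> real) \<Rightarrow> nat \<Rightarrow> (nat \<Rightarrow> real) \<Rightarrow> (('k \<Rightarrow> nat) \<Rightarrow> real) \<Rightarrow> real" where
  "grid_sum D n \<tau> a = (\<Sum>i\<in>UNIV \<rightarrow> {..<n}. a i * (\<Prod>j\<in>UNIV. D j (\<tau> (i j)) (\<tau> (Suc (i j)))))"

definition interval_additive :: "('k \<Rightarrow> real \<Rightarrow> real \<Rightarrow> real) \<Rightarrow> bool" where
  "interval_additive D \<longleftrightarrow> (\<forall>j s t u. s \<le> t \<longrightarrow> t \<le> u \<longrightarrow> D j s u = D j s t + D j t u)"

lemma step_function_eq_grid_sum:
  "step_function n \<tau> a x = grid_sum (\<lambda>j s t. indicator {s<..t} (x $ j)) n \<tau> a"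
  by (simp add: step_function_def grid_sum_def)

lemma step_integral_eq_grid_sum:
  "step_integral W n \<tau> a \<omega> = grid_sum (\<lambda>j s t. W t \<omega> - W s \<omega>) n \<tau> a"
  by (simp add: step_integral_def grid_sum_def)

lemma interval_additive_indicator:
  "interval_additive (\<lambda>j s t. indicator {s<..t} (x $ j :: real))"
  by (auto simp: interval_additive_def indicator_def)

lemma interval_additive_increment: "interval_additive (\<lambda>j s t. w t - w s)"
  by (auto simp: interval_additive_def)

lemma finite_index_functions: "finite (UNIV \<rightarrow> {..<n::nat} :: ('k::finite \<Rightarrow> nat) set)"
  using finite_PiE[of "UNIV :: 'k set" "\<lambda>_. {..<n}"] by (simp add: PiE_UNIV_domain)

lemma interval_additive_sum:
  assumes D: "interval_additive D" and \<sigma>: "strict_mono_on {..N} \<sigma>" and "p \<le> q" "q \<le> N"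
  shows "D j (\<sigma> p) (\<sigma> q) = (\<Sum>r\<in>{p..<q}. D j (\<sigma> r) (\<sigma> (Suc r)))"
  using \<open>p \<le> q\<close> \<open>q \<le> N\<close>
proof (induction q rule: dec_induct)
  case base
  \<comment> \<open>Additivity on the degenerate interval s = t = u forces the value 0, which
    matches the empty sum.\<close>
  have "D j (\<sigma> p) (\<sigma> p) = D j (\<sigma> p) (\<sigma> p) + D j (\<sigma> p) (\<sigma> p)"
    using D unfolding interval_additive_def by blast
  then show ?case
    by simp
next
  case (step q)
  have "\<sigma> p \<le> \<sigma> q" "\<sigma> q \<le> \<sigma> (Suc q)"
    using step.hyps step.prems
    by (auto intro!: monotone_onD[OF strict_mono_on_imp_mono_on[OF \<sigma>]])
  then have "D j (\<sigma> p) (\<sigma> (Suc q)) = D j (\<sigma> p) (\<sigma> q) + D j (\<sigma> q) (\<sigma> (Suc q))"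
    using D unfolding interval_additive_def by blast
  then show ?case
    using step by simp
qed

text \<open>Every old cell is a union of consecutive new cells; expanding the product of the
  resulting sums distributes an old box over new boxes. The new coefficients do not depend on
  \<open>D\<close>, so one array refines a step function and its integral at the same time. Diagonal
  boxes keep coefficient 0, because equal new indices have the same old cell as parent.\<close>

lemma grid_sum_refine:
  fixes a :: "('k::finite \<Rightarrow> nat) \<Rightarrow> real"
  assumes grid: "off_diagonal_grid n \<tau> a"
    and \<sigma>: "strict_mono_on {..N} \<sigma>" and sub: "\<tau> ` {..n} \<subseteq> \<sigma> ` {..N}"
  obtains a' where "off_diagonal_grid N \<sigma> a'"
    "\<And>D. interval_additive D \<Longrightarrow> grid_sum D n \<tau> a = grid_sum D N \<sigma> a'"
proof -
  have \<tau>: "strict_mono_on {..n} \<tau>" and a0: "\<And>i. i \<in> UNIV \<rightarrow> {..<n} \<Longrightarrow> \<not> inj i \<Longrightarrow> a i = 0"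
    using grid by (auto simp: off_diagonal_grid_def)
  have "\<forall>r\<in>{..n}. \<exists>q\<in>{..N}. \<tau> r = \<sigma> q"
    using sub by blast
  then obtain p where p': "\<forall>r\<in>{..n}. p r \<in> {..N} \<and> \<tau> r = \<sigma> (p r)"
    unfolding Bex_def using bchoice[of "{..n}" "\<lambda>r q. q \<in> {..N} \<and> \<tau> r = \<sigma> q"] by blast
  then have p: "p r \<le> N" "\<tau> r = \<sigma> (p r)" if "r \<le> n" for r
    using that by auto
  have p_less: "p r < p r'" if "r < r'" "r' \<le> n" for r r'
  proof -
    have "\<sigma> (p r) < \<sigma> (p r')"
      using strict_mono_onD[OF \<tau>, of r r'] that p(2)[of r] p(2)[of r'] by simp
    then show ?thesis
      using strict_mono_on_less[OF \<sigma>, of "p r" "p r'"] p that by simp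
  qed
  define I where "I r = {p r..<p (Suc r)}" for r
  have I_sub: "I r \<subseteq> {..<N}" if "r < n" for r
    using p(1)[of "Suc r"] that by (auto simp: I_def)
  have I_disj: "r = r'" if "q \<in> I r" "q \<in> I r'" "r < n" "r' < n" for q r r'
  proof (rule ccontr)
    have le: "p (Suc x) \<le> p y" if "x < y" "y < n" for x y
      using p_less[of "Suc x" y] that by (cases "Suc x = y") auto
    assume "r \<noteq> r'"
    then consider "r < r'" | "r' < r"
      by linarith
    then show False
      using le[of r r'] le[of r' r] that by cases (auto simp: I_def)
  qed
  \<comment> \<open>By \<open>I_disj\<close> at most one \<open>i\<close> contributes:
    \<open>a' h\<close> is the coefficient of the old box containing the new box \<open>h\<close>,
    or 0 if there is none.\<close>
  define a' where "a' h = (\<Sum>i\<in>UNIV \<rightarrow> {..<n}. if \<forall>j. h j \<in> I (i j) then a i else 0)" for h :: "'k \<Rightarrow> nat"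
  have "a' h = 0" if "\<not> inj h" for h
    unfolding a'_def
  proof (intro sum.neutral ballI)
    fix i :: "'k \<Rightarrow> nat"
    assume i: "i \<in> UNIV \<rightarrow> {..<n}"
    from that obtain j j' where "j \<noteq> j'" "h j = h j'"
      by (auto simp: inj_def)
    have "\<not> inj i" if "\<forall>j. h j \<in> I (i j)"
    proof
      assume "inj i"
      have "i j = i j'"
        using that[rule_format, of j] that[rule_format, of j'] \<open>h j = h j'\<close> i
        by (intro I_disj[of "h j"]) (auto simp: Pi_iff)
      with \<open>inj i\<close> \<open>j \<noteq> j'\<close> show False
        by (simp add: inj_eq)
    qed
    then show "(if \<forall>j. h j \<in> I (i j) then a i else 0) = 0"
      using a0[OF i] by simp
  qed
  then have "off_diagonal_grid N \<sigma> a'"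
    using \<sigma> by (simp add: off_diagonal_grid_def)
  moreover have "grid_sum D n \<tau> a = grid_sum D N \<sigma> a'" if D: "interval_additive D" for D
  proof -
    let ?P = "\<lambda>h. \<Prod>j\<in>UNIV. D j (\<sigma> (h j)) (\<sigma> (Suc (h j)))"
    have "(\<Prod>j\<in>UNIV. D j (\<tau> (i j)) (\<tau> (Suc (i j)))) =
        (\<Sum>h\<in>UNIV \<rightarrow> {..<N}. if \<forall>j. h j \<in> I (i j) then ?P h else 0)"
      if i: "i \<in> UNIV \<rightarrow> {..<n}" for i
    proof -
      have lt: "i j < n" for j
        using i by auto
      have "D j (\<tau> (i j)) (\<tau> (Suc (i j))) = (\<Sum>q\<in>I (i j). D j (\<sigma> q) (\<sigma> (Suc q)))" for j
        using interval_additive_sum[OF D \<sigma>, of "p (i j)" "p (Suc (i j))" j]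
          lt[of j] p(1)[of "Suc (i j)"] p(2)[of "Suc (i j)"] p(2)[of "i j"] p_less[of "i j" "Suc (i j)"]
        by (simp add: I_def)
      then have "(\<Prod>j\<in>UNIV. D j (\<tau> (i j)) (\<tau> (Suc (i j)))) =
          (\<Prod>j\<in>UNIV. \<Sum>q\<in>I (i j). D j (\<sigma> q) (\<sigma> (Suc q)))"
        by simp
      also have "\<dots> = (\<Sum>h\<in>Pi\<^sub>E UNIV (\<lambda>j. I (i j)). ?P h)"
        by (rule prod_sum_PiE) (auto simp: I_def)
      also have "Pi\<^sub>E UNIV (\<lambda>j. I (i j)) = {h \<in> UNIV \<rightarrow> {..<N}. \<forall>j. h j \<in> I (i j)}"
        using I_sub[OF lt] by (auto simp: PiE_UNIV_domain Pi_iff subset_iff)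
      also have "(\<Sum>h\<in>\<dots>. ?P h) = (\<Sum>h\<in>UNIV \<rightarrow> {..<N}. if \<forall>j. h j \<in> I (i j) then ?P h else 0)"
        by (rule sum.inter_filter[OF finite_index_functions])
      finally show ?thesis .
    qed
    then have "grid_sum D n \<tau> a =
        (\<Sum>i\<in>UNIV \<rightarrow> {..<n}. \<Sum>h\<in>UNIV \<rightarrow> {..<N}. a i * (if \<forall>j. h j \<in> I (i j) then ?P h else 0))"
      unfolding grid_sum_def by (simp add: sum_distrib_left)
    also have "\<dots> = (\<Sum>h\<in>UNIV \<rightarrow> {..<N}. \<Sum>i\<in>UNIV \<rightarrow> {..<n}. a i * (if \<forall>j. h j \<in> I (i j) then ?P h else 0))"
      by (rule sum.swap)
    also have "\<dots> = grid_sum D N \<sigma> a'"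
      unfolding grid_sum_def a'_def sum_distrib_right by (intro sum.cong refl) auto
    finally show ?thesis .
  qed
  ultimately show ?thesis
    using that by blast
qed

lemma finite_set_as_grid:
  fixes T :: "real set"
  assumes "finite T" "T \<noteq> {}"
  shows "\<exists>N \<sigma>. strict_mono_on {..N::nat} \<sigma> \<and> \<sigma> ` {..N} = T"
proof (intro exI conjI)
  let ?l = "sorted_list_of_set T"
  have len: "length ?l = card T" "card T > 0"
    using assms by (auto simp: card_gt_0_iff)
  show "strict_mono_on {..card T - 1} (\<lambda>i. ?l ! i)"
    using len sorted_wrt_nth_less[OF strict_sorted_list_of_set, of _ _ T]
    by (intro strict_mono_onI) auto
  have "{..card T - 1} = {..<length ?l}"
    using len by auto
  then show "(\<lambda>i. ?l ! i) ` {..card T - 1} = T"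
    using nth_image[of "length ?l" ?l] set_sorted_list_of_set[OF assms(1)]
    by (simp add: atLeast0LessThan)
qed

lemma common_grid:
  fixes a :: "'i \<Rightarrow> ('k::finite \<Rightarrow> nat) \<Rightarrow> real"
  assumes "finite J" and grid: "\<And>t. t \<in> J \<Longrightarrow> off_diagonal_grid (n t) (\<tau> t) (a t)"
  obtains N \<sigma> a' where "strict_mono_on {..N} \<sigma>"
    "\<And>t. t \<in> J \<Longrightarrow> off_diagonal_grid N \<sigma> (a' t)"
    "\<And>t D. t \<in> J \<Longrightarrow> interval_additive D \<Longrightarrow> grid_sum D (n t) (\<tau> t) (a t) = grid_sum D N \<sigma> (a' t)"
proof -
  \<comment> \<open>The point 0 keeps the set of grid points nonempty when \<open>J\<close> is
    empty.\<close>
  have "finite (insert 0 (\<Union>t\<in>J. \<tau> t ` {..n t}))"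
    using assms(1) by simp
  from finite_set_as_grid[OF this] obtain N \<sigma>
    where \<sigma>: "strict_mono_on {..N::nat} \<sigma>" "\<sigma> ` {..N} = insert 0 (\<Union>t\<in>J. \<tau> t ` {..n t})"
    by blast
  have "\<exists>b. off_diagonal_grid N \<sigma> b \<and>
      (\<forall>D. interval_additive D \<longrightarrow> grid_sum D (n t) (\<tau> t) (a t) = grid_sum D N \<sigma> b)" if "t \<in> J" for t
  proof -
    have "\<tau> t ` {..n t} \<subseteq> \<sigma> ` {..N}"
      using \<sigma>(2) that by auto
    from grid_sum_refine[OF grid[OF that] \<sigma>(1) this] show ?thesis
      by metis
  qed
  then obtain a' where "\<And>t. t \<in> J \<Longrightarrow> off_diagonal_grid N \<sigma> (a' t) \<and>
      (\<forall>D. interval_additive D \<longrightarrow> grid_sum D (n t) (\<tau> t) (a t) = grid_sum D N \<sigma> (a' t))"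
    by metis
  then show ?thesis
    using that \<sigma>(1) by blast
qed

lemma grid_sum_linear:
  "grid_sum D n \<tau> (\<lambda>i. c * a i + d * b i) = c * grid_sum D n \<tau> a + d * grid_sum D n \<tau> b"
  by (simp add: grid_sum_def sum_distrib_left sum.distrib ring_distribs mult.assoc)

text \<open>The same \<open>N\<close>, \<open>\<rho>\<close>, \<open>e\<close> must serve both the
  function and the integral; this is what later carries linearity from step functions to all
  square-mean limits.\<close>

lemma off_diagonal_steps_linear:
  fixes a b :: "('k::finite \<Rightarrow> nat) \<Rightarrow> real" and W :: "real \<Rightarrow> 'w \<Rightarrow> real"
  assumes "off_diagonal_grid n \<tau> a" "off_diagonal_grid m \<sigma> b"
  shows "\<exists>N \<rho> e. off_diagonal_grid N \<rho> e \<and>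
    (\<forall>x. step_function N \<rho> e x = c * step_function n \<tau> a x + d * step_function m \<sigma> b x) \<and>
    (\<forall>\<omega>. step_integral W N \<rho> e \<omega> = c * step_integral W n \<tau> a \<omega> + d * step_integral W m \<sigma> b \<omega>)"
proof -
  \<comment> \<open>Indexing the two grids by \<open>bool\<close> makes them a finite family for
    \<open>common_grid\<close>.\<close>
  let ?n = "\<lambda>t. if t then n else m" and ?\<tau> = "\<lambda>t. if t then \<tau> else \<sigma>" and ?a = "\<lambda>t. if t then a else b"
  have "off_diagonal_grid (?n t) (?\<tau> t) (?a t)" for t
    using assms by simp
  then obtain N \<rho> a' where *: "\<And>t. off_diagonal_grid N \<rho> (a' t)"
    "\<And>t D. interval_additive D \<Longrightarrow> grid_sum D (?n t) (?\<tau> t) (?a t) = grid_sum D N \<rho> (a' t)"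
    by (rule common_grid[of "UNIV :: bool set" ?n ?\<tau> ?a, OF finite]) (use that in blast)
  have eq: "grid_sum D N \<rho> (\<lambda>i. c * a' True i + d * a' False i) = c * grid_sum D n \<tau> a + d * grid_sum D m \<sigma> b"
    if "interval_additive D" for D
    using *(2)[of D True] *(2)[of D False] that by (simp add: grid_sum_linear)
  have "off_diagonal_grid N \<rho> (\<lambda>i. c * a' True i + d * a' False i)"
    using *(1)[of True] *(1)[of False] by (simp add: off_diagonal_grid_def)
  then show ?thesis
    by (intro exI conjI) (auto simp: step_function_eq_grid_sum step_integral_eq_grid_sum eq
      interval_additive_indicator interval_additive_increment)
qed

section \<open>The isometry bound\<close>

lemma step_function_in_box:
  fixes x :: "real ^ 'k"
  assumes \<tau>: "strict_mono_on {..n} \<tau>" and i: "i \<in> UNIV \<rightarrow> {..<n}"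
    and x: "\<And>j. x $ j \<in> {\<tau> (i j)<..\<tau> (Suc (i j))}"
  shows "step_function n \<tau> a x = a i"
proof -
  have unique: "r = r'" if "y \<in> {\<tau> r<..\<tau> (Suc r)}" "y \<in> {\<tau> r'<..\<tau> (Suc r')}" "r < n" "r' < n" for y r r'
  proof (rule ccontr)
    have le: "\<tau> (Suc p) \<le> \<tau> q" if "p < q" "q < n" for p q
      using strict_mono_on_leD[OF \<tau>, of "Suc p" q] that by simp
    assume "r \<noteq> r'"
    then consider "r < r'" | "r' < r"
      by linarith
    then show False
      using le[of r r'] le[of r' r] that by cases auto
  qed
  have zero: "(\<Prod>j\<in>UNIV. indicator {\<tau> (h j)<..\<tau> (Suc (h j))} (x $ j)) = (0::real)"
    if h: "h \<in> UNIV \<rightarrow> {..<n}" "h \<noteq> i" for h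
  proof -
    obtain j where "h j \<noteq> i j"
      using h(2) by (auto simp: fun_eq_iff)
    moreover have "h j < n" "i j < n"
      using h i by auto
    ultimately have "x $ j \<notin> {\<tau> (h j)<..\<tau> (Suc (h j))}"
      using unique[OF x[of j], of "h j"] by auto
    then show ?thesis
      by (intro prod_zero bexI[of _ j]) (auto simp: indicator_def)
  qed
  have one: "(\<Prod>j\<in>UNIV. indicator {\<tau> (i j)<..\<tau> (Suc (i j))} (x $ j)) = (1::real)"
    using x by simp
  show ?thesis
    unfolding step_function_def
    by (subst sum.remove[OF finite_index_functions i]) (simp add: one zero)
qed

lemma step_function_outside:
  fixes x :: "real ^ 'k"
  assumes "\<And>i. i \<in> UNIV \<rightarrow> {..<n} \<Longrightarrow> \<exists>j. x $ j \<notin> {\<tau> (i j)<..\<tau> (Suc (i j))}"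
  shows "step_function n \<tau> a x = 0"
  unfolding step_function_def
proof (intro sum.neutral ballI)
  fix i :: "'k \<Rightarrow> nat"
  assume "i \<in> UNIV \<rightarrow> {..<n}"
  then obtain j where "x $ j \<notin> {\<tau> (i j)<..\<tau> (Suc (i j))}"
    using assms by blast
  then have "(\<Prod>j\<in>UNIV. indicator {\<tau> (i j)<..\<tau> (Suc (i j))} (x $ j)) = (0::real)"
    by (intro prod_zero bexI[of _ j]) (auto simp: indicator_def)
  then show "a i * (\<Prod>j\<in>UNIV. indicator {\<tau> (i j)<..\<tau> (Suc (i j))} (x $ j)) = 0"
    by simp
qed

text \<open>The boxes of a grid are disjoint, so no cross terms arise and squaring acts on the
  coefficients alone.\<close>

lemma step_function_square:
  assumes "strict_mono_on {..n} \<tau>"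
  shows "(step_function n \<tau> a x)\<^sup>2 = step_function n \<tau> (\<lambda>i. (a i)\<^sup>2) x"
proof (cases "\<exists>i\<in>UNIV \<rightarrow> {..<n}. \<forall>j. x $ j \<in> {\<tau> (i j)<..\<tau> (Suc (i j))}")
  case True
  then show ?thesis
    using step_function_in_box[OF assms] by metis
next
  case False
  then have "\<And>i. i \<in> UNIV \<rightarrow> {..<n} \<Longrightarrow> \<exists>j. x $ j \<notin> {\<tau> (i j)<..\<tau> (Suc (i j))}"
    by blast
  then show ?thesis
    by (simp add: step_function_outside)
qed

lemma measurable_vec_nth_borel [measurable]: "(\<lambda>x::real ^ 'k. x $ i) \<in> borel_measurable borel"
  by (intro borel_measurable_continuous_onI continuous_intros)

lemma measurable_step_function [measurable]: "step_function n \<tau> a \<in> borel_measurable borel"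
  unfolding step_function_def[abs_def] by measurable

text \<open>The map sending \<open>j\<close> to \<open>axis j 1\<close> enumerates
  \<open>Basis\<close> without repetition, which turns the product formula over basis vectors into
  one over coordinates.\<close>

lemma nn_integral_lborel_vec_prod:
  fixes f :: "'k::finite \<Rightarrow> real \<Rightarrow> ennreal"
  assumes "\<And>j. f j \<in> borel_measurable borel"
  shows "(\<integral>\<^sup>+x. (\<Prod>j\<in>UNIV. f j ((x :: real ^ 'k) $ j)) \<partial>lborel) = (\<Prod>j\<in>UNIV. \<integral>\<^sup>+y. f j y \<partial>lborel)"
proof -
  have Basis: "(Basis :: (real ^ 'k) set) = (\<lambda>j. axis j 1) ` UNIV"
    by (auto simp: Basis_vec_def)
  have inj: "inj (\<lambda>j. axis j 1 :: real ^ 'k)"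
    by (auto simp: inj_def axis_eq_axis)
  have "(\<integral>\<^sup>+x. (\<Prod>b\<in>Basis. f (axis_index b) ((x :: real ^ 'k) \<bullet> b)) \<partial>lborel) =
      (\<Prod>b\<in>(Basis :: (real ^ 'k) set). \<integral>\<^sup>+y. f (axis_index b) y \<partial>lborel)"
    using assms by (intro nn_integral_lborel_prod) auto
  then show ?thesis
    unfolding Basis by (simp add: prod.reindex[OF inj] axis_index_axis cart_eq_inner_axis)
qed

lemma sqnorm_step_function:
  fixes a :: "('k::finite \<Rightarrow> nat) \<Rightarrow> real"
  assumes \<tau>: "strict_mono_on {..n} \<tau>"
  shows "sqnorm lborel (step_function n \<tau> a) =
    ennreal (\<Sum>i\<in>UNIV \<rightarrow> {..<n}. (a i)\<^sup>2 * (\<Prod>j\<in>UNIV. \<tau> (Suc (i j)) - \<tau> (i j)))"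
proof -
  have le: "\<tau> (i j) \<le> \<tau> (Suc (i j))" if "i \<in> UNIV \<rightarrow> {..<n}" for i :: "'k \<Rightarrow> nat" and j
  proof -
    have "i j < n"
      using that by auto
    then show ?thesis
      using strict_mono_on_leD[OF \<tau>, of "i j" "Suc (i j)"] by simp
  qed
  have "sqnorm lborel (step_function n \<tau> a) = (\<integral>\<^sup>+x. (\<Sum>i\<in>UNIV \<rightarrow> {..<n}. ennreal ((a i)\<^sup>2) *
      (\<Prod>j\<in>UNIV. indicator {\<tau> (i j)<..\<tau> (Suc (i j))} ((x :: real ^ 'k) $ j))) \<partial>lborel)"
    unfolding sqnorm_def step_function_square[OF \<tau>] unfolding step_function_def
    by (simp add: ennreal_mult prod_nonneg sum_ennreal[symmetric] ennreal_indicator prod_ennreal[symmetric]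
        del: sum_ennreal prod_ennreal)
  also have "\<dots> = (\<Sum>i\<in>UNIV \<rightarrow> {..<n}. ennreal ((a i)\<^sup>2) *
      (\<integral>\<^sup>+x. (\<Prod>j\<in>UNIV. indicator {\<tau> (i j)<..\<tau> (Suc (i j))} ((x :: real ^ 'k) $ j)) \<partial>lborel))"
    by (subst nn_integral_sum) (auto simp: nn_integral_cmult)
  also have "\<dots> = (\<Sum>i\<in>UNIV \<rightarrow> {..<n}. ennreal ((a i)\<^sup>2 * (\<Prod>j\<in>UNIV. \<tau> (Suc (i j)) - \<tau> (i j))))"
  proof (intro sum.cong refl)
    fix i :: "'k \<Rightarrow> nat"
    assume i: "i \<in> UNIV \<rightarrow> {..<n}"
    show "ennreal ((a i)\<^sup>2) *
        (\<integral>\<^sup>+x. (\<Prod>j\<in>UNIV. indicator {\<tau> (i j)<..\<tau> (Suc (i j))} ((x :: real ^ 'k) $ j)) \<partial>lborel) =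
        ennreal ((a i)\<^sup>2 * (\<Prod>j\<in>UNIV. \<tau> (Suc (i j)) - \<tau> (i j)))"
      using le[OF i]
      by (subst nn_integral_lborel_vec_prod) (auto simp: ennreal_mult prod_nonneg prod_ennreal)
  qed
  also have "\<dots> = ennreal (\<Sum>i\<in>UNIV \<rightarrow> {..<n}. (a i)\<^sup>2 * (\<Prod>j\<in>UNIV. \<tau> (Suc (i j)) - \<tau> (i j)))"
    using le by (intro sum_ennreal) (auto intro!: mult_nonneg_nonneg prod_nonneg)
  finally show ?thesis .
qed

lemma brownian_motion_prob_space: "brownian_motion M W \<Longrightarrow> prob_space M"
  by (simp add: brownian_motion_def)

lemma brownian_motion_measurable: "brownian_motion M W \<Longrightarrow> W t \<in> borel_measurable M"
  by (simp add: brownian_motion_def)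

section \<open>Second moments of products of Brownian increments\<close>

lemma brownian_increment_moments:
  assumes W: "brownian_motion M W" and "s < t"
  shows "integrable M (\<lambda>\<omega>. W t \<omega> - W s \<omega>)" "(\<integral>\<omega>. W t \<omega> - W s \<omega> \<partial>M) = 0"
    "integrable M (\<lambda>\<omega>. (W t \<omega> - W s \<omega>)\<^sup>2)" "(\<integral>\<omega>. (W t \<omega> - W s \<omega>)\<^sup>2 \<partial>M) = t - s"
proof -
  interpret prob_space M
    using W by (rule brownian_motion_prob_space)
  let ?\<sigma> = "sqrt (t - s)"
  have \<sigma>: "0 < ?\<sigma>"
    using \<open>s < t\<close> by simp
  have D: "distributed M lborel (\<lambda>\<omega>. W t \<omega> - W s \<omega>) (normal_density 0 ?\<sigma>)"
    using W \<open>s < t\<close> by (simp add: brownian_motion_def)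
  show "integrable M (\<lambda>\<omega>. W t \<omega> - W s \<omega>)"
    using distributed_integrable[OF D, of "\<lambda>x. x"] integrable_normal_moment[OF \<sigma>, of 0 1] by simp
  show "(\<integral>\<omega>. W t \<omega> - W s \<omega> \<partial>M) = 0"
    using normal_distributed_expectation[OF \<sigma> D] .
  show "integrable M (\<lambda>\<omega>. (W t \<omega> - W s \<omega>)\<^sup>2)"
    using distributed_integrable[OF D, of "\<lambda>x. x\<^sup>2"] integrable_normal_moment[OF \<sigma>, of 0 2] by simp
  show "(\<integral>\<omega>. (W t \<omega> - W s \<omega>)\<^sup>2 \<partial>M) = t - s"
    using normal_distributed_variance[OF \<sigma> D] normal_distributed_expectation[OF \<sigma> D] \<open>s < t\<close> by simp
qed

text \<open>Independence factorizes the expectation over the cells. If \<open>A\<close> and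
  \<open>B\<close> differ, some cell lies in exactly one of them and contributes a centred
  increment, so the product vanishes; otherwise only variances remain.\<close>

lemma brownian_increment_product_moment:
  assumes W: "brownian_motion M W" and \<tau>: "strict_mono_on {..n} \<tau>"
    and AB: "A \<subseteq> {..<n}" "B \<subseteq> {..<n}"
  defines "\<xi> \<equiv> \<lambda>r \<omega>. W (\<tau> (Suc r)) \<omega> - W (\<tau> r) \<omega>"
  shows "integrable M (\<lambda>\<omega>. (\<Prod>r\<in>A. \<xi> r \<omega>) * (\<Prod>r\<in>B. \<xi> r \<omega>))"
    and "(\<integral>\<omega>. (\<Prod>r\<in>A. \<xi> r \<omega>) * (\<Prod>r\<in>B. \<xi> r \<omega>) \<partial>M) =
      (if A = B then \<Prod>r\<in>A. \<tau> (Suc r) - \<tau> r else 0)"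
proof -
  interpret prob_space M
    using W by (rule brownian_motion_prob_space)
  \<comment> \<open>\<open>X r\<close> is the squared increment, the increment or 1, according to
    whether \<open>r\<close> lies in both sets, in one or in none; this merges the two products into
    one over independent factors.\<close>
  define X where "X r \<omega> = (if r \<in> A then \<xi> r \<omega> else 1) * (if r \<in> B then \<xi> r \<omega> else 1)" for r \<omega>
  have lt: "\<tau> r < \<tau> (Suc r)" if "r < n" for r
    using strict_mono_onD[OF \<tau>, of r "Suc r"] that by simp
  have prod: "(\<Prod>r\<in>A. \<xi> r \<omega>) * (\<Prod>r\<in>B. \<xi> r \<omega>) = (\<Prod>r<n. X r \<omega>)" for \<omega>
    unfolding X_def prod.distrib using AB by (simp add: prod.If_cases Int_absorb1 Int_absorb2)
  have "indep_vars (\<lambda>_. borel) \<xi> {..<n}"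
    using W \<tau> unfolding brownian_motion_def \<xi>_def by blast
  then have indep: "indep_vars (\<lambda>_. borel) X {..<n}"
    unfolding X_def
    by (rule indep_vars_compose2[where Y = "\<lambda>r x. (if r \<in> A then x else 1) * (if r \<in> B then x else 1)"]) auto
  have moments: "integrable M (\<xi> r)" "integral\<^sup>L M (\<xi> r) = 0" "integrable M (\<lambda>\<omega>. \<xi> r \<omega> * \<xi> r \<omega>)"
      "(\<integral>\<omega>. \<xi> r \<omega> * \<xi> r \<omega> \<partial>M) = \<tau> (Suc r) - \<tau> r" if "r < n" for r
    using brownian_increment_moments[OF W lt[OF that]] by (simp_all add: \<xi>_def power2_eq_square)
  have int: "integrable M (X r)" if "r < n" for r
    using moments[OF that] unfolding X_def by (cases "r \<in> A"; cases "r \<in> B") simp_all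
  have EX: "integral\<^sup>L M (X r) = (if r \<in> A \<longleftrightarrow> r \<in> B then if r \<in> A then \<tau> (Suc r) - \<tau> r else 1 else 0)"
    if "r < n" for r
    using moments[OF that] unfolding X_def by (cases "r \<in> A"; cases "r \<in> B") (simp_all add: prob_space)
  show "integrable M (\<lambda>\<omega>. (\<Prod>r\<in>A. \<xi> r \<omega>) * (\<Prod>r\<in>B. \<xi> r \<omega>))"
    unfolding prod by (rule indep_vars_integrable[OF _ indep]) (auto intro: int)
  have "(\<integral>\<omega>. (\<Prod>r\<in>A. \<xi> r \<omega>) * (\<Prod>r\<in>B. \<xi> r \<omega>) \<partial>M) = (\<Prod>r<n. integral\<^sup>L M (X r))"
    unfolding prod by (rule indep_vars_lebesgue_integral[OF _ indep]) (auto intro: int)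
  also have "\<dots> = (if A = B then \<Prod>r\<in>A. \<tau> (Suc r) - \<tau> r else 0)"
  proof (cases "A = B")
    case True
    then have "(\<Prod>r<n. integral\<^sup>L M (X r)) = (\<Prod>r<n. if r \<in> A then \<tau> (Suc r) - \<tau> r else 1)"
      by (intro prod.cong) (auto simp: EX)
    then show ?thesis
      using True AB by (simp add: prod.If_cases Int_absorb1 Int_absorb2)
  next
    case False
    then obtain r where "r < n" "r \<in> A \<longleftrightarrow> r \<notin> B"
      using AB by blast
    then show ?thesis
      using False by (intro trans[OF prod_zero]) (auto simp: EX intro!: bexI[of _ r])
  qed
  finally show "(\<integral>\<omega>. (\<Prod>r\<in>A. \<xi> r \<omega>) * (\<Prod>r\<in>B. \<xi> r \<omega>) \<partial>M) =
      (if A = B then \<Prod>r\<in>A. \<tau> (Suc r) - \<tau> r else 0)" .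
qed

lemma measurable_step_integral:
  assumes "brownian_motion M W"
  shows "step_integral W n \<tau> a \<in> borel_measurable M"
proof -
  have [measurable]: "W t \<in> borel_measurable M" for t
    using assms by (rule brownian_motion_measurable)
  show ?thesis
    unfolding step_integral_def[abs_def] by measurable
qed

text \<open>Multi-indices with the same range \<open>A\<close> give the same product of increments, and products for
  different \<open>A\<close> are orthogonal. The constant is not optimal: a box of a given range is counted at
  most \<open>k\<^sup>k\<close> times instead of \<open>k!\<close> times.\<close>

lemma sqnorm_step_integral_le:
  fixes a :: "('k::finite \<Rightarrow> nat) \<Rightarrow> real"
  assumes W: "brownian_motion M W" and grid: "off_diagonal_grid n \<tau> a"
  shows "sqnorm M (step_integral W n \<tau> a) \<le>
    of_nat (CARD('k) ^ CARD('k)) * sqnorm lborel (step_function n \<tau> a)"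
proof -
  interpret prob_space M
    using W by (rule brownian_motion_prob_space)
  have \<tau>: "strict_mono_on {..n} \<tau>" and a0: "\<And>i. i \<in> UNIV \<rightarrow> {..<n} \<Longrightarrow> \<not> inj i \<Longrightarrow> a i = 0"
    using grid by (auto simp: off_diagonal_grid_def)
  let ?I = "UNIV \<rightarrow> {..<n} :: ('k \<Rightarrow> nat) set" and ?K = "real (CARD('k) ^ CARD('k))"
  define \<xi> where "\<xi> r \<omega> = W (\<tau> (Suc r)) \<omega> - W (\<tau> r) \<omega>" for r \<omega>
  define v where "v r = \<tau> (Suc r) - \<tau> r" for r
  define S where "S A = {i \<in> ?I. inj i \<and> range i = A}" for A
  define b where "b A = (\<Sum>i\<in>S A. a i)" for A
  have finI: "finite ?I"
    by (rule finite_index_functions)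
  have fin: "finite (S A)" for A
    unfolding S_def using finI by simp
  \<comment> \<open>The exponent \<open>p\<close> lets one regrouping serve twice: p = 1 with the
    increments for the integral, p = 2 with the cell lengths for the norm of the step function.
    Positivity of \<open>p\<close> keeps vanishing coefficients at 0.\<close>
  have group: "(\<Sum>i\<in>?I. a i ^ p * (\<Prod>j\<in>UNIV. y (i j))) = (\<Sum>A\<in>Pow {..<n}. (\<Sum>i\<in>S A. a i ^ p) * (\<Prod>r\<in>A. y r))"
    if "p > 0" for p and y :: "nat \<Rightarrow> real"
  proof -
    have "(\<Sum>i\<in>?I. a i ^ p * (\<Prod>j\<in>UNIV. y (i j))) = (\<Sum>i\<in>{i\<in>?I. inj i}. a i ^ p * (\<Prod>j\<in>UNIV. y (i j)))"
      using that by (intro sum.mono_neutral_right finI) (auto simp: a0)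
    also have "\<dots> = (\<Sum>i\<in>{i\<in>?I. inj i}. a i ^ p * (\<Prod>r\<in>range i. y r))"
      by (intro sum.cong) (auto simp: prod.reindex)
    also have "\<dots> = (\<Sum>A\<in>Pow {..<n}. \<Sum>i\<in>{i \<in> {i\<in>?I. inj i}. range i = A}. a i ^ p * (\<Prod>r\<in>range i. y r))"
      using finI by (intro sum.group[symmetric]) auto
    also have "\<dots> = (\<Sum>A\<in>Pow {..<n}. (\<Sum>i\<in>S A. a i ^ p) * (\<Prod>r\<in>A. y r))"
      unfolding sum_distrib_right by (intro sum.cong) (auto simp: S_def)
    finally show ?thesis .
  qed
  have v_nonneg: "v r \<ge> 0" if "r < n" for r
    using strict_mono_onD[OF \<tau>, of r "Suc r"] that by (simp add: v_def)
  have square: "(step_integral W n \<tau> a \<omega>)\<^sup>2 =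
      (\<Sum>A\<in>Pow {..<n}. \<Sum>B\<in>Pow {..<n}. b A * b B * ((\<Prod>r\<in>A. \<xi> r \<omega>) * (\<Prod>r\<in>B. \<xi> r \<omega>)))" for \<omega>
  proof -
    have "step_integral W n \<tau> a \<omega> = (\<Sum>A\<in>Pow {..<n}. b A * (\<Prod>r\<in>A. \<xi> r \<omega>))"
      using group[of 1 "\<lambda>r. \<xi> r \<omega>"] by (simp add: step_integral_def b_def \<xi>_def)
    then show ?thesis
      by (simp add: power2_eq_square sum_product mult_ac)
  qed
  have moment: "integrable M (\<lambda>\<omega>. (\<Prod>r\<in>A. \<xi> r \<omega>) * (\<Prod>r\<in>B. \<xi> r \<omega>))"
      "(\<integral>\<omega>. (\<Prod>r\<in>A. \<xi> r \<omega>) * (\<Prod>r\<in>B. \<xi> r \<omega>) \<partial>M) = (if A = B then \<Prod>r\<in>A. v r else 0)"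
    if "A \<in> Pow {..<n}" "B \<in> Pow {..<n}" for A B
    using brownian_increment_product_moment[OF W \<tau>, of A B] that by (simp_all add: \<xi>_def v_def)
  have "integrable M (\<lambda>\<omega>. (step_integral W n \<tau> a \<omega>)\<^sup>2)"
    unfolding square by (intro Bochner_Integration.integrable_sum integrable_mult_right moment)
  then have "sqnorm M (step_integral W n \<tau> a) = ennreal (\<integral>\<omega>. (step_integral W n \<tau> a \<omega>)\<^sup>2 \<partial>M)"
    unfolding sqnorm_def by (subst nn_integral_eq_integral) auto
  also have "(\<integral>\<omega>. (step_integral W n \<tau> a \<omega>)\<^sup>2 \<partial>M) =
      (\<Sum>A\<in>Pow {..<n}. \<Sum>B\<in>Pow {..<n}. b A * b B * (if A = B then \<Prod>r\<in>A. v r else 0))"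
    unfolding square
    by (subst Bochner_Integration.integral_sum, intro Bochner_Integration.integrable_sum integrable_mult_right moment, assumption+,
        intro sum.cong refl, subst Bochner_Integration.integral_sum, intro integrable_mult_right moment, assumption+,
        intro sum.cong refl, simp only: integral_mult_right_zero moment)
  also have "\<dots> = (\<Sum>A\<in>Pow {..<n}. (b A)\<^sup>2 * (\<Prod>r\<in>A. v r))"
    by (intro sum.cong refl) (simp add: power2_eq_square if_distrib[of "\<lambda>z. _ * z"] sum.delta' cong: if_cong)
  also have "\<dots> \<le> (\<Sum>A\<in>Pow {..<n}. ?K * ((\<Sum>i\<in>S A. (a i)\<^sup>2) * (\<Prod>r\<in>A. v r)))"
  proof (intro sum_mono)
    fix A assume A: "A \<in> Pow {..<n}"
    have card: "real (card (S A)) \<le> ?K"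
    proof (cases "card A = CARD('k)")
      case True
      have "finite A"
        using A finite_subset by auto
      then have "card (S A) \<le> card (Pi\<^sub>E (UNIV :: 'k set) (\<lambda>_. A))"
        by (intro card_mono finite_PiE) (auto simp: S_def PiE_UNIV_domain)
      also have "\<dots> = CARD('k) ^ CARD('k)"
        by (simp add: card_PiE True)
      finally show ?thesis
        by (simp flip: of_nat_power)
    next
      \<comment> \<open>An injective multi-index has a range of exactly \<open>CARD('k)\<close>
        elements, so no other \<open>A\<close> occurs.\<close>
      case False
      then have "S A = {}"
        by (auto simp: S_def card_image)
      then show ?thesis
        by simp
    qed
    have "(b A)\<^sup>2 \<le> (\<Sum>i\<in>S A. (a i)\<^sup>2) * (\<Sum>i\<in>S A. 1\<^sup>2)"
      using Cauchy_Schwarz_ineq_sum[of a "\<lambda>_. 1" "S A"] by (simp add: b_def)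
    also have "\<dots> = real (card (S A)) * (\<Sum>i\<in>S A. (a i)\<^sup>2)"
      by simp
    also have "\<dots> \<le> ?K * (\<Sum>i\<in>S A. (a i)\<^sup>2)"
      using card by (intro mult_right_mono sum_nonneg) auto
    finally have "(b A)\<^sup>2 * (\<Prod>r\<in>A. v r) \<le> ?K * (\<Sum>i\<in>S A. (a i)\<^sup>2) * (\<Prod>r\<in>A. v r)"
      using A by (intro mult_right_mono prod_nonneg v_nonneg) auto
    then show "(b A)\<^sup>2 * (\<Prod>r\<in>A. v r) \<le> ?K * ((\<Sum>i\<in>S A. (a i)\<^sup>2) * (\<Prod>r\<in>A. v r))"
      by (simp only: mult.assoc)
  qed
  also have "\<dots> = ?K * (\<Sum>i\<in>?I. (a i)\<^sup>2 * (\<Prod>j\<in>UNIV. v (i j)))"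
    using group[of 2 v] by (simp add: sum_distrib_left)
  finally have "sqnorm M (step_integral W n \<tau> a) \<le> ennreal (?K * (\<Sum>i\<in>?I. (a i)\<^sup>2 * (\<Prod>j\<in>UNIV. v (i j))))"
    by (simp add: ennreal_leI)
  also have "\<dots> = of_nat (CARD('k) ^ CARD('k)) * ennreal (\<Sum>i\<in>?I. (a i)\<^sup>2 * (\<Prod>j\<in>UNIV. v (i j)))"
    unfolding ennreal_of_nat_eq_real_of_nat using v_nonneg
    by (intro ennreal_mult) (auto intro!: sum_nonneg mult_nonneg_nonneg prod_nonneg)
  finally show ?thesis
    unfolding sqnorm_step_function[OF \<tau>] v_def .
qed

section \<open>Density of off-diagonal step functions\<close>

lemma sqnorm_dominated_convergence:
  fixes f :: "nat \<Rightarrow> 'a \<Rightarrow> real"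
  assumes [measurable]: "\<And>i. f i \<in> borel_measurable M" "g \<in> borel_measurable M" "w \<in> borel_measurable M"
    and le: "\<And>i. AE x in M. \<bar>g x - f i x\<bar> \<le> w x" and w: "sqnorm M w < \<infinity>"
    and lim: "AE x in M. (\<lambda>i. f i x) \<longlonglongrightarrow> g x"
  shows "(\<lambda>i. sqnorm M (\<lambda>x. g x - f i x)) \<longlonglongrightarrow> 0"
proof -
  have "(\<lambda>i. \<integral>\<^sup>+x. ennreal ((g x - f i x)\<^sup>2) \<partial>M) \<longlonglongrightarrow> (\<integral>\<^sup>+x. 0 \<partial>M)"
  proof (rule nn_integral_dominated_convergence)
    show "AE x in M. ennreal ((g x - f i x)\<^sup>2) \<le> ennreal ((w x)\<^sup>2)" for i
      using le[of i]
    proof eventually_elim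
      case (elim x)
      then have "\<bar>g x - f i x\<bar> \<le> \<bar>w x\<bar>"
        by linarith
      then show ?case
        by (intro ennreal_leI) (simp add: abs_le_square_iff)
    qed
    show "(\<integral>\<^sup>+x. ennreal ((w x)\<^sup>2) \<partial>M) < \<infinity>"
      using w by (simp add: sqnorm_def)
    show "AE x in M. (\<lambda>i. ennreal ((g x - f i x)\<^sup>2)) \<longlonglongrightarrow> 0"
      using lim
    proof eventually_elim
      case (elim x)
      have "(\<lambda>i. ennreal ((g x - f i x)\<^sup>2)) \<longlonglongrightarrow> ennreal ((g x - g x)\<^sup>2)"
        by (intro tendsto_ennrealI tendsto_intros elim)
      then show ?case
        by simp
    qed
  qed auto
  then show ?thesis
    by (simp add: sqnorm_def)
qed

definition step_approximable :: "(real ^ 'k \<Rightarrow> real) \<Rightarrow> bool" where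
  "step_approximable f \<longleftrightarrow> f \<in> borel_measurable borel \<and>
    (\<exists>n \<tau> a. (\<forall>m::nat. off_diagonal_grid (n m) (\<tau> m) (a m)) \<and>
      (\<lambda>m. sqnorm lborel (\<lambda>x. f x - step_function (n m) (\<tau> m) (a m) x)) \<longlonglongrightarrow> 0)"

lemma step_approximable_zero: "step_approximable (\<lambda>x :: real ^ 'k. 0)"
proof -
  have "off_diagonal_grid 0 (\<lambda>_. 0) (\<lambda>i :: 'k \<Rightarrow> nat. 0)"
    by (auto simp: off_diagonal_grid_def intro!: strict_mono_onI)
  then show ?thesis
    unfolding step_approximable_def
    by (intro conjI exI[of _ "\<lambda>_. 0"] exI[of _ "\<lambda>_ _. 0"] exI[of _ "\<lambda>_ _. 0"])
      (auto simp: step_function_def sqnorm_def)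
qed

lemma step_approximable_linear:
  assumes "step_approximable f" "step_approximable g"
  shows "step_approximable (\<lambda>x. c * f x + d * g x)"
proof -
  obtain n \<tau> a where f: "\<And>m. off_diagonal_grid (n m) (\<tau> m) (a m)"
    "(\<lambda>m. sqnorm lborel (\<lambda>x. f x - step_function (n m) (\<tau> m) (a m) x)) \<longlonglongrightarrow> 0"
    using assms(1) unfolding step_approximable_def by blast
  obtain n' \<tau>' a' where g: "\<And>m. off_diagonal_grid (n' m) (\<tau>' m) (a' m)"
    "(\<lambda>m. sqnorm lborel (\<lambda>x. g x - step_function (n' m) (\<tau>' m) (a' m) x)) \<longlonglongrightarrow> 0"
    using assms(2) unfolding step_approximable_def by blast
  have [measurable]: "f \<in> borel_measurable borel" "g \<in> borel_measurable borel"
    using assms by (auto simp: step_approximable_def)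
  have "\<exists>N \<rho> e. off_diagonal_grid N \<rho> e \<and> (\<forall>x. step_function N \<rho> e x =
      c * step_function (n m) (\<tau> m) (a m) x + d * step_function (n' m) (\<tau>' m) (a' m) x)" for m
    using off_diagonal_steps_linear[OF f(1)[of m] g(1)[of m]] by blast
  then obtain N \<rho> e where e: "\<And>m. off_diagonal_grid (N m) (\<rho> m) (e m)"
    "\<And>m x. step_function (N m) (\<rho> m) (e m) x =
      c * step_function (n m) (\<tau> m) (a m) x + d * step_function (n' m) (\<tau>' m) (a' m) x"
    by metis
  have "(\<lambda>m. sqnorm lborel (\<lambda>x. c * (f x - step_function (n m) (\<tau> m) (a m) x) +
      d * (g x - step_function (n' m) (\<tau>' m) (a' m) x))) \<longlonglongrightarrow> 0"
    by (intro sqnorm_tendsto_add sqnorm_tendsto_cmult f g) auto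
  then have "(\<lambda>m. sqnorm lborel (\<lambda>x. c * f x + d * g x - step_function (N m) (\<rho> m) (e m) x)) \<longlonglongrightarrow> 0"
    by (simp add: e algebra_simps)
  then show ?thesis
    unfolding step_approximable_def using e(1) by auto
qed

text \<open>A diagonal choice: for each \<open>i\<close>, one step function whose squared distance
  from \<open>f i\<close> is below 1/(i+1).\<close>

lemma step_approximable_limit:
  fixes f :: "nat \<Rightarrow> real ^ 'k \<Rightarrow> real"
  assumes app: "\<And>i. step_approximable (f i)" and [measurable]: "g \<in> borel_measurable borel"
    and lim: "(\<lambda>i. sqnorm lborel (\<lambda>x. g x - f i x)) \<longlonglongrightarrow> 0"
  shows "step_approximable g"
proof -
  have [measurable]: "f i \<in> borel_measurable borel" for i
    using app by (auto simp: step_approximable_def)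
  have "\<exists>n \<tau> a. off_diagonal_grid n \<tau> a \<and>
      sqnorm lborel (\<lambda>x. f i x - step_function n \<tau> a x) < ennreal (1 / Suc i)" for i
  proof -
    obtain n \<tau> a where *: "\<And>m. off_diagonal_grid (n m) (\<tau> m) (a m)"
      "(\<lambda>m. sqnorm lborel (\<lambda>x. f i x - step_function (n m) (\<tau> m) (a m) x)) \<longlonglongrightarrow> 0"
      using app[of i] unfolding step_approximable_def by blast
    have "\<forall>\<^sub>F m in sequentially. sqnorm lborel (\<lambda>x. f i x - step_function (n m) (\<tau> m) (a m) x) < ennreal (1 / Suc i)"
      by (rule order_tendstoD[OF *(2)]) simp
    then obtain m where "sqnorm lborel (\<lambda>x. f i x - step_function (n m) (\<tau> m) (a m) x) < ennreal (1 / Suc i)"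
      by (auto simp: eventually_sequentially)
    with *(1) show ?thesis
      by blast
  qed
  then obtain n \<tau> a where grid: "\<And>i. off_diagonal_grid (n i) (\<tau> i) (a i)"
    and lt: "\<And>i. sqnorm lborel (\<lambda>x. f i x - step_function (n i) (\<tau> i) (a i) x) < ennreal (1 / Suc i)"
    by metis
  have "(\<lambda>i. ennreal (1 / Suc i)) \<longlonglongrightarrow> 0"
    unfolding ennreal_0[symmetric] by (intro tendsto_ennrealI LIMSEQ_Suc lim_1_over_n)
  from ennreal_tendsto_0_le[OF this less_imp_le[OF lt]]
  have "(\<lambda>i. sqnorm lborel (\<lambda>x. f i x - step_function (n i) (\<tau> i) (a i) x)) \<longlonglongrightarrow> 0" .
  from sqnorm_tendsto_add[OF lim this]
  have "(\<lambda>i. sqnorm lborel (\<lambda>x. g x - step_function (n i) (\<tau> i) (a i) x)) \<longlonglongrightarrow> 0"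
    by simp
  then show ?thesis
    unfolding step_approximable_def using grid by auto
qed

text \<open>The diagonals are finitely many hyperplanes, hence null. This is why forbidding diagonal
  boxes costs nothing in square mean.\<close>

lemma AE_lborel_distinct_coordinates: "AE x in lborel. inj (\<lambda>j. (x :: real ^ 'k) $ j)"
proof -
  have "AE x in lborel. (x :: real ^ 'k) $ i \<noteq> x $ j" if "i \<noteq> j" for i j :: 'k
  proof (rule AE_I')
    have "negligible {x. (axis i 1 - axis j 1 :: real ^ 'k) \<bullet> x = 0}"
      using that by (intro negligible_hyperplane) (auto simp: axis_eq_axis)
    moreover have "{x. (axis i 1 - axis j 1 :: real ^ 'k) \<bullet> x = 0} = {x. x $ i = x $ j}"
      by (auto simp: inner_diff_left inner_axis')
    ultimately have "{x :: real ^ 'k. x $ i = x $ j} \<in> null_sets lebesgue"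
      by (simp add: negligible_iff_null_sets)
    \<comment> \<open>Negligibility concerns the completed measure; since the hyperplane is Borel,
      it is null for \<open>lborel\<close> too.\<close>
    then show "{x :: real ^ 'k. x $ i = x $ j} \<in> null_sets lborel"
      by (subst (asm) null_sets_completion_iff) measurable
  qed auto
  then have "AE x in lborel. \<forall>i\<in>UNIV. \<forall>j\<in>UNIV. i \<noteq> j \<longrightarrow> (x :: real ^ 'k) $ i \<noteq> x $ j"
    by (intro AE_finite_allI) auto
  then show ?thesis
    by eventually_elim (auto simp: inj_def)
qed

text \<open>A window of finite measure, left-open and right-closed like the cells, so that a grid on
  [l, u] tiles it exactly.\<close>

definition half_open_cube :: "real \<Rightarrow> real \<Rightarrow> (real ^ 'k) set" where
  "half_open_cube l u = {x. \<forall>j. x $ j \<in> {l<..u}}"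

lemma half_open_cube_borel [measurable]: "half_open_cube l u \<in> sets borel"
  unfolding half_open_cube_def by measurable

lemma sqnorm_half_open_cube:
  "sqnorm lborel (\<lambda>x :: real ^ 'k. c * indicator (half_open_cube l u) x) < \<infinity>"
proof -
  have "bounded (half_open_cube l u :: (real ^ 'k) set)"
    by (rule bounded_subset[OF bounded_cbox[of "\<chi> i. l" "\<chi> i. u"]])
      (auto simp: half_open_cube_def mem_box_cart less_imp_le)
  then have "emeasure lborel (half_open_cube l u :: (real ^ 'k) set) < \<infinity>"
    by (rule emeasure_bounded_finite)
  moreover have "sqnorm lborel (indicator (half_open_cube l u) :: real ^ 'k \<Rightarrow> real) =
      emeasure lborel (half_open_cube l u :: (real ^ 'k) set)"
  proof -
    have "ennreal ((indicator (half_open_cube l u) x :: real)\<^sup>2) = indicator (half_open_cube l u) x" for x :: "real ^ 'k"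
      by (auto split: split_indicator)
    then show ?thesis
      unfolding sqnorm_def by simp
  qed
  ultimately have "sqnorm lborel (indicator (half_open_cube l u) :: real ^ 'k \<Rightarrow> real) < \<infinity>"
    by simp
  then show ?thesis
    by (subst sqnorm_cmult) (auto simp: ennreal_mult_less_top)
qed

text \<open>Lower corners of the grid boxes converge strictly from below, hence the half-open box
  \<open>{x. \<forall>j. l < x\<^sub>j \<le> min u c\<^sub>j}\<close> is the pointwise limit, off the diagonals, of the step functions
  whose coefficients test the lower corners.\<close>

lemma step_approximable_box:
  fixes c :: "real ^ 'k"
  assumes "l < u"
  shows "step_approximable (indicator ({x. \<forall>j. x $ j \<le> c $ j} \<inter> half_open_cube l u))"
proof -
  let ?B = "{x. \<forall>j. x $ j \<le> c $ j} \<inter> half_open_cube l u :: (real ^ 'k) set"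
  define \<delta> where "\<delta> m = (u - l) / Suc m" for m
  define \<tau> where "\<tau> m r = l + real r * \<delta> m" for m r
  define a where "a m i = (if inj i \<and> (\<forall>j. \<tau> m (i j) < c $ j) then 1 else 0 :: real)" for m and i :: "'k \<Rightarrow> nat"
  let ?s = "\<lambda>m. step_function (Suc m) (\<tau> m) (a m)"
  have \<delta>: "\<delta> m > 0" for m
    using assms by (simp add: \<delta>_def)
  have \<delta>_lim: "\<delta> \<longlonglongrightarrow> 0"
    unfolding \<delta>_def using LIMSEQ_Suc[OF lim_const_over_n[of "u - l"]] by simp
  have [measurable]: "?B \<in> sets borel"
    by measurable
  have mono: "strict_mono_on {..Suc m} (\<tau> m)" for m
    using \<delta>[of m] by (auto intro!: strict_mono_onI simp: \<tau>_def)
  have last: "\<tau> m (Suc m) = u" for m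
    by (simp add: \<tau>_def \<delta>_def)
  have \<tau>_Suc: "\<tau> m (Suc r) = \<tau> m r + \<delta> m" for m r
    by (simp add: \<tau>_def algebra_simps)
  have outside: "?s m x = 0" if "x \<notin> half_open_cube l u" for m x
  proof (rule step_function_outside)
    fix i :: "'k \<Rightarrow> nat"
    assume i: "i \<in> UNIV \<rightarrow> {..<Suc m}"
    obtain j where j: "x $ j \<notin> {l<..u}"
      using \<open>x \<notin> half_open_cube l u\<close> unfolding half_open_cube_def by blast
    have "i j < Suc m"
      using i by auto
    then have "\<tau> m (Suc (i j)) \<le> u" "l \<le> \<tau> m (i j)"
      using strict_mono_on_leD[OF mono[of m], of "Suc (i j)" "Suc m"] last[of m] \<delta>[of m]
      by (auto simp: \<tau>_def)
    with j show "\<exists>j. x $ j \<notin> {\<tau> m (i j)<..\<tau> m (Suc (i j))}"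
      by (intro exI[of _ j]) auto
  qed
  have inside: "\<exists>i\<in>UNIV \<rightarrow> {..<Suc m}. \<forall>j. x $ j \<in> {\<tau> m (i j)<..\<tau> m (Suc (i j))}"
    if "x \<in> half_open_cube l u" for m x
  proof -
    have "\<exists>r<Suc m. x $ j \<in> {\<tau> m r<..\<tau> m (Suc r)}" for j
    proof -
      have x: "l < x $ j" "x $ j \<le> u"
        using that by (auto simp: half_open_cube_def)
      \<comment> \<open>The first grid point not below \<open>x $ j\<close>; its predecessor is the
        left end of the cell sought.\<close>
      define r where "r = (LEAST r. x $ j \<le> \<tau> m r)"
      have r: "x $ j \<le> \<tau> m r" and r_le: "r \<le> Suc m"
        unfolding r_def using x last[of m] by (auto intro: LeastI[of _ "Suc m"] Least_le)
      have "r \<noteq> 0"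
      proof
        assume "r = 0"
        then show False
          using r x by (simp add: \<tau>_def)
      qed
      then obtain q where q: "r = Suc q"
        by (cases r) auto
      have "\<not> x $ j \<le> \<tau> m q"
        using not_less_Least[of q "\<lambda>r. x $ j \<le> \<tau> m r"] q by (simp add: r_def)
      with r r_le q show ?thesis
        by (intro exI[of _ q]) auto
    qed
    then obtain i where "\<forall>j. i j < Suc m \<and> x $ j \<in> {\<tau> m (i j)<..\<tau> m (Suc (i j))}"
      by metis
    then show ?thesis
      by (intro bexI[of _ i]) auto
  qed
  have bound: "\<bar>indicator ?B x - ?s m x\<bar> \<le> 1 * indicator (half_open_cube l u) x" for m x
  proof (cases "x \<in> half_open_cube l u")
    case True
    obtain i where "i \<in> UNIV \<rightarrow> {..<Suc m}" "\<forall>j. x $ j \<in> {\<tau> m (i j)<..\<tau> m (Suc (i j))}"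
      using inside[OF True] by blast
    then have "?s m x = a m i"
      by (intro step_function_in_box[OF mono]) auto
    then show ?thesis
      using True by (auto simp: a_def indicator_def)
  qed (auto simp: outside)
  have lim: "(\<lambda>m. ?s m x) \<longlonglongrightarrow> indicator ?B x" if inj: "inj (\<lambda>j. x $ j)" for x
  proof (cases "x \<in> half_open_cube l u")
    case True
    \<comment> \<open>\<open>e\<close> bounds from below the gaps between distinct coordinates and
      the excess of every coordinate beyond \<open>c\<close>. Once the mesh is below
      \<open>e\<close>, no two coordinates share a cell and the lower corner decides correctly
      whether x_j is at most c_j. The element 1 keeps the set nonempty.\<close>
    define e where "e = Min (insert 1 ((\<lambda>(i, j). \<bar>x $ i - x $ j\<bar>) ` {(i, j). i \<noteq> j}
      \<union> (\<lambda>j. x $ j - c $ j) ` {j. x $ j > c $ j}))"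
    have "e > 0"
      unfolding e_def using inj by (subst Min_gr_iff) (auto simp: inj_eq)
    have e1: "e \<le> \<bar>x $ i - x $ j\<bar>" if "i \<noteq> j" for i j
      unfolding e_def using that by (intro Min_le) auto
    have e2: "e \<le> x $ j - c $ j" if "x $ j > c $ j" for j
      unfolding e_def using that by (intro Min_le) auto
    have "\<forall>\<^sub>F m in sequentially. \<delta> m < e"
      using \<delta>_lim \<open>e > 0\<close> by (rule order_tendstoD)
    then have "\<forall>\<^sub>F m in sequentially. ?s m x = indicator ?B x"
    proof eventually_elim
      case (elim m)
      obtain i where i: "i \<in> UNIV \<rightarrow> {..<Suc m}" "\<forall>j. x $ j \<in> {\<tau> m (i j)<..\<tau> m (Suc (i j))}"
        using inside[OF True] by blast
      have near: "\<tau> m (i j) < x $ j" "x $ j - \<tau> m (i j) \<le> \<delta> m" for j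
        using i(2)[rule_format, of j] by (auto simp: \<tau>_Suc)
      have "inj i"
      proof (rule injI, rule ccontr)
        fix p q assume "i p = i q" "p \<noteq> q"
        then show False
          using e1[of p q] near[of p] near[of q] elim by auto
      qed
      moreover have "(\<forall>j. \<tau> m (i j) < c $ j) \<longleftrightarrow> (\<forall>j. x $ j \<le> c $ j)"
      proof (intro iff_allI)
        show "\<tau> m (i j) < c $ j \<longleftrightarrow> x $ j \<le> c $ j" for j
          using near[of j] e2[of j] elim by linarith
      qed
      ultimately have "a m i = indicator ?B x"
        using True by (auto simp: a_def indicator_def)
      moreover have "?s m x = a m i"
        using i by (intro step_function_in_box[OF mono]) auto
      ultimately show ?case
        by simp
    qed
    then show ?thesis
      by (rule tendsto_eventually)
  qed (simp add: outside)
  have "(\<lambda>m. sqnorm lborel (\<lambda>x. indicator ?B x - ?s m x)) \<longlonglongrightarrow> 0"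
  proof (rule sqnorm_dominated_convergence)
    show "sqnorm lborel (\<lambda>x :: real ^ 'k. 1 * indicator (half_open_cube l u) x) < \<infinity>"
      by (rule sqnorm_half_open_cube)
    show "AE x in lborel. (\<lambda>m. ?s m x) \<longlonglongrightarrow> indicator ?B x"
      using AE_lborel_distinct_coordinates by eventually_elim (rule lim)
    show "AE x in lborel. \<bar>indicator ?B x - ?s m x\<bar> \<le> 1 * indicator (half_open_cube l u) x" for m
      by (intro AE_I2 bound)
  qed auto
  moreover have "off_diagonal_grid (Suc m) (\<tau> m) (a m)" for m
    using mono by (auto simp: off_diagonal_grid_def a_def)
  ultimately show ?thesis
    unfolding step_approximable_def
    by (intro conjI exI[of _ Suc] exI[of _ \<tau>] exI[of _ a]) auto
qed

text \<open>A Dynkin argument: lower orthants form an intersection-stable generator of the Borel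
  sets. Complements follow by linearity. A finite disjoint union is an exact sum of indicators, and
  a countable one is its limit, dominated by the indicator of the window.\<close>

lemma step_approximable_indicator:
  fixes A :: "(real ^ 'k) set"
  assumes A: "A \<in> sets borel" and "l < u"
  shows "step_approximable (indicator (A \<inter> half_open_cube l u))"
proof -
  let ?\<Omega> = "half_open_cube l u :: (real ^ 'k) set"
  let ?G = "range (\<lambda>c. {x :: real ^ 'k. \<forall>j. x $ j \<le> c $ j})"
  have gen: "sets borel = sigma_sets UNIV ?G"
  proof -
    have "(\<lambda>c. {x :: real ^ 'k. \<forall>j. x $ j \<le> c $ j}) = atMost"
      by (auto simp: fun_eq_iff less_eq_vec_def)
    then show ?thesis
      unfolding borel_eq_atMost by (simp only: sets_measure_of_conv) simp
  qed
  have "Int_stable ?G"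
  proof (rule Int_stableI_image)
    fix c d :: "real ^ 'k"
    show "\<exists>e\<in>UNIV. {x :: real ^ 'k. \<forall>j. x $ j \<le> c $ j} \<inter> {x. \<forall>j. x $ j \<le> d $ j} = {x. \<forall>j. x $ j \<le> e $ j}"
      by (intro bexI[of _ "\<chi> j. min (c $ j) (d $ j)"]) auto
  qed
  moreover have "?G \<subseteq> Pow UNIV"
    by simp
  moreover have "A \<in> sigma_sets UNIV ?G"
    using A unfolding gen .
  ultimately show ?thesis
  proof (induct A rule: sigma_sets_induct_disjoint)
    case (basic A)
    then show ?case
      using step_approximable_box[OF \<open>l < u\<close>] by auto
  next
    case empty
    show ?case
      using step_approximable_zero by (simp add: indicator_def[abs_def])
  next
    case (compl A)
    \<comment> \<open>Complements are taken within the window, which is itself a box: every corner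
      coordinate is set to \<open>u\<close>.\<close>
    have "{x. \<forall>j. x $ j \<le> (\<chi> j. u) $ j} \<inter> ?\<Omega> = UNIV \<inter> ?\<Omega>"
      by (auto simp: half_open_cube_def)
    from step_approximable_box[OF \<open>l < u\<close>, of "(\<chi> j. u) :: real ^ 'k", unfolded this]
    have C: "step_approximable (indicator (UNIV \<inter> ?\<Omega>) :: real ^ 'k \<Rightarrow> real)" .
    have "indicator ((UNIV - A) \<inter> ?\<Omega>) = (\<lambda>x. 1 * indicator (UNIV \<inter> ?\<Omega>) x + (-1) * indicator (A \<inter> ?\<Omega>) x :: real)"
      by (auto simp: fun_eq_iff split: split_indicator)
    then show ?case
      using step_approximable_linear[OF C compl(2), of 1 "-1"] by simp
  next
    case (union A)
    have A_borel [measurable]: "A i \<in> sets borel" for i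
      using union(2) unfolding gen by auto
    have sum: "step_approximable (indicator ((\<Union>i<n. A i) \<inter> ?\<Omega>) :: real ^ 'k \<Rightarrow> real)" for n
    proof (induction n)
      case 0
      show ?case
        using step_approximable_zero by (simp add: indicator_def[abs_def])
    next
      case (Suc n)
      have "(\<Union>i<n. A i) \<inter> A n = {}"
        using union(1) by (auto simp: disjoint_family_on_def) (metis disjoint_iff less_irrefl)
      then have "indicator ((\<Union>i<Suc n. A i) \<inter> ?\<Omega>) =
          (\<lambda>x. 1 * indicator ((\<Union>i<n. A i) \<inter> ?\<Omega>) x + 1 * indicator (A n \<inter> ?\<Omega>) x :: real)"
        by (auto simp: fun_eq_iff lessThan_Suc split: split_indicator)
      then show ?case
        using step_approximable_linear[OF Suc union(3)[of n], of 1 1] by simp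
    qed
    show ?case
    proof (rule step_approximable_limit[OF sum])
      show "(\<lambda>n. sqnorm lborel (\<lambda>x. indicator ((\<Union>i. A i) \<inter> ?\<Omega>) x - indicator ((\<Union>i<n. A i) \<inter> ?\<Omega>) x)) \<longlonglongrightarrow> 0"
      proof (rule sqnorm_dominated_convergence)
        show "sqnorm lborel (\<lambda>x. 1 * indicator ?\<Omega> x) < \<infinity>"
          by (rule sqnorm_half_open_cube)
        show "AE x in lborel. (\<lambda>n. indicator ((\<Union>i<n. A i) \<inter> ?\<Omega>) x) \<longlonglongrightarrow> (indicator ((\<Union>i. A i) \<inter> ?\<Omega>) x :: real)"
        proof (intro AE_I2)
          fix x
          have "(\<lambda>n. indicator (\<Union>i<n. A i) x * indicator ?\<Omega> x) \<longlonglongrightarrow> (indicator (\<Union>i. A i) x * indicator ?\<Omega> x :: real)"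
            by (intro tendsto_intros LIMSEQ_indicator_UN)
          then show "(\<lambda>n. indicator ((\<Union>i<n. A i) \<inter> ?\<Omega>) x) \<longlonglongrightarrow> (indicator ((\<Union>i. A i) \<inter> ?\<Omega>) x :: real)"
            by (simp add: indicator_inter_arith)
        qed
        show "AE x in lborel. \<bar>indicator ((\<Union>i. A i) \<inter> ?\<Omega>) x - indicator ((\<Union>i<n. A i) \<inter> ?\<Omega>) x\<bar>
            \<le> (1 * indicator ?\<Omega> x :: real)" for n
          by (intro AE_I2) (auto split: split_indicator)
      qed auto
    qed auto
qed
qed

lemma step_approximable_sum:
  assumes "finite I" "I \<noteq> {}" "\<And>y. y \<in> I \<Longrightarrow> step_approximable (f y)"
  shows "step_approximable (\<lambda>x. \<Sum>y\<in>I. f y x)"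
  using assms
proof (induction I rule: finite_ne_induct)
  case (insert y I)
  then show ?case
    using step_approximable_linear[of "f y" "\<lambda>x. \<Sum>y\<in>I. f y x" 1 1] by simp
qed auto

text \<open>Truncating simple approximations of \<open>f\<close> to growing cubes gives finite
  combinations of indicators covered by \<open>step_approximable_indicator\<close>; domination by a
  multiple of |f| yields convergence in square mean.\<close>

lemma step_approximable_square_integrable:
  fixes f :: "real ^ 'k \<Rightarrow> real"
  assumes "square_integrable lborel f"
  shows "step_approximable f"
proof -
  have [measurable]: "f \<in> borel_measurable borel" and sq: "sqnorm lborel f < \<infinity>"
    using assms by (auto simp: square_integrable_iff_sqnorm)
  obtain F where F: "\<And>i. simple_function lborel (F i)" "\<And>x. (\<lambda>i. F i x) \<longlonglongrightarrow> f x"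
    "\<And>i x. \<bar>F i x\<bar> \<le> 2 * \<bar>f x\<bar>"
    using borel_measurable_implies_sequence_metric[of f lborel 0] by auto
  \<comment> \<open>\<open>Suc i\<close> rather than \<open>i\<close>, so that the cube is
    nondegenerate already for i = 0.\<close>
  let ?\<Omega> = "\<lambda>i. half_open_cube (- real (Suc i)) (real (Suc i)) :: (real ^ 'k) set"
  have [measurable]: "F i \<in> borel_measurable borel" for i
    using borel_measurable_simple_function[OF F(1)] by simp
  have app: "step_approximable (\<lambda>x. F i x * indicator (?\<Omega> i) x)" for i
  proof -
    have fin: "finite (range (F i))"
      using simple_functionD(1)[OF F(1)[of i]] by simp
    have eq: "(\<lambda>x. F i x * indicator (?\<Omega> i) x) = (\<lambda>x. \<Sum>y\<in>range (F i). y * indicator (F i -` {y} \<inter> ?\<Omega> i) x)"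
    proof
      fix x
      have "(\<Sum>y\<in>range (F i). y * indicator (F i -` {y} \<inter> ?\<Omega> i) x) =
          (\<Sum>y\<in>range (F i). if y = F i x then y * indicator (?\<Omega> i) x else 0)"
        by (intro sum.cong) (auto split: split_indicator)
      then show "F i x * indicator (?\<Omega> i) x = (\<Sum>y\<in>range (F i). y * indicator (F i -` {y} \<inter> ?\<Omega> i) x)"
        using fin by simp
    qed
    show ?thesis
      unfolding eq
    proof (rule step_approximable_sum[OF fin])
      fix y
      have "F i -` {y} \<in> sets borel"
        using measurable_sets[of "F i" borel borel "{y}"] by simp
      then have "step_approximable (indicator (F i -` {y} \<inter> ?\<Omega> i) :: real ^ 'k \<Rightarrow> real)"
        by (intro step_approximable_indicator) auto
      from step_approximable_linear[OF this this, of y 0]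
      show "step_approximable (\<lambda>x. y * indicator (F i -` {y} \<inter> ?\<Omega> i) x)"
        by simp
    qed auto
  qed
  show ?thesis
  proof (rule step_approximable_limit[OF app])
    show "(\<lambda>i. sqnorm lborel (\<lambda>x. f x - F i x * indicator (?\<Omega> i) x)) \<longlonglongrightarrow> 0"
    proof (rule sqnorm_dominated_convergence)
      \<comment> \<open>The factor 3 is 1 + 2, from |f| and the bound 2|f| on the simple
        functions.\<close>
      show "sqnorm lborel (\<lambda>x. 3 * \<bar>f x\<bar>) < \<infinity>"
        using sq by (subst sqnorm_cmult) (auto simp: sqnorm_def ennreal_mult_less_top)
      show "AE x in lborel. \<bar>f x - F i x * indicator (?\<Omega> i) x\<bar> \<le> 3 * \<bar>f x\<bar>" for i
      proof (intro AE_I2)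
        show "\<bar>f x - F i x * indicator (?\<Omega> i) x\<bar> \<le> 3 * \<bar>f x\<bar>" for x
          using F(3)[of i x] by (auto split: split_indicator)
      qed
      show "AE x in lborel. (\<lambda>i. F i x * indicator (?\<Omega> i) x) \<longlonglongrightarrow> f x"
      proof (intro AE_I2)
        fix x :: "real ^ 'k"
        obtain n :: nat where n: "norm x < n"
          using reals_Archimedean2 by blast
        have "indicator (?\<Omega> i) x = (1 :: real)" if "i \<ge> n" for i
        proof -
          have "x $ j \<in> {- real (Suc i)<..real (Suc i)}" for j
            using component_le_norm_cart[of x j] n that by auto
          then show ?thesis
            by (simp add: half_open_cube_def)
        qed
        then have "\<forall>\<^sub>F i in sequentially. F i x = F i x * indicator (?\<Omega> i) x"
          by (auto simp: eventually_sequentially)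
        then show "(\<lambda>i. F i x * indicator (?\<Omega> i) x) \<longlonglongrightarrow> f x"
          using F(2)[of x] by (rule Lim_transform_eventually[rotated])
      qed
    qed auto
  qed auto
qed

section \<open>Multiple Wiener-Ito integrals\<close>

lemma square_integrable_linear:
  assumes "square_integrable M f" "square_integrable M g"
  shows "square_integrable M (\<lambda>x. c * f x + d * g x)"
proof -
  have [measurable]: "f \<in> borel_measurable M" "g \<in> borel_measurable M"
    and fin: "sqnorm M f < \<infinity>" "sqnorm M g < \<infinity>"
    using assms by (auto simp: square_integrable_iff_sqnorm)
  have "sqnorm M (\<lambda>x. c * f x + d * g x) \<le> 2 * (ennreal (c\<^sup>2) * sqnorm M f) + 2 * (ennreal (d\<^sup>2) * sqnorm M g)"
    using sqnorm_add_le[of "\<lambda>x. c * f x" M "\<lambda>x. d * g x"] by (simp add: sqnorm_cmult)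
  also have "\<dots> < \<infinity>"
    using fin by (auto simp: ennreal_mult_less_top)
  finally show ?thesis
    by (simp add: square_integrable_iff_sqnorm)
qed

lemma is_wiener_ito_iff_sqnorm:
  "is_wiener_ito M W f Y \<longleftrightarrow> square_integrable lborel f \<and> square_integrable M Y \<and>
     (\<exists>n \<tau> a. (\<forall>m::nat. off_diagonal_grid (n m) (\<tau> m) (a m)) \<and>
        (\<lambda>m. sqnorm lborel (\<lambda>x. f x - step_function (n m) (\<tau> m) (a m) x)) \<longlonglongrightarrow> 0 \<and>
        (\<lambda>m. sqnorm M (\<lambda>\<omega>. Y \<omega> - step_integral W (n m) (\<tau> m) (a m) \<omega>)) \<longlonglongrightarrow> 0)"
  by (simp add: is_wiener_ito_def sqnorm_def)

text \<open>On a common grid the difference is again an off-diagonal step function, so the bound for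
  single step integrals applies to it.\<close>

lemma sqnorm_step_integral_diff_le:
  fixes a b :: "('k::finite \<Rightarrow> nat) \<Rightarrow> real"
  assumes W: "brownian_motion M W" and grids: "off_diagonal_grid n \<tau> a" "off_diagonal_grid m \<sigma> b"
  shows "sqnorm M (\<lambda>\<omega>. step_integral W n \<tau> a \<omega> - step_integral W m \<sigma> b \<omega>) \<le>
    of_nat (CARD('k) ^ CARD('k)) *
    sqnorm lborel (\<lambda>x. step_function n \<tau> a x - step_function m \<sigma> b x)"
proof -
  have "\<exists>N \<rho> e. off_diagonal_grid N \<rho> e \<and>
      (\<forall>x. step_function N \<rho> e x = 1 * step_function n \<tau> a x + (-1) * step_function m \<sigma> b x) \<and>
      (\<forall>\<omega>. step_integral W N \<rho> e \<omega> = 1 * step_integral W n \<tau> a \<omega> + (-1) * step_integral W m \<sigma> b \<omega>)"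
    by (rule off_diagonal_steps_linear[OF grids])
  then obtain N \<rho> e where *: "off_diagonal_grid N \<rho> e"
    "\<And>x. step_function N \<rho> e x = 1 * step_function n \<tau> a x + (-1) * step_function m \<sigma> b x"
    "\<And>\<omega>. step_integral W N \<rho> e \<omega> = 1 * step_integral W n \<tau> a \<omega> + (-1) * step_integral W m \<sigma> b \<omega>"
    by blast
  have "step_function N \<rho> e = (\<lambda>x. step_function n \<tau> a x - step_function m \<sigma> b x)"
    "step_integral W N \<rho> e = (\<lambda>\<omega>. step_integral W n \<tau> a \<omega> - step_integral W m \<sigma> b \<omega>)"
    using *(2,3) by auto
  then show ?thesis
    using sqnorm_step_integral_le[OF W *(1)] by simp
qed

text \<open>Step functions are picked at squared distance below 4^-m from \<open>f\<close>; the
  bound on differences turns this into the geometric Cauchy rate that \<open>sqnorm_complete\<close>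
  asks for.\<close>

lemma is_wiener_ito_exists:
  fixes f :: "real ^ 'k \<Rightarrow> real"
  assumes W: "brownian_motion M W" and f: "square_integrable lborel f"
  shows "\<exists>Y. is_wiener_ito M W f Y"
proof -
  let ?K = "CARD('k) ^ CARD('k)"
  have [measurable]: "f \<in> borel_measurable borel" and f_fin: "sqnorm lborel f < \<infinity>"
    using f by (auto simp: square_integrable_iff_sqnorm)
  obtain n' \<tau>' a' where *: "\<And>m. off_diagonal_grid (n' m) (\<tau>' m) (a' m)"
      "(\<lambda>m. sqnorm lborel (\<lambda>x. f x - step_function (n' m) (\<tau>' m) (a' m) x)) \<longlonglongrightarrow> 0"
    using step_approximable_square_integrable[OF f] unfolding step_approximable_def by blast
  have "\<exists>n \<tau> a. off_diagonal_grid n \<tau> a \<and>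
      sqnorm lborel (\<lambda>x. f x - step_function n \<tau> a x) < ennreal ((1/4) ^ m)" for m
  proof -
    have "\<forall>\<^sub>F i in sequentially.
        sqnorm lborel (\<lambda>x. f x - step_function (n' i) (\<tau>' i) (a' i) x) < ennreal ((1/4) ^ m)"
      by (rule order_tendstoD[OF *(2)]) simp
    then obtain i where "sqnorm lborel (\<lambda>x. f x - step_function (n' i) (\<tau>' i) (a' i) x) < ennreal ((1/4) ^ m)"
      by (auto simp: eventually_sequentially)
    with *(1) show ?thesis
      by blast
  qed
  then obtain n \<tau> a where grid: "\<And>m. off_diagonal_grid (n m) (\<tau> m) (a m)"
    and lt: "\<And>m. sqnorm lborel (\<lambda>x. f x - step_function (n m) (\<tau> m) (a m) x) < ennreal ((1/4) ^ m)"
    by metis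
  let ?s = "\<lambda>m. step_function (n m) (\<tau> m) (a m)" and ?S = "\<lambda>m. step_integral W (n m) (\<tau> m) (a m)"
  have [measurable]: "?S m \<in> borel_measurable M" for m
    by (rule measurable_step_integral[OF W])
  \<comment> \<open>The 4 collects the 2 + 2 from the weak triangle inequality, as 4^-q is at most
    4^-p; \<open>?K\<close> is the constant of the bound for step integrals.\<close>
  have "sqnorm M (\<lambda>\<omega>. ?S q \<omega> - ?S p \<omega>) \<le> ennreal (real (4 * ?K) * (1/4) ^ p)" if "p \<le> q" for p q
  proof -
    have "sqnorm lborel (\<lambda>x. ?s q x - ?s p x) \<le>
        2 * sqnorm lborel (\<lambda>x. f x - ?s q x) + 2 * sqnorm lborel (\<lambda>x. f x - ?s p x)"
      using sqnorm_triangle[of "?s q" lborel f "?s p"] by (simp add: sqnorm_minus_commute[of _ f])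
    also have "\<dots> \<le> 2 * ennreal ((1/4) ^ q) + 2 * ennreal ((1/4) ^ p)"
      by (intro add_mono mult_left_mono less_imp_le lt) auto
    also have "\<dots> \<le> 2 * ennreal ((1/4) ^ p) + 2 * ennreal ((1/4) ^ p)"
      using that by (intro add_mono mult_left_mono ennreal_leI power_decreasing) auto
    also have "\<dots> = ennreal (4 * (1/4) ^ p)"
      by (simp add: ennreal_mult flip: distrib_right)
    finally have "sqnorm M (\<lambda>\<omega>. ?S q \<omega> - ?S p \<omega>) \<le> of_nat ?K * ennreal (4 * (1/4) ^ p)"
      by (intro order_trans[OF sqnorm_step_integral_diff_le[OF W grid grid]] mult_left_mono) auto
    also have "\<dots> = ennreal (real ?K * (4 * (1/4) ^ p))"
      unfolding ennreal_of_nat_eq_real_of_nat by (rule ennreal_mult[symmetric]) auto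
    also have "real ?K * (4 * (1/4) ^ p) = real (4 * ?K) * (1/4) ^ p"
      by simp
    finally show ?thesis .
  qed
  from sqnorm_complete[of ?S, OF _ this]
  obtain Y where [measurable]: "Y \<in> borel_measurable M" and Y: "(\<lambda>m. sqnorm M (\<lambda>\<omega>. Y \<omega> - ?S m \<omega>)) \<longlonglongrightarrow> 0"
    by auto
  \<comment> \<open>A single approximant at finite distance already gives \<open>Y\<close> a finite
    second moment.\<close>
  have "\<forall>\<^sub>F m in sequentially. sqnorm M (\<lambda>\<omega>. Y \<omega> - ?S m \<omega>) < 1"
    by (rule order_tendstoD[OF Y]) simp
  then obtain m where m: "sqnorm M (\<lambda>\<omega>. Y \<omega> - ?S m \<omega>) < 1"
    by (auto simp: eventually_sequentially)
  have "strict_mono_on {..n m} (\<tau> m)"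
    using grid[of m] by (simp add: off_diagonal_grid_def)
  then have "of_nat ?K * sqnorm lborel (?s m) < \<infinity>"
    by (simp add: sqnorm_step_function ennreal_mult_less_top of_nat_less_top flip: of_nat_power)
  with sqnorm_step_integral_le[OF W grid[of m]] have S_fin: "sqnorm M (?S m) < \<infinity>"
    by (rule order_le_less_trans)
  have "sqnorm M Y \<le> 2 * sqnorm M (\<lambda>\<omega>. Y \<omega> - ?S m \<omega>) + 2 * sqnorm M (?S m)"
    using sqnorm_add_le[of "\<lambda>\<omega>. Y \<omega> - ?S m \<omega>" M "?S m"] by simp
  also have "\<dots> < \<infinity>"
    using S_fin order_less_trans[OF m, of top] by (auto simp: ennreal_mult_less_top)
  finally have "square_integrable M Y"
    by (simp add: square_integrable_iff_sqnorm)
  moreover have "(\<lambda>m. sqnorm lborel (\<lambda>x. f x - ?s m x)) \<longlonglongrightarrow> 0"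
  proof (rule ennreal_tendsto_0_le)
    show "(\<lambda>m. ennreal ((1/4) ^ m)) \<longlonglongrightarrow> 0"
      unfolding ennreal_0[symmetric] by (intro tendsto_ennrealI LIMSEQ_power_zero) simp
  qed (rule less_imp_le[OF lt])
  ultimately show ?thesis
    unfolding is_wiener_ito_iff_sqnorm using f grid Y by blast
qed

text \<open>The definition supplies only some approximating sequence; here every sequence of step
  functions tending to \<open>f\<close> is seen to do. Hence one sequence can be used for integrals
  against two different Brownian motions.\<close>

lemma is_wiener_ito_limit:
  fixes f :: "real ^ 'k \<Rightarrow> real"
  assumes W: "brownian_motion M W" and Y: "is_wiener_ito M W f Y"
    and grid: "\<And>m::nat. off_diagonal_grid (n m) (\<tau> m) (a m)"
    and lim: "(\<lambda>m. sqnorm lborel (\<lambda>x. f x - step_function (n m) (\<tau> m) (a m) x)) \<longlonglongrightarrow> 0"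
  shows "(\<lambda>m. sqnorm M (\<lambda>\<omega>. Y \<omega> - step_integral W (n m) (\<tau> m) (a m) \<omega>)) \<longlonglongrightarrow> 0"
proof -
  obtain n' \<tau>' a' where *: "\<And>m::nat. off_diagonal_grid (n' m) (\<tau>' m) (a' m)"
      "(\<lambda>m. sqnorm lborel (\<lambda>x. f x - step_function (n' m) (\<tau>' m) (a' m) x)) \<longlonglongrightarrow> 0"
      "(\<lambda>m. sqnorm M (\<lambda>\<omega>. Y \<omega> - step_integral W (n' m) (\<tau>' m) (a' m) \<omega>)) \<longlonglongrightarrow> 0"
    using Y unfolding is_wiener_ito_iff_sqnorm by blast
  let ?s = "\<lambda>m. step_function (n m) (\<tau> m) (a m)" and ?S = "\<lambda>m. step_integral W (n m) (\<tau> m) (a m)"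
  let ?s' = "\<lambda>m. step_function (n' m) (\<tau>' m) (a' m)" and ?S' = "\<lambda>m. step_integral W (n' m) (\<tau>' m) (a' m)"
  have [measurable]: "?S m \<in> borel_measurable M" "?S' m \<in> borel_measurable M" for m
    by (rule measurable_step_integral[OF W])+
  have [measurable]: "f \<in> borel_measurable borel" "Y \<in> borel_measurable M"
    using Y by (auto simp: is_wiener_ito_iff_sqnorm square_integrable_iff_sqnorm)
  have "(\<lambda>m. sqnorm lborel (\<lambda>x. (-1) * (f x - ?s' m x) + (f x - ?s m x))) \<longlonglongrightarrow> 0"
    by (intro sqnorm_tendsto_add sqnorm_tendsto_cmult * lim) auto
  then have "(\<lambda>m. sqnorm lborel (\<lambda>x. ?s' m x - ?s m x)) \<longlonglongrightarrow> 0"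
    by simp
  then have "(\<lambda>m. of_nat (CARD('k) ^ CARD('k)) * sqnorm lborel (\<lambda>x. ?s' m x - ?s m x)) \<longlonglongrightarrow> 0"
    by (rule ennreal_cmult_tendsto_0) (simp add: of_nat_less_top flip: of_nat_power)
  then have "(\<lambda>m. sqnorm M (\<lambda>\<omega>. ?S' m \<omega> - ?S m \<omega>)) \<longlonglongrightarrow> 0"
    by (rule ennreal_tendsto_0_le) (rule sqnorm_step_integral_diff_le[OF W *(1) grid])
  then have "(\<lambda>m. sqnorm M (\<lambda>\<omega>. (Y \<omega> - ?S' m \<omega>) + (?S' m \<omega> - ?S m \<omega>))) \<longlonglongrightarrow> 0"
    by (intro sqnorm_tendsto_add *) auto
  then show ?thesis
    by simp
qed

text \<open>Needed because kernel increments are identified only almost everywhere.\<close>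

lemma is_wiener_ito_cong_AE:
  assumes Y: "is_wiener_ito M W f Y" and eq: "AE x in lborel. f x = g x"
    and [measurable]: "g \<in> borel_measurable borel"
  shows "is_wiener_ito M W g Y"
proof -
  have "sqnorm lborel (\<lambda>x. f x - s x) = sqnorm lborel (\<lambda>x. g x - s x)" for s
    using eq by (intro sqnorm_cong_AE) auto
  moreover have "sqnorm lborel f = sqnorm lborel g"
    using eq by (rule sqnorm_cong_AE)
  ultimately show ?thesis
    using Y by (simp add: is_wiener_ito_iff_sqnorm square_integrable_iff_sqnorm)
qed

lemma is_wiener_ito_linear:
  assumes W: "brownian_motion M W" and Y: "is_wiener_ito M W f Y" and Z: "is_wiener_ito M W g Z"
  shows "is_wiener_ito M W (\<lambda>x. c * f x + d * g x) (\<lambda>\<omega>. c * Y \<omega> + d * Z \<omega>)"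
proof -
  obtain n \<tau> a where f: "\<And>m::nat. off_diagonal_grid (n m) (\<tau> m) (a m)"
      "(\<lambda>m. sqnorm lborel (\<lambda>x. f x - step_function (n m) (\<tau> m) (a m) x)) \<longlonglongrightarrow> 0"
      "(\<lambda>m. sqnorm M (\<lambda>\<omega>. Y \<omega> - step_integral W (n m) (\<tau> m) (a m) \<omega>)) \<longlonglongrightarrow> 0"
    using Y unfolding is_wiener_ito_iff_sqnorm by blast
  obtain n' \<tau>' a' where g: "\<And>m::nat. off_diagonal_grid (n' m) (\<tau>' m) (a' m)"
      "(\<lambda>m. sqnorm lborel (\<lambda>x. g x - step_function (n' m) (\<tau>' m) (a' m) x)) \<longlonglongrightarrow> 0"
      "(\<lambda>m. sqnorm M (\<lambda>\<omega>. Z \<omega> - step_integral W (n' m) (\<tau>' m) (a' m) \<omega>)) \<longlonglongrightarrow> 0"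
    using Z unfolding is_wiener_ito_iff_sqnorm by blast
  have [measurable]: "f \<in> borel_measurable borel" "Y \<in> borel_measurable M"
    "g \<in> borel_measurable borel" "Z \<in> borel_measurable M"
    using Y Z by (auto simp: is_wiener_ito_iff_sqnorm square_integrable_iff_sqnorm)
  have [measurable]: "step_integral W n \<tau> a \<in> borel_measurable M" for n \<tau> and a :: "('b \<Rightarrow> nat) \<Rightarrow> real"
    by (rule measurable_step_integral[OF W])
  have "\<exists>N \<rho> e. off_diagonal_grid N \<rho> e \<and>
      (\<forall>x. step_function N \<rho> e x =
        c * step_function (n m) (\<tau> m) (a m) x + d * step_function (n' m) (\<tau>' m) (a' m) x) \<and>
      (\<forall>\<omega>. step_integral W N \<rho> e \<omega> =
        c * step_integral W (n m) (\<tau> m) (a m) \<omega> + d * step_integral W (n' m) (\<tau>' m) (a' m) \<omega>)" for m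
    by (rule off_diagonal_steps_linear[OF f(1)[of m] g(1)[of m]])
  then obtain N \<rho> e where e: "\<And>m. off_diagonal_grid (N m) (\<rho> m) (e m)"
    "\<And>m x. step_function (N m) (\<rho> m) (e m) x =
      c * step_function (n m) (\<tau> m) (a m) x + d * step_function (n' m) (\<tau>' m) (a' m) x"
    "\<And>m \<omega>. step_integral W (N m) (\<rho> m) (e m) \<omega> =
      c * step_integral W (n m) (\<tau> m) (a m) \<omega> + d * step_integral W (n' m) (\<tau>' m) (a' m) \<omega>"
    by metis
  have "(\<lambda>m. sqnorm lborel (\<lambda>x. c * (f x - step_function (n m) (\<tau> m) (a m) x) +
      d * (g x - step_function (n' m) (\<tau>' m) (a' m) x))) \<longlonglongrightarrow> 0"
    by (intro sqnorm_tendsto_add sqnorm_tendsto_cmult f g) auto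
  then have "(\<lambda>m. sqnorm lborel (\<lambda>x. c * f x + d * g x - step_function (N m) (\<rho> m) (e m) x)) \<longlonglongrightarrow> 0"
    by (simp add: e algebra_simps)
  moreover have "(\<lambda>m. sqnorm M (\<lambda>\<omega>. c * (Y \<omega> - step_integral W (n m) (\<tau> m) (a m) \<omega>) +
      d * (Z \<omega> - step_integral W (n' m) (\<tau>' m) (a' m) \<omega>))) \<longlonglongrightarrow> 0"
    by (intro sqnorm_tendsto_add sqnorm_tendsto_cmult f g) auto
  then have "(\<lambda>m. sqnorm M (\<lambda>\<omega>. c * Y \<omega> + d * Z \<omega> - step_integral W (N m) (\<rho> m) (e m) \<omega>)) \<longlonglongrightarrow> 0"
    by (simp add: e algebra_simps)
  moreover have "square_integrable lborel (\<lambda>x. c * f x + d * g x)" "square_integrable M (\<lambda>\<omega>. c * Y \<omega> + d * Z \<omega>)"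
    using Y Z by (auto intro!: square_integrable_linear simp: is_wiener_ito_iff_sqnorm)
  ultimately show ?thesis
    unfolding is_wiener_ito_iff_sqnorm using e(1) by blast
qed

text \<open>The only place where the choice behind \<open>wiener_ito\<close> is opened; everything
  afterwards holds for arbitrary versions.\<close>

lemma wiener_ito_is_wiener_ito:
  "brownian_motion M W \<Longrightarrow> square_integrable lborel f \<Longrightarrow> is_wiener_ito M W f (wiener_ito M W f)"
  unfolding wiener_ito_def by (rule someI_ex[OF is_wiener_ito_exists])

section \<open>Affine changes of time\<close>

lemma brownian_motion_affine:
  assumes W: "brownian_motion M W" and a: "0 < a"
  shows "brownian_motion M (\<lambda>t \<omega>. (W (a * t + b) \<omega> - W b \<omega>) / sqrt a)"
proof -
  interpret prob_space M
    using W by (rule brownian_motion_prob_space)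
  have [measurable]: "W t \<in> borel_measurable M" for t
    using W by (rule brownian_motion_measurable)
  let ?V = "\<lambda>t \<omega>. (W (a * t + b) \<omega> - W b \<omega>) / sqrt a"
  \<comment> \<open>The form 0 + c * increment is the one expected by
    \<open>normal_density_affine\<close>.\<close>
  have diff: "?V t \<omega> - ?V s \<omega> = 0 + 1 / sqrt a * (W (a * t + b) \<omega> - W (a * s + b) \<omega>)" for s t \<omega>
    by (simp add: diff_divide_distrib)
  have "AE \<omega> in M. continuous_on UNIV (\<lambda>t. ?V t \<omega>)"
  proof -
    have "AE \<omega> in M. continuous_on UNIV (\<lambda>t. W t \<omega>)"
      using W by (simp add: brownian_motion_def)
    then show ?thesis
    proof eventually_elim
      case (elim \<omega>)
      have "continuous_on UNIV (\<lambda>t. W (a * t + b) \<omega>)"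
        by (rule continuous_on_compose2[OF elim]) (auto intro!: continuous_intros)
      then show ?case
        using a by (intro continuous_intros) auto
    qed
  qed
  moreover have "distributed M lborel (\<lambda>\<omega>. ?V t \<omega> - ?V s \<omega>) (normal_density 0 (sqrt (t - s)))"
    if "s < t" for s t
  proof -
    have "a * s + b < a * t + b"
      using a that by simp
    then have "distributed M lborel (\<lambda>\<omega>. W (a * t + b) \<omega> - W (a * s + b) \<omega>)
        (normal_density 0 (sqrt (a * t + b - (a * s + b))))"
      using W unfolding brownian_motion_def by blast
    from normal_density_affine[OF this, of "1 / sqrt a" 0]
    have "distributed M lborel (\<lambda>\<omega>. ?V t \<omega> - ?V s \<omega>)
        (normal_density 0 (\<bar>1 / sqrt a\<bar> * sqrt (a * t + b - (a * s + b))))"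
      unfolding diff using a that by simp
    moreover have "\<bar>1 / sqrt a\<bar> * sqrt (a * t + b - (a * s + b)) = sqrt (t - s)"
      using a by (simp add: real_sqrt_mult flip: right_diff_distrib)
    ultimately show ?thesis
      by simp
  qed
  moreover have "indep_vars (\<lambda>_. borel) (\<lambda>i \<omega>. ?V (\<tau> (Suc i)) \<omega> - ?V (\<tau> i) \<omega>) {..<n}"
    if \<tau>: "strict_mono_on {..n} \<tau>" for n \<tau>
  proof -
    have "strict_mono_on {..n} (\<lambda>i. a * \<tau> i + b)"
      using a strict_mono_onD[OF \<tau>] by (intro strict_mono_onI) auto
    then have "indep_vars (\<lambda>_. borel) (\<lambda>i \<omega>. W (a * \<tau> (Suc i) + b) \<omega> - W (a * \<tau> i + b) \<omega>) {..<n}"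
      using W unfolding brownian_motion_def by blast
    then show ?thesis
      unfolding diff by (rule indep_vars_compose2[where Y = "\<lambda>_ x. 0 + 1 / sqrt a * x"]) simp
  qed
  moreover have "prob_space M"
    by unfold_locales
  ultimately show ?thesis
    unfolding brownian_motion_def by simp
qed

lemma nn_integral_lborel_affine:
  fixes F :: "'a::euclidean_space \<Rightarrow> ennreal"
  assumes [measurable]: "F \<in> borel_measurable borel" and c: "c \<noteq> 0"
  shows "(\<integral>\<^sup>+x. F x \<partial>lborel) = ennreal (\<bar>c\<bar> ^ DIM('a)) * (\<integral>\<^sup>+x. F (t + c *\<^sub>R x) \<partial>lborel)"
  by (subst lborel_affine[OF c, of t])
    (simp add: nn_integral_density nn_integral_distr nn_integral_cmult)

lemma sqnorm_lborel_affine: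
  fixes f :: "'a::euclidean_space \<Rightarrow> real"
  assumes [measurable]: "f \<in> borel_measurable borel" and c: "c \<noteq> 0"
  shows "sqnorm lborel (\<lambda>x. f (t + c *\<^sub>R x)) = ennreal (1 / \<bar>c\<bar> ^ DIM('a)) * sqnorm lborel f"
proof -
  have "sqnorm lborel f = ennreal (\<bar>c\<bar> ^ DIM('a)) * sqnorm lborel (\<lambda>x. f (t + c *\<^sub>R x))"
    unfolding sqnorm_def by (rule nn_integral_lborel_affine[OF _ c]) measurable
  moreover have "ennreal (1 / \<bar>c\<bar> ^ DIM('a)) * (ennreal (\<bar>c\<bar> ^ DIM('a)) * z) = z" for z
    unfolding mult.assoc[symmetric] using c by (subst ennreal_mult[symmetric]) auto
  ultimately show ?thesis
    by simp
qed

lemma is_wiener_ito_affine: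
  fixes f :: "real ^ 'k \<Rightarrow> real"
  assumes W: "brownian_motion M W" and a: "0 < a" and Y: "is_wiener_ito M W f Y"
  shows "is_wiener_ito M (\<lambda>t \<omega>. (W (a * t + b) \<omega> - W b \<omega>) / sqrt a)
    (\<lambda>x. f ((\<chi> i. b) + a *\<^sub>R x)) (\<lambda>\<omega>. 1 / sqrt a ^ CARD('k) * Y \<omega>)"
proof -
  let ?V = "\<lambda>t \<omega>. (W (a * t + b) \<omega> - W b \<omega>) / sqrt a" and ?c = "1 / sqrt a ^ CARD('k)"
  obtain n \<tau> e where *: "\<And>m::nat. off_diagonal_grid (n m) (\<tau> m) (e m)"
      "(\<lambda>m. sqnorm lborel (\<lambda>x. f x - step_function (n m) (\<tau> m) (e m) x)) \<longlonglongrightarrow> 0"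
      "(\<lambda>m. sqnorm M (\<lambda>\<omega>. Y \<omega> - step_integral W (n m) (\<tau> m) (e m) \<omega>)) \<longlonglongrightarrow> 0"
    using Y unfolding is_wiener_ito_iff_sqnorm by blast
  have [measurable]: "f \<in> borel_measurable borel" "Y \<in> borel_measurable M"
    and f_fin: "sqnorm lborel f < \<infinity>" and Y_sq: "square_integrable M Y"
    using Y by (auto simp: is_wiener_ito_iff_sqnorm square_integrable_iff_sqnorm)
  have [measurable]: "step_integral W n \<tau> a \<in> borel_measurable M" for n \<tau> and a :: "('k \<Rightarrow> nat) \<Rightarrow> real"
    by (rule measurable_step_integral[OF W])
  \<comment> \<open>Pulling the grid back along the time change, with unchanged coefficients, makes
    each \<open>?V\<close>-increment over \<open>\<sigma>\<close> equal to the
    \<open>W\<close>-increment over \<open>\<tau>\<close> divided by sqrt a. Every box has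
    \<open>CARD('k)\<close> sides, which gives \<open>?c\<close>.\<close>
  define \<sigma> where "\<sigma> m r = (\<tau> m r - b) / a" for m r
  have "off_diagonal_grid (n m) (\<sigma> m) (e m)" for m
    using *(1)[of m] a by (auto simp: off_diagonal_grid_def \<sigma>_def strict_mono_on_def divide_strict_right_mono)
  moreover have "step_function (n m) (\<sigma> m) (e m) x = step_function (n m) (\<tau> m) (e m) ((\<chi> i. b) + a *\<^sub>R x)" for m x
    using a by (simp add: step_function_def \<sigma>_def indicator_def field_simps)
  then have "(\<lambda>m. sqnorm lborel (\<lambda>x. f ((\<chi> i. b) + a *\<^sub>R x) - step_function (n m) (\<sigma> m) (e m) x)) =
      (\<lambda>m. ennreal (1 / \<bar>a\<bar> ^ DIM(real ^ 'k)) * sqnorm lborel (\<lambda>x. f x - step_function (n m) (\<tau> m) (e m) x))"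
    using a sqnorm_lborel_affine[of "\<lambda>x. f x - step_function (n m) (\<tau> m) (e m) x" a "\<chi> i. b" for m] by simp
  then have "(\<lambda>m. sqnorm lborel (\<lambda>x. f ((\<chi> i. b) + a *\<^sub>R x) - step_function (n m) (\<sigma> m) (e m) x)) \<longlonglongrightarrow> 0"
    using ennreal_cmult_tendsto_0[OF *(2)] by simp
  moreover have "step_integral ?V (n m) (\<sigma> m) (e m) \<omega> = ?c * step_integral W (n m) (\<tau> m) (e m) \<omega>" for m \<omega>
    using a by (simp add: step_integral_def \<sigma>_def prod_dividef sum_divide_distrib flip: diff_divide_distrib)
  then have "(\<lambda>m. sqnorm M (\<lambda>\<omega>. ?c * Y \<omega> - step_integral ?V (n m) (\<sigma> m) (e m) \<omega>)) \<longlonglongrightarrow> 0"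
    using sqnorm_tendsto_cmult[OF *(3), of ?c] by (simp only: right_diff_distrib) simp
  moreover have "square_integrable lborel (\<lambda>x. f ((\<chi> i. b) + a *\<^sub>R x))"
    using a f_fin sqnorm_lborel_affine[of f a "\<chi> i. b"]
    by (simp add: square_integrable_iff_sqnorm ennreal_mult_less_top)
  moreover have "square_integrable M (\<lambda>\<omega>. ?c * Y \<omega>)"
    using square_integrable_linear[OF Y_sq Y_sq, of ?c 0] by simp
  ultimately show ?thesis
    unfolding is_wiener_ito_iff_sqnorm by blast
qed

section \<open>Integrals with respect to two Brownian motions have the same law\<close>

lemma brownian_increments_same_law:
  assumes W: "brownian_motion M W" and V: "brownian_motion M V" and \<sigma>: "strict_mono_on {..N} \<sigma>"
  shows "distr M (\<Pi>\<^sub>M q\<in>{..<N}. borel) (\<lambda>\<omega>. \<lambda>q\<in>{..<N}. W (\<sigma> (Suc q)) \<omega> - W (\<sigma> q) \<omega>) =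
    distr M (\<Pi>\<^sub>M q\<in>{..<N}. borel) (\<lambda>\<omega>. \<lambda>q\<in>{..<N}. V (\<sigma> (Suc q)) \<omega> - V (\<sigma> q) \<omega>)"
proof (cases "N = 0")
  \<comment> \<open>The characterization of independence by a product law is applied to a nonempty
    index set; for N = 0 both sides are trivially equal.\<close>
  case False
  interpret prob_space M
    using W by (rule brownian_motion_prob_space)
  have law: "distr M (\<Pi>\<^sub>M q\<in>{..<N}. borel) (\<lambda>\<omega>. \<lambda>q\<in>{..<N}. U (\<sigma> (Suc q)) \<omega> - U (\<sigma> q) \<omega>) =
      (\<Pi>\<^sub>M q\<in>{..<N}. density lborel (normal_density 0 (sqrt (\<sigma> (Suc q) - \<sigma> q))))"
    if U: "brownian_motion M U" for U
  proof -
    have [measurable]: "U t \<in> borel_measurable M" for t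
      using U by (rule brownian_motion_measurable)
    have "indep_vars (\<lambda>_. borel) (\<lambda>q \<omega>. U (\<sigma> (Suc q)) \<omega> - U (\<sigma> q) \<omega>) {..<N}"
      using U \<sigma> unfolding brownian_motion_def by blast
    then have "distr M (\<Pi>\<^sub>M q\<in>{..<N}. borel) (\<lambda>\<omega>. \<lambda>q\<in>{..<N}. U (\<sigma> (Suc q)) \<omega> - U (\<sigma> q) \<omega>) =
        (\<Pi>\<^sub>M q\<in>{..<N}. distr M borel (\<lambda>\<omega>. U (\<sigma> (Suc q)) \<omega> - U (\<sigma> q) \<omega>))"
      using False by (subst (asm) indep_vars_iff_distr_eq_PiM) auto
    also have "\<dots> = (\<Pi>\<^sub>M q\<in>{..<N}. density lborel (normal_density 0 (sqrt (\<sigma> (Suc q) - \<sigma> q))))"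
    proof (rule PiM_cong)
      fix q assume "q \<in> {..<N}"
      then have "\<sigma> q < \<sigma> (Suc q)"
        using strict_mono_onD[OF \<sigma>, of q "Suc q"] by simp
      then have "distributed M lborel (\<lambda>\<omega>. U (\<sigma> (Suc q)) \<omega> - U (\<sigma> q) \<omega>)
          (normal_density 0 (sqrt (\<sigma> (Suc q) - \<sigma> q)))"
        using U unfolding brownian_motion_def by blast
      then have "distr M lborel (\<lambda>\<omega>. U (\<sigma> (Suc q)) \<omega> - U (\<sigma> q) \<omega>) =
          density lborel (normal_density 0 (sqrt (\<sigma> (Suc q) - \<sigma> q)))"
        by (rule distributed_distr_eq_density)
      then show "distr M borel (\<lambda>\<omega>. U (\<sigma> (Suc q)) \<omega> - U (\<sigma> q) \<omega>) =
          density lborel (normal_density 0 (sqrt (\<sigma> (Suc q) - \<sigma> q)))"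
        by (simp cong: distr_cong)
    qed simp
    finally show ?thesis .
  qed
  show ?thesis
    unfolding law[OF W] law[OF V] ..
qed (simp add: restrict_def)

text \<open>On a common grid the whole family is one fixed measurable function \<open>\<Psi>\<close>
  of the vector of increments, and the law of that vector is the same for every Brownian
  motion.\<close>

lemma step_integrals_same_law:
  fixes a :: "'i \<Rightarrow> ('k::finite \<Rightarrow> nat) \<Rightarrow> real"
  assumes W: "brownian_motion M W" and V: "brownian_motion M V" and "finite J"
    and grid: "\<And>t. t \<in> J \<Longrightarrow> off_diagonal_grid (n t) (\<tau> t) (a t)"
  shows "distr M (\<Pi>\<^sub>M t\<in>J. borel) (\<lambda>\<omega>. \<lambda>t\<in>J. step_integral W (n t) (\<tau> t) (a t) \<omega>) =
    distr M (\<Pi>\<^sub>M t\<in>J. borel) (\<lambda>\<omega>. \<lambda>t\<in>J. step_integral V (n t) (\<tau> t) (a t) \<omega>)"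
proof (rule common_grid[OF \<open>finite J\<close> grid])
  fix N \<sigma> a'
  assume \<sigma>: "strict_mono_on {..N} \<sigma>"
    and a': "\<And>t D. t \<in> J \<Longrightarrow> interval_additive D \<Longrightarrow> grid_sum D (n t) (\<tau> t) (a t) = grid_sum D N \<sigma> (a' t)"
  define \<Psi> where "\<Psi> d = (\<lambda>t\<in>J. \<Sum>i\<in>UNIV \<rightarrow> {..<N}. a' t i * (\<Prod>j\<in>UNIV. d (i j)))" for d :: "nat \<Rightarrow> real"
  have [measurable]: "\<Psi> \<in> (\<Pi>\<^sub>M q\<in>{..<N}. borel) \<rightarrow>\<^sub>M (\<Pi>\<^sub>M t\<in>J. borel)"
    unfolding \<Psi>_def
  proof (intro measurable_restrict borel_measurable_sum borel_measurable_times borel_measurable_const borel_measurable_prod)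
    show "(\<lambda>d. d (i j)) \<in> borel_measurable (\<Pi>\<^sub>M q\<in>{..<N}. borel)" if "i \<in> UNIV \<rightarrow> {..<N}" for i :: "'k \<Rightarrow> nat" and j
      by (rule measurable_component_singleton) (use that in auto)
  qed
  have eq: "distr M (\<Pi>\<^sub>M t\<in>J. borel) (\<lambda>\<omega>. \<lambda>t\<in>J. step_integral U (n t) (\<tau> t) (a t) \<omega>) =
      distr (distr M (\<Pi>\<^sub>M q\<in>{..<N}. borel) (\<lambda>\<omega>. \<lambda>q\<in>{..<N}. U (\<sigma> (Suc q)) \<omega> - U (\<sigma> q) \<omega>)) (\<Pi>\<^sub>M t\<in>J. borel) \<Psi>"
    if U: "brownian_motion M U" for U
  proof -
    have [measurable]: "U t \<in> borel_measurable M" for t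
      using U by (rule brownian_motion_measurable)
    have "(\<lambda>t\<in>J. step_integral U (n t) (\<tau> t) (a t) \<omega>) = \<Psi> (\<lambda>q\<in>{..<N}. U (\<sigma> (Suc q)) \<omega> - U (\<sigma> q) \<omega>)" for \<omega>
    proof (unfold \<Psi>_def, rule restrict_ext)
      fix t assume t: "t \<in> J"
      have "step_integral U (n t) (\<tau> t) (a t) \<omega> = grid_sum (\<lambda>j s t. U t \<omega> - U s \<omega>) N \<sigma> (a' t)"
        unfolding step_integral_eq_grid_sum using t interval_additive_increment by (rule a')
      then show "step_integral U (n t) (\<tau> t) (a t) \<omega> = (\<Sum>i\<in>UNIV \<rightarrow> {..<N}. a' t i *
          (\<Prod>j\<in>UNIV. (\<lambda>q\<in>{..<N}. U (\<sigma> (Suc q)) \<omega> - U (\<sigma> q) \<omega>) (i j)))"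
        unfolding grid_sum_def by (auto intro!: sum.cong prod.cong simp: Pi_iff)
    qed
    then show ?thesis
      by (subst distr_distr) (auto simp: comp_def)
  qed
  show ?thesis
    unfolding eq[OF W] eq[OF V] brownian_increments_same_law[OF W V \<sigma>] ..
qed

section \<open>From laws of step integrals to laws of their limits\<close>

lemma (in prob_space) expectation_abs_le_sqrt:
  assumes [measurable]: "Z \<in> borel_measurable M" and int: "integrable M (\<lambda>\<omega>. (Z \<omega>)\<^sup>2)"
  shows "integrable M Z" "expectation (\<lambda>\<omega>. \<bar>Z \<omega>\<bar>) \<le> sqrt (expectation (\<lambda>\<omega>. (Z \<omega>)\<^sup>2))"
proof -
  show Z: "integrable M Z"
    using int by (rule square_integrable_imp_integrable[rotated]) measurable
  have "variance (\<lambda>\<omega>. \<bar>Z \<omega>\<bar>) = expectation (\<lambda>\<omega>. (Z \<omega>)\<^sup>2) - (expectation (\<lambda>\<omega>. \<bar>Z \<omega>\<bar>))\<^sup>2"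
    using int Z by (subst variance_eq) auto
  then have "(expectation (\<lambda>\<omega>. \<bar>Z \<omega>\<bar>))\<^sup>2 \<le> expectation (\<lambda>\<omega>. (Z \<omega>)\<^sup>2)"
    using variance_positive[of "\<lambda>\<omega>. \<bar>Z \<omega>\<bar>"] by simp
  then show "expectation (\<lambda>\<omega>. \<bar>Z \<omega>\<bar>) \<le> sqrt (expectation (\<lambda>\<omega>. (Z \<omega>)\<^sup>2))"
    by (rule real_le_rsqrt)
qed

text \<open>For factors bounded by 1, two products differ by at most the sum of the differences of
  their factors. The Lipschitz bound and comparison of first with second moments reduce each summand
  to a distance in square mean.\<close>

lemma expectation_prod_tendsto:
  fixes Y :: "'i \<Rightarrow> 'w \<Rightarrow> real" and S :: "nat \<Rightarrow> 'i \<Rightarrow> 'w \<Rightarrow> real"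
  assumes "prob_space M" "finite J"
    and Y [measurable]: "\<And>t. t \<in> J \<Longrightarrow> Y t \<in> borel_measurable M"
    and S [measurable]: "\<And>m t. t \<in> J \<Longrightarrow> S m t \<in> borel_measurable M"
    and lim: "\<And>t. t \<in> J \<Longrightarrow> (\<lambda>m. sqnorm M (\<lambda>\<omega>. Y t \<omega> - S m t \<omega>)) \<longlonglongrightarrow> 0"
    and \<phi>: "\<And>t x. \<bar>\<phi> t x\<bar> \<le> (1::real)" "\<And>t x y. \<bar>\<phi> t x - \<phi> t y\<bar> \<le> L * \<bar>x - y\<bar>" "0 \<le> L"
    and [measurable]: "\<And>t. \<phi> t \<in> borel_measurable borel"
  shows "(\<lambda>m. \<integral>\<omega>. (\<Prod>t\<in>J. \<phi> t (S m t \<omega>)) \<partial>M) \<longlonglongrightarrow> (\<integral>\<omega>. (\<Prod>t\<in>J. \<phi> t (Y t \<omega>)) \<partial>M)"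
proof -
  interpret prob_space M
    by fact
  define r where "r m t = sqrt (enn2real (sqnorm M (\<lambda>\<omega>. Y t \<omega> - S m t \<omega>)))" for m t
  have abs_prod: "\<bar>\<Prod>t\<in>J. \<phi> t (z t)\<bar> \<le> 1" for z
    unfolding abs_prod by (intro prod_le_1) (auto simp: \<phi>)
  have int: "integrable M (\<lambda>\<omega>. \<Prod>t\<in>J. \<phi> t (Z t \<omega>))" if "\<And>t. t \<in> J \<Longrightarrow> Z t \<in> borel_measurable M" for Z
    using that abs_prod by (intro integrable_const_bound[of _ 1]) auto
  have r_lim: "(\<lambda>m. \<Sum>t\<in>J. L * r m t) \<longlonglongrightarrow> (\<Sum>t\<in>J. L * sqrt 0)"
  proof (intro tendsto_sum tendsto_mult tendsto_const)
    fix t assume "t \<in> J"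
    have "(\<lambda>m. enn2real (sqnorm M (\<lambda>\<omega>. Y t \<omega> - S m t \<omega>))) \<longlonglongrightarrow> 0"
      by (rule tendsto_enn2real) (use lim[OF \<open>t \<in> J\<close>] in simp_all)
    then show "(\<lambda>m. r m t) \<longlonglongrightarrow> sqrt 0"
      unfolding r_def by (rule tendsto_real_sqrt)
  qed
  \<comment> \<open>\<open>enn2real\<close> sends infinity to 0, so \<open>r\<close> measures the
    distance correctly only once that distance is finite; hence the estimate is claimed
    eventually.\<close>
  have "\<forall>\<^sub>F m in sequentially. \<forall>t\<in>J. sqnorm M (\<lambda>\<omega>. Y t \<omega> - S m t \<omega>) < \<infinity>"
    using \<open>finite J\<close> by (subst eventually_ball_finite_distrib) (auto intro!: order_tendstoD(2)[OF lim])
  then have "\<forall>\<^sub>F m in sequentially. norm ((\<integral>\<omega>. (\<Prod>t\<in>J. \<phi> t (S m t \<omega>)) \<partial>M) - (\<integral>\<omega>. (\<Prod>t\<in>J. \<phi> t (Y t \<omega>)) \<partial>M))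
      \<le> (\<Sum>t\<in>J. L * r m t)"
  proof eventually_elim
    case (elim m)
    have sq: "integrable M (\<lambda>\<omega>. (Y t \<omega> - S m t \<omega>)\<^sup>2)" if "t \<in> J" for t
    proof -
      have "square_integrable M (\<lambda>\<omega>. Y t \<omega> - S m t \<omega>)"
        using elim that Y S by (simp add: square_integrable_iff_sqnorm)
      then show ?thesis
        by (simp add: square_integrable_def)
    qed
    have diff: "integrable M (\<lambda>\<omega>. Y t \<omega> - S m t \<omega>)" "expectation (\<lambda>\<omega>. \<bar>Y t \<omega> - S m t \<omega>\<bar>) \<le> r m t" if "t \<in> J" for t
    proof -
      have "sqnorm M (\<lambda>\<omega>. Y t \<omega> - S m t \<omega>) = ennreal (expectation (\<lambda>\<omega>. (Y t \<omega> - S m t \<omega>)\<^sup>2))"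
        unfolding sqnorm_def by (rule nn_integral_eq_integral[OF sq[OF that]]) auto
      then have "r m t = sqrt (expectation (\<lambda>\<omega>. (Y t \<omega> - S m t \<omega>)\<^sup>2))"
        by (simp add: r_def)
      then show "integrable M (\<lambda>\<omega>. Y t \<omega> - S m t \<omega>)" "expectation (\<lambda>\<omega>. \<bar>Y t \<omega> - S m t \<omega>\<bar>) \<le> r m t"
        using expectation_abs_le_sqrt[OF _ sq[OF that]] Y[OF that] S[OF that] by auto
    qed
    have "norm ((\<integral>\<omega>. (\<Prod>t\<in>J. \<phi> t (S m t \<omega>)) \<partial>M) - (\<integral>\<omega>. (\<Prod>t\<in>J. \<phi> t (Y t \<omega>)) \<partial>M)) =
        norm (\<integral>\<omega>. (\<Prod>t\<in>J. \<phi> t (S m t \<omega>)) - (\<Prod>t\<in>J. \<phi> t (Y t \<omega>)) \<partial>M)"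
      using Y S by (subst Bochner_Integration.integral_diff) (auto intro!: int)
    also have "\<dots> \<le> (\<integral>\<omega>. norm ((\<Prod>t\<in>J. \<phi> t (S m t \<omega>)) - (\<Prod>t\<in>J. \<phi> t (Y t \<omega>))) \<partial>M)"
      by (rule integral_norm_bound)
    also have "\<dots> \<le> (\<integral>\<omega>. (\<Sum>t\<in>J. L * \<bar>Y t \<omega> - S m t \<omega>\<bar>) \<partial>M)"
    proof (rule integral_mono)
      show "integrable M (\<lambda>\<omega>. norm ((\<Prod>t\<in>J. \<phi> t (S m t \<omega>)) - (\<Prod>t\<in>J. \<phi> t (Y t \<omega>))))"
        using Y S by (intro integrable_norm Bochner_Integration.integrable_diff int) auto
      show "integrable M (\<lambda>\<omega>. \<Sum>t\<in>J. L * \<bar>Y t \<omega> - S m t \<omega>\<bar>)"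
        by (intro Bochner_Integration.integrable_sum integrable_mult_right integrable_abs diff)
      fix \<omega>
      have "norm ((\<Prod>t\<in>J. \<phi> t (S m t \<omega>)) - (\<Prod>t\<in>J. \<phi> t (Y t \<omega>))) \<le> (\<Sum>t\<in>J. norm (\<phi> t (S m t \<omega>) - \<phi> t (Y t \<omega>)))"
        by (rule norm_prod_diff) (auto simp: \<phi>)
      also have "\<dots> \<le> (\<Sum>t\<in>J. L * \<bar>Y t \<omega> - S m t \<omega>\<bar>)"
        using \<phi>(2) by (intro sum_mono) (simp add: abs_minus_commute)
      finally show "norm ((\<Prod>t\<in>J. \<phi> t (S m t \<omega>)) - (\<Prod>t\<in>J. \<phi> t (Y t \<omega>))) \<le> (\<Sum>t\<in>J. L * \<bar>Y t \<omega> - S m t \<omega>\<bar>)" .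
    qed
    also have "\<dots> = (\<Sum>t\<in>J. L * expectation (\<lambda>\<omega>. \<bar>Y t \<omega> - S m t \<omega>\<bar>))"
      using diff by (subst Bochner_Integration.integral_sum) auto
    also have "\<dots> \<le> (\<Sum>t\<in>J. L * r m t)"
      by (intro sum_mono mult_left_mono diff \<phi>)
    finally show ?case .
  qed
  then have "(\<lambda>m. (\<integral>\<omega>. (\<Prod>t\<in>J. \<phi> t (S m t \<omega>)) \<partial>M) - (\<integral>\<omega>. (\<Prod>t\<in>J. \<phi> t (Y t \<omega>)) \<partial>M)) \<longlonglongrightarrow> 0"
    by (rule Lim_null_comparison) (use r_lim in simp)
  then show ?thesis
    by (rule LIM_zero_cancel)
qed

text \<open>A Lipschitz substitute for the indicator of {..c}: it equals 1 up to \<open>c\<close>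
  and falls with slope \<open>n\<close>. Convergence holds at every point, \<open>c\<close>
  included, so no continuity points of distribution functions have to be selected.\<close>

definition ramp :: "real \<Rightarrow> nat \<Rightarrow> real \<Rightarrow> real" where
  "ramp c n x = max 0 (min 1 (1 - real n * (x - c)))"

lemma ramp_bounds: "0 \<le> ramp c n x" "\<bar>ramp c n x\<bar> \<le> 1"
  by (auto simp: ramp_def)

lemma ramp_lipschitz: "\<bar>ramp c n x - ramp c n y\<bar> \<le> real n * \<bar>x - y\<bar>"
proof -
  have "\<bar>ramp c n x - ramp c n y\<bar> \<le> \<bar>real n * (x - c) - real n * (y - c)\<bar>"
    unfolding ramp_def by linarith
  also have "\<dots> = real n * \<bar>x - y\<bar>"
    by (simp add: abs_mult flip: right_diff_distrib)
  finally show ?thesis .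
qed

lemma measurable_ramp [measurable]: "ramp c n \<in> borel_measurable borel"
  unfolding ramp_def[abs_def] by measurable

lemma ramp_tendsto: "(\<lambda>n. ramp c n x) \<longlonglongrightarrow> indicator {..c} x"
proof (cases "x \<le> c")
  case True
  then have "ramp c n x = 1" for n
    by (simp add: ramp_def mult_nonneg_nonpos)
  then show ?thesis
    using True by simp
next
  case False
  obtain N :: nat where N: "1 / (x - c) < N"
    using reals_Archimedean2 by blast
  have "ramp c n x = 0" if "n \<ge> N" for n
  proof -
    have "1 < real N * (x - c)"
      using N False by (simp add: pos_divide_less_eq)
    also have "\<dots> \<le> real n * (x - c)"
      using that False by (intro mult_right_mono) auto
    finally show ?thesis
      by (simp add: ramp_def)
  qed
  then have "\<forall>\<^sub>F n in sequentially. ramp c n x = indicator {..c} x"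
    using False by (auto simp: eventually_sequentially)
  then show ?thesis
    by (rule tendsto_eventually)
qed

text \<open>Joint distribution functions determine the law: products of closed half-lines are an
  intersection-stable generator and exhaust the space.\<close>

lemma distr_PiM_eqI_atMost:
  fixes X Y :: "'i \<Rightarrow> 'w \<Rightarrow> real"
  assumes "prob_space M" and J: "finite J"
    and [measurable]: "\<And>t. t \<in> J \<Longrightarrow> X t \<in> borel_measurable M" "\<And>t. t \<in> J \<Longrightarrow> Y t \<in> borel_measurable M"
    and eq: "\<And>c. (\<integral>\<omega>. (\<Prod>t\<in>J. indicator {..c t} (X t \<omega>)) \<partial>M) = (\<integral>\<omega>. (\<Prod>t\<in>J. indicator {..c t} (Y t \<omega>)) \<partial>M :: real)"
  shows "distr M (\<Pi>\<^sub>M t\<in>J. borel) (\<lambda>\<omega>. \<lambda>t\<in>J. X t \<omega>) = distr M (\<Pi>\<^sub>M t\<in>J. borel) (\<lambda>\<omega>. \<lambda>t\<in>J. Y t \<omega>)"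
proof -
  interpret prob_space M
    by fact
  \<comment> \<open>The generator in the form produced by \<open>sets_PiM_sigma\<close>, with
    \<open>J\<close> as the only index block; \<open>P_iff\<close> identifies it with the products
    of half-lines.\<close>
  let ?P = "{{f \<in> (\<Pi>\<^sub>E i\<in>J. UNIV). \<forall>i\<in>j. f i \<in> A i} | A j. j \<in> {J} \<and> A \<in> Pi j (\<lambda>_. range atMost)} :: ('i \<Rightarrow> real) set set"
  have "(UNIV :: real set) = \<Union> (range (\<lambda>n::nat. {..real n}))"
    by (auto intro: real_arch_simple)
  then have cover: "\<exists>S\<subseteq>range atMost. countable S \<and> (UNIV :: real set) = \<Union>S"
    by (intro exI[of _ "range (\<lambda>n::nat. {..real n})"]) auto
  have "sets (\<Pi>\<^sub>M t\<in>J. borel :: real measure) = sets (sigma (\<Pi>\<^sub>E i\<in>J. UNIV) ?P)"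
    unfolding borel_eq_atMost using cover J by (intro sets_PiM_sigma) auto
  also have "\<dots> = sigma_sets (\<Pi>\<^sub>E i\<in>J. UNIV) ?P"
    by (intro sets_measure_of) auto
  finally have sets: "sets (\<Pi>\<^sub>M t\<in>J. borel :: real measure) = sigma_sets (\<Pi>\<^sub>E i\<in>J. UNIV) ?P" .
  have P_iff: "E \<in> ?P \<longleftrightarrow> (\<exists>c. E = (\<Pi>\<^sub>E t\<in>J. {..c t}))" for E
  proof
    assume "E \<in> ?P"
    then obtain A where E: "E = {f \<in> (\<Pi>\<^sub>E i\<in>J. UNIV). \<forall>i\<in>J. f i \<in> A i}" and "A \<in> Pi J (\<lambda>_. range atMost)"
      by auto
    then obtain c where "\<And>t. t \<in> J \<Longrightarrow> A t = {..c t}"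
      by (auto simp: Pi_iff image_iff) metis
    then have "E = (\<Pi>\<^sub>E t\<in>J. {..c t})"
      unfolding E by (auto simp: PiE_iff intro: extensional_arb)
    then show "\<exists>c. E = (\<Pi>\<^sub>E t\<in>J. {..c t})"
      by blast
  next
    assume "\<exists>c. E = (\<Pi>\<^sub>E t\<in>J. {..c t})"
    then obtain c where E: "E = (\<Pi>\<^sub>E t\<in>J. {..c t})" ..
    show "E \<in> ?P"
      unfolding E by (intro CollectI exI[of _ "\<lambda>t. {..c t}"] exI[of _ J])
        (auto simp: PiE_iff intro: extensional_arb)
  qed
  have prob: "emeasure (distr M (\<Pi>\<^sub>M t\<in>J. borel) (\<lambda>\<omega>. \<lambda>t\<in>J. Z t \<omega>)) (\<Pi>\<^sub>E t\<in>J. {..c t}) =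
      ennreal (\<integral>\<omega>. (\<Prod>t\<in>J. indicator {..c t} (Z t \<omega>)) \<partial>M)"
    if [measurable]: "\<And>t. t \<in> J \<Longrightarrow> Z t \<in> borel_measurable M" for Z :: "'i \<Rightarrow> 'w \<Rightarrow> real" and c
  proof -
    have "emeasure (distr M (\<Pi>\<^sub>M t\<in>J. borel) (\<lambda>\<omega>. \<lambda>t\<in>J. Z t \<omega>)) (\<Pi>\<^sub>E t\<in>J. {..c t}) =
        emeasure M ((\<lambda>\<omega>. \<lambda>t\<in>J. Z t \<omega>) -` (\<Pi>\<^sub>E t\<in>J. {..c t}) \<inter> space M)"
      using J by (intro emeasure_distr sets_PiM_I_finite measurable_restrict) auto
    also have "\<dots> = ennreal (\<integral>\<omega>. indicator ((\<lambda>\<omega>. \<lambda>t\<in>J. Z t \<omega>) -` (\<Pi>\<^sub>E t\<in>J. {..c t}) \<inter> space M) \<omega> \<partial>M)"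
      by (simp add: emeasure_eq_measure)
    also have "(\<integral>\<omega>. indicator ((\<lambda>\<omega>. \<lambda>t\<in>J. Z t \<omega>) -` (\<Pi>\<^sub>E t\<in>J. {..c t}) \<inter> space M) \<omega> \<partial>M) =
        (\<integral>\<omega>. (\<Prod>t\<in>J. indicator {..c t} (Z t \<omega>)) \<partial>M :: real)"
    proof (intro Bochner_Integration.integral_cong refl)
      fix \<omega> assume "\<omega> \<in> space M"
      then show "indicator ((\<lambda>\<omega>. \<lambda>t\<in>J. Z t \<omega>) -` (\<Pi>\<^sub>E t\<in>J. {..c t}) \<inter> space M) \<omega> =
          (\<Prod>t\<in>J. indicator {..c t} (Z t \<omega>) :: real)"
        using J by (auto simp: indicator_def PiE_iff prod_zero_iff)
    qed
    finally show ?thesis .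
  qed
  show ?thesis
  proof (rule measure_eqI_generator_eq[where E = ?P and A = "\<lambda>n. \<Pi>\<^sub>E t\<in>J. {..real n}"])
    show "Int_stable ?P"
    proof (rule Int_stableI)
      fix E F assume "E \<in> ?P" "F \<in> ?P"
      then obtain c d where "E = (\<Pi>\<^sub>E t\<in>J. {..c t})" "F = (\<Pi>\<^sub>E t\<in>J. {..d t})"
        unfolding P_iff by blast
      then have "E \<inter> F = (\<Pi>\<^sub>E t\<in>J. {..min (c t) (d t)})"
        by (auto simp: PiE_iff)
      then show "E \<inter> F \<in> ?P"
        unfolding P_iff by (intro exI[of _ "\<lambda>t. min (c t) (d t)"])
    qed
    show "emeasure (distr M (\<Pi>\<^sub>M t\<in>J. borel) (\<lambda>\<omega>. \<lambda>t\<in>J. X t \<omega>)) E =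
        emeasure (distr M (\<Pi>\<^sub>M t\<in>J. borel) (\<lambda>\<omega>. \<lambda>t\<in>J. Y t \<omega>)) E" if "E \<in> ?P" for E
      using that unfolding P_iff by (auto simp: prob eq)
    show "(\<Union>n. \<Pi>\<^sub>E t\<in>J. {..real n}) = (\<Pi>\<^sub>E i\<in>J. UNIV)"
    proof (intro equalityI subsetI)
      fix f :: "'i \<Rightarrow> real" assume f: "f \<in> (\<Pi>\<^sub>E i\<in>J. UNIV)"
      obtain n :: nat where n: "Max (insert 0 (f ` J)) \<le> n"
        using real_arch_simple by blast
      have "f t \<le> n" if "t \<in> J" for t
        using that J by (intro order_trans[OF Max_ge n]) auto
      then show "f \<in> (\<Union>n. \<Pi>\<^sub>E t\<in>J. {..real n})"
        using f by (auto simp: PiE_iff)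
    qed auto
    show "range (\<lambda>n. \<Pi>\<^sub>E t\<in>J. {..real n}) \<subseteq> ?P"
    proof (intro subsetI)
      fix E assume "E \<in> range (\<lambda>n. \<Pi>\<^sub>E t\<in>J. {..real n})"
      then obtain n :: nat where "E = (\<Pi>\<^sub>E t\<in>J. {..real n})"
        by blast
      then show "E \<in> ?P"
        unfolding P_iff by (intro exI[of _ "\<lambda>_. real n"])
    qed
    show "emeasure (distr M (\<Pi>\<^sub>M t\<in>J. borel) (\<lambda>\<omega>. \<lambda>t\<in>J. X t \<omega>)) (\<Pi>\<^sub>E t\<in>J. {..real n}) \<noteq> \<infinity>" for n
      by (simp add: prob)
  qed (auto simp: sets)
qed

text \<open>Step integrals of the same step functions against \<open>W\<close> and \<open>V\<close>
  agree in law, and their limits give equal expectations of Lipschitz products. Letting the ramps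
  sharpen turns these into equal joint distribution functions.\<close>

lemma wiener_ito_same_law:
  fixes f :: "'i \<Rightarrow> real ^ 'k \<Rightarrow> real"
  assumes W: "brownian_motion M W" and V: "brownian_motion M V" and J: "finite J"
    and Y: "\<And>t. t \<in> J \<Longrightarrow> is_wiener_ito M W (f t) (Y t)"
    and Z: "\<And>t. t \<in> J \<Longrightarrow> is_wiener_ito M V (f t) (Z t)"
  shows "distr M (\<Pi>\<^sub>M t\<in>J. borel) (\<lambda>\<omega>. \<lambda>t\<in>J. Y t \<omega>) = distr M (\<Pi>\<^sub>M t\<in>J. borel) (\<lambda>\<omega>. \<lambda>t\<in>J. Z t \<omega>)"
proof -
  interpret prob_space M
    using W by (rule brownian_motion_prob_space)
  have Y_meas [measurable]: "\<And>t. t \<in> J \<Longrightarrow> Y t \<in> borel_measurable M"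
    and Z_meas [measurable]: "\<And>t. t \<in> J \<Longrightarrow> Z t \<in> borel_measurable M"
    using Y Z by (auto simp: is_wiener_ito_iff_sqnorm square_integrable_iff_sqnorm)
  \<comment> \<open>The sequence is taken from the integral against \<open>W\<close>, but
    \<open>approx\<close> mentions only \<open>f t\<close>, so it serves \<open>V\<close> as well.
    Packing the data into a triple allows a single choice over \<open>J\<close>.\<close>
  define approx where "approx t = (\<lambda>(n, \<tau>, a). (\<forall>m::nat. off_diagonal_grid (n m) (\<tau> m) (a m)) \<and>
      (\<lambda>m. sqnorm lborel (\<lambda>x. f t x - step_function (n m) (\<tau> m) (a m) x)) \<longlonglongrightarrow> 0)" for t
  have "\<forall>t\<in>J. \<exists>p. approx t p"
    using Y unfolding is_wiener_ito_iff_sqnorm approx_def by fast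
  then obtain p where p: "\<forall>t\<in>J. approx t (p t)"
    by (rule bchoice[THEN exE])
  define n \<tau> a where "n t = fst (p t)" and "\<tau> t = fst (snd (p t))" and "a t = snd (snd (p t))" for t
  have grid: "\<And>t m. t \<in> J \<Longrightarrow> off_diagonal_grid (n t m) (\<tau> t m) (a t m)"
    and lim: "\<And>t. t \<in> J \<Longrightarrow> (\<lambda>m. sqnorm lborel (\<lambda>x. f t x - step_function (n t m) (\<tau> t m) (a t m) x)) \<longlonglongrightarrow> 0"
    using p by (auto simp: approx_def n_def \<tau>_def a_def split_beta)
  let ?S = "\<lambda>W m t. step_integral W (n t m) (\<tau> t m) (a t m)"
  have lipschitz: "(\<integral>\<omega>. (\<Prod>t\<in>J. \<phi> t (Y t \<omega>)) \<partial>M) = (\<integral>\<omega>. (\<Prod>t\<in>J. \<phi> t (Z t \<omega>)) \<partial>M)"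
    if \<phi>: "\<And>t x. \<bar>\<phi> t x\<bar> \<le> (1::real)" "\<And>t x y. \<bar>\<phi> t x - \<phi> t y\<bar> \<le> L * \<bar>x - y\<bar>" "0 \<le> L"
      "\<And>t. \<phi> t \<in> borel_measurable borel" for \<phi> L
  proof -
    have "(\<lambda>m. \<integral>\<omega>. (\<Prod>t\<in>J. \<phi> t (?S W m t \<omega>)) \<partial>M) \<longlonglongrightarrow> (\<integral>\<omega>. (\<Prod>t\<in>J. \<phi> t (Y t \<omega>)) \<partial>M)"
      using \<phi> grid lim
      by (intro expectation_prod_tendsto[OF _ J] is_wiener_ito_limit[OF W Y] measurable_step_integral[OF W] Y_meas)
        (auto intro: prob_space_axioms)
    moreover have "(\<lambda>m. \<integral>\<omega>. (\<Prod>t\<in>J. \<phi> t (?S V m t \<omega>)) \<partial>M) \<longlonglongrightarrow> (\<integral>\<omega>. (\<Prod>t\<in>J. \<phi> t (Z t \<omega>)) \<partial>M)"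
      using \<phi> grid lim
      by (intro expectation_prod_tendsto[OF _ J] is_wiener_ito_limit[OF V Z] measurable_step_integral[OF V] Z_meas)
        (auto intro: prob_space_axioms)
    moreover have "(\<integral>\<omega>. (\<Prod>t\<in>J. \<phi> t (?S W m t \<omega>)) \<partial>M) = (\<integral>\<omega>. (\<Prod>t\<in>J. \<phi> t (?S V m t \<omega>)) \<partial>M)" for m
    proof -
      have [measurable]: "\<phi> t \<in> borel_measurable borel" for t
        by (rule \<phi>)
      have eq: "(\<integral>\<omega>. (\<Prod>t\<in>J. \<phi> t (?S U m t \<omega>)) \<partial>M) =
          (\<integral>x. (\<Prod>t\<in>J. \<phi> t (x t)) \<partial>distr M (\<Pi>\<^sub>M t\<in>J. borel) (\<lambda>\<omega>. \<lambda>t\<in>J. ?S U m t \<omega>))"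
        if U: "brownian_motion M U" for U
      proof -
        have [measurable]: "?S U m t \<in> borel_measurable M" for t
          by (rule measurable_step_integral[OF U])
        show ?thesis
          by (subst integral_distr) (auto intro!: Bochner_Integration.integral_cong)
      qed
      show ?thesis
        unfolding eq[OF W] eq[OF V]
        using step_integrals_same_law[OF W V J, of "\<lambda>t. n t m" "\<lambda>t. \<tau> t m" "\<lambda>t. a t m", OF grid] by simp
    qed
    ultimately show ?thesis
      using LIMSEQ_unique by simp
  qed
  show ?thesis
  proof (rule distr_PiM_eqI_atMost[OF prob_space_axioms J Y_meas Z_meas])
    fix c :: "'i \<Rightarrow> real"
    have lim: "(\<lambda>n. \<integral>\<omega>. (\<Prod>t\<in>J. ramp (c t) n (U t \<omega>)) \<partial>M) \<longlonglongrightarrow> (\<integral>\<omega>. (\<Prod>t\<in>J. indicator {..c t} (U t \<omega>)) \<partial>M)"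
      if [measurable]: "\<And>t. t \<in> J \<Longrightarrow> U t \<in> borel_measurable M" for U
    proof (rule integral_dominated_convergence[where w = "\<lambda>_. 1"])
      show "AE \<omega> in M. (\<lambda>n. \<Prod>t\<in>J. ramp (c t) n (U t \<omega>)) \<longlonglongrightarrow> (\<Prod>t\<in>J. indicator {..c t} (U t \<omega>))"
        by (intro AE_I2 tendsto_prod ramp_tendsto)
      show "AE \<omega> in M. norm (\<Prod>t\<in>J. ramp (c t) n (U t \<omega>)) \<le> 1" for n
        by (intro AE_I2) (auto simp: abs_prod intro!: prod_le_1 ramp_bounds)
    qed auto
    have eq: "(\<integral>\<omega>. (\<Prod>t\<in>J. ramp (c t) n (Y t \<omega>)) \<partial>M) = (\<integral>\<omega>. (\<Prod>t\<in>J. ramp (c t) n (Z t \<omega>)) \<partial>M)" for n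
      by (rule lipschitz[of "\<lambda>t. ramp (c t) n" "real n"]) (auto intro: ramp_bounds ramp_lipschitz)
    show "(\<integral>\<omega>. (\<Prod>t\<in>J. indicator {..c t} (Y t \<omega>)) \<partial>M) = (\<integral>\<omega>. (\<Prod>t\<in>J. indicator {..c t} (Z t \<omega>)) \<partial>M :: real)"
      using lim[of Y, OF Y_meas] lim[of Z, OF Z_meas] unfolding eq by (rule LIMSEQ_unique)
  qed
qed

section \<open>Riesz energy of powers\<close>

lemma nn_integral_powr_from_0:
  assumes "-1 < e" "0 \<le> L"
  shows "(\<integral>\<^sup>+x. ennreal (x powr e) * indicator {0<..L} x \<partial>lborel) < \<infinity>"
proof -
  have "(\<integral>\<^sup>+x\<in>{0..L}. ennreal (x powr e) \<partial>lborel) = ennreal (L powr (e + 1) / (e + 1))"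
    using has_integral_powr_from_0[OF assms] by (intro nn_integral_has_integral_lebesgue') auto
  then have "(\<integral>\<^sup>+x. ennreal (x powr e) * indicator {0..L} x \<partial>lborel) < \<infinity>"
    by simp
  then show ?thesis
    by (rule order_le_less_trans[rotated]) (auto intro!: nn_integral_mono split: split_indicator)
qed

lemma nn_integral_powr_to_inf:
  assumes "e < -1" "0 < T"
  shows "(\<integral>\<^sup>+x. ennreal (x powr e) * indicator {T<..} x \<partial>lborel) < \<infinity>"
proof -
  have "(\<integral>\<^sup>+x\<in>{T..}. ennreal (x powr e) \<partial>lborel) = ennreal (- (T powr (e + 1)) / (e + 1))"
    using has_integral_powr_to_inf[OF assms] by (intro nn_integral_has_integral_lebesgue') auto
  then have "(\<integral>\<^sup>+x. ennreal (x powr e) * indicator {T..} x \<partial>lborel) < \<infinity>"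
    by simp
  then show ?thesis
    by (rule order_le_less_trans[rotated]) (auto intro!: nn_integral_mono split: split_indicator)
qed

definition riesz_energy :: "real \<Rightarrow> (real \<Rightarrow> ennreal) \<Rightarrow> ennreal" where
  "riesz_energy \<gamma> u = (\<integral>\<^sup>+s. \<integral>\<^sup>+r. u s * u r * ennreal (\<bar>s - r\<bar> powr \<gamma>) \<partial>lborel \<partial>lborel)"

text \<open>The pieces of the weight are powers of \<open>t - s\<close> and \<open>- s\<close>;
  reflection reduces them to powers of \<open>s\<close> on half-lines.\<close>

lemma riesz_energy_reflect:
  assumes [measurable]: "u \<in> borel_measurable borel"
  shows "riesz_energy \<gamma> (\<lambda>s. u (p - s)) = riesz_energy \<gamma> u"
proof -
  have reflect: "(\<integral>\<^sup>+x. F x \<partial>lborel) = (\<integral>\<^sup>+x. F (p - x) \<partial>lborel)" if "F \<in> borel_measurable borel" for F :: "real \<Rightarrow> ennreal"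
    using nn_integral_real_affine[OF that, of "-1" p] by simp
  have "riesz_energy \<gamma> u = (\<integral>\<^sup>+s. \<integral>\<^sup>+r. u (p - s) * u r * ennreal (\<bar>p - s - r\<bar> powr \<gamma>) \<partial>lborel \<partial>lborel)"
    unfolding riesz_energy_def by (rule reflect) measurable
  also have "\<dots> = (\<integral>\<^sup>+s. \<integral>\<^sup>+r. u (p - s) * u (p - r) * ennreal (\<bar>p - s - (p - r)\<bar> powr \<gamma>) \<partial>lborel \<partial>lborel)"
    by (rule nn_integral_cong, rule reflect) measurable
  also have "\<dots> = riesz_energy \<gamma> (\<lambda>s. u (p - s))"
    by (simp add: riesz_energy_def abs_minus_commute)
  finally show ?thesis ..
qed

text \<open>The integrand is symmetric and the diagonal is null. Both halves are recorded: near 0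
  the inner variable must stay below \<open>s\<close>, at infinity above \<open>s\<close>, for the
  inner integral to scale to a constant.\<close>

lemma riesz_energy_eq_half_plane:
  assumes [measurable]: "u \<in> borel_measurable borel"
  shows "riesz_energy \<gamma> u = 2 * (\<integral>\<^sup>+s. \<integral>\<^sup>+r. u s * u r * ennreal (\<bar>s - r\<bar> powr \<gamma>) * indicator {s<..} r \<partial>lborel \<partial>lborel)"
    and "riesz_energy \<gamma> u = 2 * (\<integral>\<^sup>+s. \<integral>\<^sup>+r. u s * u r * ennreal (\<bar>s - r\<bar> powr \<gamma>) * indicator {..<s} r \<partial>lborel \<partial>lborel)"
proof -
  let ?F = "\<lambda>s r. u s * u r * ennreal (\<bar>s - r\<bar> powr \<gamma>)"
  let ?up = "\<integral>\<^sup>+s. \<integral>\<^sup>+r. ?F s r * indicator {s<..} r \<partial>lborel \<partial>lborel"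
  let ?lo = "\<integral>\<^sup>+s. \<integral>\<^sup>+r. ?F s r * indicator {..<s} r \<partial>lborel \<partial>lborel"
  have ind: "indicator {s<..} r = (if s < r then 1 else 0 :: ennreal)"
    "indicator {..<s} r = (if r < s then 1 else 0 :: ennreal)" for s r :: real
    by (auto split: split_indicator)
  have "riesz_energy \<gamma> u = (\<integral>\<^sup>+s. (\<integral>\<^sup>+r. ?F s r * indicator {s<..} r + ?F s r * indicator {..<s} r \<partial>lborel) \<partial>lborel)"
    unfolding riesz_energy_def
  proof (rule nn_integral_cong, rule nn_integral_cong_AE)
    fix s :: real
    show "AE r in lborel. ?F s r = ?F s r * indicator {s<..} r + ?F s r * indicator {..<s} r"
      using AE_lborel_singleton[of s] by eventually_elim (auto simp: ind)
  qed
  also have "\<dots> = (\<integral>\<^sup>+s. (\<integral>\<^sup>+r. ?F s r * indicator {s<..} r \<partial>lborel) + (\<integral>\<^sup>+r. ?F s r * indicator {..<s} r \<partial>lborel) \<partial>lborel)"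
    by (intro nn_integral_cong nn_integral_add) measurable
  also have "\<dots> = ?up + ?lo"
    unfolding ind by (intro nn_integral_add) measurable
  finally have sum: "riesz_energy \<gamma> u = ?up + ?lo" .
  have "?up = (\<integral>\<^sup>+r. \<integral>\<^sup>+s. ?F s r * indicator {s<..} r \<partial>lborel \<partial>lborel)"
    unfolding ind by (rule lborel_pair.Fubini'[symmetric]) measurable
  also have "\<dots> = ?lo"
    by (intro nn_integral_cong) (auto simp: ind mult_ac abs_minus_commute)
  finally have "?up = ?lo" .
  then show "riesz_energy \<gamma> u = 2 * ?up" "riesz_energy \<gamma> u = 2 * ?lo"
    unfolding sum by (simp_all add: mult_2)
qed

section \<open>Scaling constants of the energy and its finiteness for powers\<close>

lemma nn_integral_Beta_finite:
  assumes "-1 < b" "-1 < \<gamma>"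
  shows "(\<integral>\<^sup>+v. ennreal (v powr b * (1 - v) powr \<gamma>) * indicator {0<..<1} v \<partial>lborel) < \<infinity>"
proof -
  have "((\<lambda>v. v powr b * (1 - v) powr \<gamma>) has_integral Beta (b + 1) (\<gamma> + 1)) {0..1}"
    using has_integral_Beta_real[of "b + 1" "\<gamma> + 1"] assms by simp
  then have "(\<integral>\<^sup>+v\<in>{0..1}. ennreal (v powr b * (1 - v) powr \<gamma>) \<partial>lborel) = ennreal (Beta (b + 1) (\<gamma> + 1))"
    by (intro nn_integral_has_integral_lebesgue') auto
  then have "(\<integral>\<^sup>+v\<in>{0..1}. ennreal (v powr b * (1 - v) powr \<gamma>) \<partial>lborel) < \<infinity>"
    by simp
  then show ?thesis
    by (rule order_le_less_trans[rotated]) (auto intro!: nn_integral_mono split: split_indicator)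
qed

text \<open>Up to v = 2 only the singularity (v - 1)^\<gamma> matters, integrable as \<gamma> > -1.
  Beyond 2, v - 1 is at least v/2, so the integrand is at most a constant times
  v^(b+\<gamma>).\<close>

lemma nn_integral_tail_finite:
  assumes "b < 0" "-1 < \<gamma>" "\<gamma> < 0" "b + \<gamma> < -1"
  shows "(\<integral>\<^sup>+v. ennreal (v powr b * (v - 1) powr \<gamma>) * indicator {1<..} v \<partial>lborel) < \<infinity>"
proof -
  \<comment> \<open>\<open>?P\<close> is evaluated at \<open>- 1 + 1 * v\<close>, the shape in which
    the affine substitution recognizes the shift by 1.\<close>
  let ?P = "\<lambda>v. ennreal (v powr \<gamma>) * indicator {0<..1} v" and ?Q = "\<lambda>v. ennreal (v powr (b + \<gamma>)) * indicator {1<..} v"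
  have "(\<integral>\<^sup>+v. ennreal (v powr b * (v - 1) powr \<gamma>) * indicator {1<..} v \<partial>lborel) \<le>
      (\<integral>\<^sup>+v. ?P (- 1 + 1 * v) + ennreal (2 powr (- \<gamma>)) * ?Q v \<partial>lborel)"
  proof (rule nn_integral_mono)
    fix v :: real
    consider "v \<le> 1" | "1 < v" "v \<le> 2" | "2 < v"
      by linarith
    then show "ennreal (v powr b * (v - 1) powr \<gamma>) * indicator {1<..} v \<le>
        ?P (- 1 + 1 * v) + ennreal (2 powr (- \<gamma>)) * ?Q v"
    proof cases
      case 2
      have "v powr b * (v - 1) powr \<gamma> \<le> 1 * (v - 1) powr \<gamma>"
        using 2 assms powr_mono2'[of b 1 v] by (intro mult_right_mono) auto
      then have "ennreal (v powr b * (v - 1) powr \<gamma>) \<le> ennreal ((- 1 + 1 * v) powr \<gamma>)"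
        by (intro ennreal_leI) (simp add: algebra_simps)
      then show ?thesis
        using 2 by (intro add_increasing2) auto
    next
      case 3
      have "(v - 1) powr \<gamma> \<le> (v / 2) powr \<gamma>"
        using 3 assms by (intro powr_mono2') auto
      then have "v powr b * (v - 1) powr \<gamma> \<le> v powr b * (v / 2) powr \<gamma>"
        by (intro mult_left_mono) auto
      also have "\<dots> = 2 powr (- \<gamma>) * v powr (b + \<gamma>)"
        using 3 by (simp add: powr_divide powr_add powr_minus field_simps)
      finally have "ennreal (v powr b * (v - 1) powr \<gamma>) \<le> ennreal (2 powr (- \<gamma>)) * ennreal (v powr (b + \<gamma>))"
        by (simp add: ennreal_leI flip: ennreal_mult)
      then show ?thesis
        using 3 by (intro add_increasing) auto
    qed auto
  qed
  also have "\<dots> = (\<integral>\<^sup>+v. ?P (- 1 + 1 * v) \<partial>lborel) + ennreal (2 powr (- \<gamma>)) * (\<integral>\<^sup>+v. ?Q v \<partial>lborel)"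
    by (subst nn_integral_add) (auto simp: nn_integral_cmult)
  also have "(\<integral>\<^sup>+v. ?P (- 1 + 1 * v) \<partial>lborel) = (\<integral>\<^sup>+v. ?P v \<partial>lborel)"
    using nn_integral_real_affine[of ?P 1 "-1"] by simp
  also have "\<dots> + ennreal (2 powr (- \<gamma>)) * (\<integral>\<^sup>+v. ?Q v \<partial>lborel) < \<infinity>"
    using nn_integral_powr_from_0[of \<gamma> 1] nn_integral_powr_to_inf[of "b + \<gamma>" 1] assms
    by (auto simp: ennreal_mult_less_top)
  finally show ?thesis .
qed

text \<open>For a power, one of the two half-plane integrals scales to a power of the outer variable
  times a constant.\<close>

lemma riesz_energy_power_near_0:
  assumes "-1 - \<gamma> / 2 < b" "-1 < \<gamma>" "\<gamma> < 0" "0 \<le> L"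
  shows "riesz_energy \<gamma> (\<lambda>s. ennreal (s powr b) * indicator {0<..L} s) < \<infinity>"
proof -
  let ?u = "\<lambda>s. ennreal (s powr b) * indicator {0<..L} s"
  define A where "A = (\<integral>\<^sup>+v. ennreal (v powr b * (1 - v) powr \<gamma>) * indicator {0<..<1} v \<partial>lborel)"
  \<comment> \<open>As \<gamma> < 0, the lower bound on \<open>b\<close> exceeds -1, so the Beta
    integral converges at 0.\<close>
  have "A < \<infinity>"
    unfolding A_def using assms by (intro nn_integral_Beta_finite) auto
  have inner: "(\<integral>\<^sup>+r. ?u s * ?u r * ennreal (\<bar>s - r\<bar> powr \<gamma>) * indicator {..<s} r \<partial>lborel) \<le>
      A * (ennreal (s powr (2 * b + \<gamma> + 1)) * indicator {0<..L} s)" for s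
  proof (cases "s \<in> {0<..L}")
    case True
    then have "0 < s"
      by simp
    have "(\<integral>\<^sup>+r. ?u s * ?u r * ennreal (\<bar>s - r\<bar> powr \<gamma>) * indicator {..<s} r \<partial>lborel) \<le>
        (\<integral>\<^sup>+r. ennreal (s powr b * (r powr b * \<bar>s - r\<bar> powr \<gamma>)) * indicator {0<..<s} r \<partial>lborel)"
      using True by (intro nn_integral_mono) (auto simp: ennreal_mult mult.assoc split: split_indicator)
    \<comment> \<open>The substitution r = s v extracts all powers of \<open>s\<close>: 2b from the
      two weights, \<gamma> from the distance and 1 from the Jacobian.\<close>
    also have "\<dots> = ennreal \<bar>s\<bar> * (\<integral>\<^sup>+v. ennreal (s powr b * ((0 + s * v) powr b * \<bar>s - (0 + s * v)\<bar> powr \<gamma>))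
        * indicator {0<..<s} (0 + s * v) \<partial>lborel)"
      using \<open>0 < s\<close> by (intro nn_integral_real_affine) auto
    also have "\<dots> = ennreal \<bar>s\<bar> * (\<integral>\<^sup>+v. ennreal (s powr (2 * b + \<gamma>)) *
        (ennreal (v powr b * (1 - v) powr \<gamma>) * indicator {0<..<1} v) \<partial>lborel)"
    proof (rule arg_cong2[where f = "(*)", OF refl nn_integral_cong])
      fix v :: real
      have iff: "0 + s * v \<in> {0<..<s} \<longleftrightarrow> v \<in> {0<..<1}"
        using \<open>0 < s\<close> by (auto simp: zero_less_mult_iff)
      have "s powr b * ((0 + s * v) powr b * \<bar>s - (0 + s * v)\<bar> powr \<gamma>) =
          s powr (2 * b + \<gamma>) * (v powr b * (1 - v) powr \<gamma>)" if "0 < v" "v < 1"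
      proof -
        have "\<bar>s - (0 + s * v)\<bar> = s * (1 - v)"
          using \<open>0 < s\<close> that by (simp add: algebra_simps)
        moreover have "s powr (2 * b + \<gamma>) = s powr b * s powr b * s powr \<gamma>"
          by (simp flip: powr_add)
        ultimately show ?thesis
          using \<open>0 < s\<close> that by (simp add: powr_mult)
      qed
      then show "ennreal (s powr b * ((0 + s * v) powr b * \<bar>s - (0 + s * v)\<bar> powr \<gamma>)) * indicator {0<..<s} (0 + s * v) =
          ennreal (s powr (2 * b + \<gamma>)) * (ennreal (v powr b * (1 - v) powr \<gamma>) * indicator {0<..<1} v)"
        using iff by (cases "v \<in> {0<..<1}") (auto simp flip: ennreal_mult)
    qed
    also have "\<dots> = ennreal (\<bar>s\<bar> * s powr (2 * b + \<gamma>)) * A"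
      unfolding A_def by (simp add: nn_integral_cmult ennreal_mult mult.assoc)
    also have "\<bar>s\<bar> * s powr (2 * b + \<gamma>) = s powr (2 * b + \<gamma> + 1)"
      using \<open>0 < s\<close> by (simp add: powr_add)
    finally show ?thesis
      using True by (simp add: mult.commute)
  qed auto
  \<comment> \<open>2b + \<gamma> + 1 > -1 is the assumed lower bound on \<open>b\<close>.\<close>
  have "(\<integral>\<^sup>+s. A * (ennreal (s powr (2 * b + \<gamma> + 1)) * indicator {0<..L} s) \<partial>lborel) < \<infinity>"
    using nn_integral_powr_from_0[of "2 * b + \<gamma> + 1" L] assms \<open>A < \<infinity>\<close>
    by (simp add: nn_integral_cmult ennreal_mult_less_top)
  then have "(\<integral>\<^sup>+s. \<integral>\<^sup>+r. ?u s * ?u r * ennreal (\<bar>s - r\<bar> powr \<gamma>) * indicator {..<s} r \<partial>lborel \<partial>lborel) < \<infinity>"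
    by (rule order_le_less_trans[rotated]) (intro nn_integral_mono inner)
  then show ?thesis
    by (subst riesz_energy_eq_half_plane(2)) (auto simp: ennreal_mult_less_top)
qed

text \<open>The substitution r = s v is now made on r > s, so v runs over (1, infinity). The
  remaining power 2b + \<gamma> + 1 is integrable at infinity by the upper bound on
  \<open>b\<close>.\<close>

lemma riesz_energy_power_at_infinity:
  assumes "b < -1 - \<gamma> / 2" "-1 < \<gamma>" "\<gamma> < 0" "0 < T"
  shows "riesz_energy \<gamma> (\<lambda>s. ennreal (s powr b) * indicator {T<..} s) < \<infinity>"
proof -
  let ?u = "\<lambda>s. ennreal (s powr b) * indicator {T<..} s"
  define A where "A = (\<integral>\<^sup>+v. ennreal (v powr b * (v - 1) powr \<gamma>) * indicator {1<..} v \<partial>lborel)"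
  \<comment> \<open>The upper bound on \<open>b\<close> with -1 < \<gamma> < 0 gives b < -1/2 and b
    + \<gamma> < -1.\<close>
  have "A < \<infinity>"
    unfolding A_def using assms by (intro nn_integral_tail_finite) auto
  have inner: "(\<integral>\<^sup>+r. ?u s * ?u r * ennreal (\<bar>s - r\<bar> powr \<gamma>) * indicator {s<..} r \<partial>lborel) \<le>
      A * (ennreal (s powr (2 * b + \<gamma> + 1)) * indicator {T<..} s)" for s
  proof (cases "s \<in> {T<..}")
    case True
    then have "0 < s"
      using assms by simp
    have "(\<integral>\<^sup>+r. ?u s * ?u r * ennreal (\<bar>s - r\<bar> powr \<gamma>) * indicator {s<..} r \<partial>lborel) \<le>
        (\<integral>\<^sup>+r. ennreal (s powr b * (r powr b * \<bar>s - r\<bar> powr \<gamma>)) * indicator {s<..} r \<partial>lborel)"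
      using True by (intro nn_integral_mono) (auto simp: ennreal_mult mult.assoc split: split_indicator)
    also have "\<dots> = ennreal \<bar>s\<bar> * (\<integral>\<^sup>+v. ennreal (s powr b * ((0 + s * v) powr b * \<bar>s - (0 + s * v)\<bar> powr \<gamma>))
        * indicator {s<..} (0 + s * v) \<partial>lborel)"
      using \<open>0 < s\<close> by (intro nn_integral_real_affine) auto
    also have "\<dots> = ennreal \<bar>s\<bar> * (\<integral>\<^sup>+v. ennreal (s powr (2 * b + \<gamma>)) *
        (ennreal (v powr b * (v - 1) powr \<gamma>) * indicator {1<..} v) \<partial>lborel)"
    proof (rule arg_cong2[where f = "(*)", OF refl nn_integral_cong])
      fix v :: real
      have iff: "0 + s * v \<in> {s<..} \<longleftrightarrow> v \<in> {1<..}"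
        using \<open>0 < s\<close> by auto
      have "s powr b * ((0 + s * v) powr b * \<bar>s - (0 + s * v)\<bar> powr \<gamma>) =
          s powr (2 * b + \<gamma>) * (v powr b * (v - 1) powr \<gamma>)" if "1 < v"
      proof -
        have "s - (0 + s * v) = - (s * (v - 1))"
          by (simp add: algebra_simps)
        then have "\<bar>s - (0 + s * v)\<bar> = s * (v - 1)"
          using \<open>0 < s\<close> that by simp
        moreover have "s powr (2 * b + \<gamma>) = s powr b * s powr b * s powr \<gamma>"
          by (simp flip: powr_add)
        ultimately show ?thesis
          using \<open>0 < s\<close> that by (simp add: powr_mult)
      qed
      then show "ennreal (s powr b * ((0 + s * v) powr b * \<bar>s - (0 + s * v)\<bar> powr \<gamma>)) * indicator {s<..} (0 + s * v) =
          ennreal (s powr (2 * b + \<gamma>)) * (ennreal (v powr b * (v - 1) powr \<gamma>) * indicator {1<..} v)"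
        using iff by (cases "v \<in> {1<..}") (auto simp flip: ennreal_mult)
    qed
    also have "\<dots> = ennreal (\<bar>s\<bar> * s powr (2 * b + \<gamma>)) * A"
      unfolding A_def by (simp add: nn_integral_cmult ennreal_mult mult.assoc)
    also have "\<bar>s\<bar> * s powr (2 * b + \<gamma>) = s powr (2 * b + \<gamma> + 1)"
      using \<open>0 < s\<close> by (simp add: powr_add)
    finally show ?thesis
      using True by (simp add: mult.commute)
  qed auto
  have "(\<integral>\<^sup>+s. A * (ennreal (s powr (2 * b + \<gamma> + 1)) * indicator {T<..} s) \<partial>lborel) < \<infinity>"
    using nn_integral_powr_to_inf[of "2 * b + \<gamma> + 1" T] assms \<open>A < \<infinity>\<close>
    by (simp add: nn_integral_cmult ennreal_mult_less_top)
  then have "(\<integral>\<^sup>+s. \<integral>\<^sup>+r. ?u s * ?u r * ennreal (\<bar>s - r\<bar> powr \<gamma>) * indicator {s<..} r \<partial>lborel \<partial>lborel) < \<infinity>"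
    by (rule order_le_less_trans[rotated]) (intro nn_integral_mono inner)
  then show ?thesis
    by (subst riesz_energy_eq_half_plane(1)) (auto simp: ennreal_mult_less_top)
qed

section \<open>Square integrability of the kernels\<close>

text \<open>Extension by zero absorbs the condition that \<open>s\<close> exceed all coordinates of
  \<open>x\<close> and hides the arbitrary values of \<open>g\<close> off the orthant.\<close>

definition kernel_ext :: "(real ^ 'k \<Rightarrow> real) \<Rightarrow> real ^ 'k \<Rightarrow> real" where
  "kernel_ext g x = indicator pos_orthant x * g x"

text \<open>The absolute majorant of the kernel integrals. Being \<open>ennreal\<close>-valued, it
  admits Tonelli's theorem before any convergence is known.\<close>

definition kernel_potential :: "(real ^ 'k \<Rightarrow> real) \<Rightarrow> (real \<Rightarrow> ennreal) \<Rightarrow> real ^ 'k \<Rightarrow> ennreal" where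
  "kernel_potential g u x = (\<integral>\<^sup>+s. u s * ennreal \<bar>kernel_ext g (\<chi> i. s - x $ i)\<bar> \<partial>lborel)"

lemma pos_orthant_borel [measurable]: "(pos_orthant :: (real ^ 'k) set) \<in> sets borel"
  unfolding pos_orthant_def by measurable

lemma measurable_kernel_ext:
  assumes "generalized_hermite_kernel g \<alpha>"
  shows "kernel_ext g \<in> borel_measurable borel"
  using assms unfolding generalized_hermite_kernel_def set_borel_measurable_def kernel_ext_def[abs_def]
  by simp

lemma kernel_ext_scale:
  fixes g :: "real ^ 'k \<Rightarrow> real"
  assumes g: "generalized_hermite_kernel g \<alpha>" and c: "0 < c"
  shows "kernel_ext g (c *\<^sub>R x) = c powr \<alpha> * kernel_ext g x"
proof -
  have "c *\<^sub>R x \<in> pos_orthant \<longleftrightarrow> x \<in> pos_orthant"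
    using c by (simp add: pos_orthant_def zero_less_mult_iff)
  then show ?thesis
    using g c by (auto simp: kernel_ext_def generalized_hermite_kernel_def split: split_indicator)
qed

lemma measurable_shifted_kernel_ext:
  assumes "generalized_hermite_kernel g \<alpha>"
  shows "(\<lambda>(x, s). kernel_ext g (\<chi> i. s - x $ i)) \<in> borel_measurable (borel \<Otimes>\<^sub>M borel)"
proof -
  have "(\<lambda>p :: (real ^ 'k) \<times> real. \<chi> i. snd p - fst p $ i) \<in> borel_measurable borel"
    by (intro borel_measurable_continuous_onI continuous_intros)
  then have "(\<lambda>p :: (real ^ 'k) \<times> real. \<chi> i. snd p - fst p $ i) \<in> borel_measurable (borel \<Otimes>\<^sub>M borel)"
    by (simp add: borel_prod)
  from measurable_compose[OF this measurable_kernel_ext[OF assms]] show ?thesis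
    by (simp add: split_beta)
qed

lemma h_kernel_eq_kernel_ext:
  "h_kernel g \<beta> t x = (\<integral>s. (1 / \<beta>) * (plus_powr (t - s) \<beta> - plus_powr (- s) \<beta>) * kernel_ext g (\<chi> i. s - x $ i) \<partial>lborel)"
proof -
  have "indicator {s. \<forall>i. x $ i < s} s = (indicator pos_orthant (\<chi> i. s - x $ i) :: real)" for s
    by (simp add: pos_orthant_def indicator_def)
  then show ?thesis
    unfolding h_kernel_def kernel_ext_def by (simp add: mult_ac)
qed

text \<open>For d = r - s > 0 the substitution x = s - d y turns the arguments into d y and d (1 +
  y). Homogeneity yields d^(2\<alpha>), the Jacobian d^k, and \<open>C\<close> is the integral
  assumed finite in the definition of the kernel.\<close>

lemma kernel_translates_inner_product:
  fixes g :: "real ^ 'k \<Rightarrow> real"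
  assumes g: "generalized_hermite_kernel g \<alpha>"
  obtains C where "C < \<infinity>"
    "\<And>s r. s \<noteq> r \<Longrightarrow> (\<integral>\<^sup>+x. ennreal \<bar>kernel_ext g (\<chi> i. s - x $ i)\<bar> * ennreal \<bar>kernel_ext g (\<chi> i. r - x $ i)\<bar> \<partial>lborel)
      = C * ennreal (\<bar>s - r\<bar> powr (2 * \<alpha> + CARD('k)))"
proof
  define G where "G y = ennreal \<bar>kernel_ext g y\<bar>" for y
  have [measurable]: "G \<in> borel_measurable borel"
    unfolding G_def using measurable_kernel_ext[OF g] by measurable
  let ?C = "\<integral>\<^sup>+y. G y * G (1 + y) \<partial>lborel"
  let ?K = "\<lambda>s r. \<integral>\<^sup>+x. G (\<chi> i. s - x $ i) * G (\<chi> i. r - x $ i) \<partial>lborel"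
  have shift [measurable]: "(\<lambda>x :: real ^ 'k. \<chi> i. s - x $ i) \<in> borel_measurable borel" for s
    by (intro borel_measurable_continuous_onI continuous_intros)
  have int: "integrable lborel (\<lambda>x. indicator pos_orthant x *\<^sub>R \<bar>g x * g (1 + x)\<bar>)"
    using g by (simp add: generalized_hermite_kernel_def set_integrable_def)
  have "G y * G (1 + y) = ennreal (norm (indicator pos_orthant y *\<^sub>R \<bar>g y * g (1 + y)\<bar>))" for y
  proof -
    have "1 + y \<in> pos_orthant" if "y \<in> pos_orthant"
      using that by (auto simp: pos_orthant_def add_pos_pos)
    then show ?thesis
      by (auto simp: G_def kernel_ext_def abs_mult ennreal_mult split: split_indicator)
  qed
  then have "?C = (\<integral>\<^sup>+y. ennreal (norm (indicator pos_orthant y *\<^sub>R \<bar>g y * g (1 + y)\<bar>)) \<partial>lborel)"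
    by simp
  also have "\<dots> < \<infinity>"
    using int by (simp only: integrable_iff_bounded)
  finally show "?C < \<infinity>" .
  have less: "?K s r = ?C * ennreal (\<bar>s - r\<bar> powr (2 * \<alpha> + CARD('k)))" if "s < r" for s r
  proof -
    define d where "d = r - s"
    have d: "0 < d"
      using that by (simp add: d_def)
    have G_scale: "G (d *\<^sub>R y) = ennreal (d powr \<alpha>) * G y" for y
      unfolding G_def kernel_ext_scale[OF g d] by (simp add: abs_mult ennreal_mult)
    have "?K s r = ennreal (\<bar>- d\<bar> ^ DIM(real ^ 'k)) *
        (\<integral>\<^sup>+y. G (\<chi> i. s - ((\<chi> i. s) + (- d) *\<^sub>R y) $ i) * G (\<chi> i. r - ((\<chi> i. s) + (- d) *\<^sub>R y) $ i) \<partial>lborel)"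
      using d by (intro nn_integral_lborel_affine) auto
    also have "(\<lambda>y. G (\<chi> i. s - ((\<chi> i. s) + (- d) *\<^sub>R y) $ i) * G (\<chi> i. r - ((\<chi> i. s) + (- d) *\<^sub>R y) $ i)) =
        (\<lambda>y. ennreal (d powr \<alpha> * d powr \<alpha>) * (G y * G (1 + y)))"
    proof
      fix y :: "real ^ 'k"
      have "(\<chi> i. s - ((\<chi> i. s) + (- d) *\<^sub>R y) $ i) = d *\<^sub>R y"
        by (simp add: vec_eq_iff)
      moreover have "(\<chi> i. r - ((\<chi> i. s) + (- d) *\<^sub>R y) $ i) = d *\<^sub>R (1 + y)"
        by (simp add: vec_eq_iff d_def algebra_simps)
      ultimately show "G (\<chi> i. s - ((\<chi> i. s) + (- d) *\<^sub>R y) $ i) * G (\<chi> i. r - ((\<chi> i. s) + (- d) *\<^sub>R y) $ i) =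
          ennreal (d powr \<alpha> * d powr \<alpha>) * (G y * G (1 + y))"
        by (simp only: G_scale) (simp add: ennreal_mult mult_ac)
    qed
    also have "(\<integral>\<^sup>+y. ennreal (d powr \<alpha> * d powr \<alpha>) * (G y * G (1 + y)) \<partial>lborel) = ennreal (d powr \<alpha> * d powr \<alpha>) * ?C"
      by (rule nn_integral_cmult) measurable
    also have "ennreal (\<bar>- d\<bar> ^ DIM(real ^ 'k)) * (ennreal (d powr \<alpha> * d powr \<alpha>) * ?C) =
        ?C * ennreal (d ^ CARD('k) * (d powr \<alpha> * d powr \<alpha>))"
      using d by (simp add: ennreal_mult mult_ac)
    also have "d ^ CARD('k) * (d powr \<alpha> * d powr \<alpha>) = \<bar>s - r\<bar> powr (2 * \<alpha> + CARD('k))"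
    proof -
      have "\<bar>s - r\<bar> = d" "2 * \<alpha> = \<alpha> + \<alpha>"
        using that by (simp_all add: d_def)
      then show ?thesis
        using d by (simp only: powr_add powr_realpow[OF d] mult.commute)
    qed
    finally show ?thesis .
  qed
  have "?K s r = ?C * ennreal (\<bar>s - r\<bar> powr (2 * \<alpha> + CARD('k)))" if "s \<noteq> r" for s r
    using less[of s r] less[of r s] that
    by (cases s r rule: linorder_cases) (auto simp: mult.commute abs_minus_commute)
  then show "(\<integral>\<^sup>+x. ennreal \<bar>kernel_ext g (\<chi> i. s - x $ i)\<bar> * ennreal \<bar>kernel_ext g (\<chi> i. r - x $ i)\<bar> \<partial>lborel)
      = ?C * ennreal (\<bar>s - r\<bar> powr (2 * \<alpha> + CARD('k)))" if "s \<noteq> r" for s r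
    using that by (simp add: G_def)
qed

lemma measurable_kernel_potential:
  assumes g: "generalized_hermite_kernel g \<alpha>" and [measurable]: "u \<in> borel_measurable borel"
  shows "kernel_potential g u \<in> borel_measurable borel"
proof -
  note [measurable] = measurable_shifted_kernel_ext[OF g]
  show ?thesis
    unfolding kernel_potential_def[abs_def] by measurable
qed

text \<open>The square is written as a double integral in \<open>s\<close> and \<open>r\<close>, and
  the integral over \<open>x\<close> is moved inside. There it is \<open>C\<close> times the Riesz
  kernel off the null set s = r.\<close>

lemma kernel_potential_square:
  fixes g :: "real ^ 'k \<Rightarrow> real"
  assumes g: "generalized_hermite_kernel g \<alpha>" and [measurable]: "u \<in> borel_measurable borel"
    and energy: "riesz_energy (2 * \<alpha> + CARD('k)) u < \<infinity>"
  shows "(\<integral>\<^sup>+x. (kernel_potential g u x)\<^sup>2 \<partial>lborel) < \<infinity>"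
proof -
  define G where "G x s = ennreal \<bar>kernel_ext g (\<chi> i. s - x $ i)\<bar>" for x s
  note [measurable] = measurable_shifted_kernel_ext[OF g]
  have G [measurable]: "(\<lambda>(x, s). G x s) \<in> borel_measurable (borel \<Otimes>\<^sub>M borel)"
    unfolding G_def by measurable
  obtain C where C: "C < \<infinity>" "\<And>s r. s \<noteq> r \<Longrightarrow>
      (\<integral>\<^sup>+x. G x s * G x r \<partial>lborel) = C * ennreal (\<bar>s - r\<bar> powr (2 * \<alpha> + CARD('k)))"
    unfolding G_def by (rule kernel_translates_inner_product[OF g]) (use that in blast)
  have "(kernel_potential g u x)\<^sup>2 = (\<integral>\<^sup>+s. \<integral>\<^sup>+r. (u s * G x s) * (u r * G x r) \<partial>lborel \<partial>lborel)" for x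
    unfolding kernel_potential_def power2_eq_square G_def[symmetric]
    by (simp add: nn_integral_cmult nn_integral_multc)
  then have "(\<integral>\<^sup>+x. (kernel_potential g u x)\<^sup>2 \<partial>lborel) =
      (\<integral>\<^sup>+x. \<integral>\<^sup>+s. \<integral>\<^sup>+r. (u s * G x s) * (u r * G x r) \<partial>lborel \<partial>lborel \<partial>lborel)"
    by simp
  also have "\<dots> = (\<integral>\<^sup>+s. \<integral>\<^sup>+x. \<integral>\<^sup>+r. (u s * G x s) * (u r * G x r) \<partial>lborel \<partial>lborel \<partial>lborel)"
    by (rule lborel_pair.Fubini') measurable
  also have "\<dots> = (\<integral>\<^sup>+s. \<integral>\<^sup>+r. \<integral>\<^sup>+x. (u s * G x s) * (u r * G x r) \<partial>lborel \<partial>lborel \<partial>lborel)"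
    by (rule nn_integral_cong, rule lborel_pair.Fubini') measurable
  also have "\<dots> = (\<integral>\<^sup>+s. \<integral>\<^sup>+r. u s * u r * (\<integral>\<^sup>+x. G x s * G x r \<partial>lborel) \<partial>lborel \<partial>lborel)"
    by (intro nn_integral_cong) (subst nn_integral_cmult[symmetric], measurable, simp add: mult_ac)
  also have "\<dots> = (\<integral>\<^sup>+s. \<integral>\<^sup>+r. C * (u s * u r * ennreal (\<bar>s - r\<bar> powr (2 * \<alpha> + CARD('k)))) \<partial>lborel \<partial>lborel)"
  proof (rule nn_integral_cong, rule nn_integral_cong_AE)
    fix s :: real
    show "AE r in lborel. u s * u r * (\<integral>\<^sup>+x. G x s * G x r \<partial>lborel) =
        C * (u s * u r * ennreal (\<bar>s - r\<bar> powr (2 * \<alpha> + CARD('k))))"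
      using AE_lborel_singleton[of s] by eventually_elim (simp add: C(2)[OF not_sym] abs_minus_commute mult_ac)
  qed
  also have "\<dots> = C * riesz_energy (2 * \<alpha> + CARD('k)) u"
    unfolding riesz_energy_def by (simp add: nn_integral_cmult)
  also have "\<dots> < \<infinity>"
    using C(1) energy by (simp add: ennreal_mult_less_top)
  finally show ?thesis .
qed

text \<open>The sum is at most twice the larger term, which explains the 4.\<close>

lemma ennreal_square_add_le: "((a :: ennreal) + b)\<^sup>2 \<le> 4 * a\<^sup>2 + 4 * b\<^sup>2"
proof (cases "a \<le> b")
  case True
  then have "(a + b)\<^sup>2 \<le> (2 * b)\<^sup>2"
    by (intro power_mono) (auto simp: mult_2 add_right_mono)
  also have "\<dots> = 4 * b\<^sup>2"
    by (simp add: power_mult_distrib)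
  finally show ?thesis
    by (rule add_increasing[OF zero_le])
next
  case False
  then have "(a + b)\<^sup>2 \<le> (2 * a)\<^sup>2"
    by (intro power_mono) (auto simp: mult_2 add_left_mono)
  also have "\<dots> = 4 * a\<^sup>2"
    by (simp add: power_mult_distrib)
  finally show ?thesis
    by (rule add_increasing2[OF zero_le])
qed

lemma kernel_potential_linear:
  assumes g: "generalized_hermite_kernel g \<alpha>"
    and [measurable]: "u \<in> borel_measurable borel" "v \<in> borel_measurable borel"
  shows "kernel_potential g (\<lambda>s. c * u s + v s) x = c * kernel_potential g u x + kernel_potential g v x"
proof -
  note [measurable] = measurable_shifted_kernel_ext[OF g]
  show ?thesis
    unfolding kernel_potential_def
    by (subst nn_integral_cmult[symmetric], measurable, subst nn_integral_add[symmetric])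
      (measurable, auto simp: distrib_right mult.assoc)
qed

lemma kernel_potential_mono:
  "(\<And>s. u s \<le> v s) \<Longrightarrow> kernel_potential g u x \<le> kernel_potential g v x"
  unfolding kernel_potential_def by (intro nn_integral_mono mult_right_mono) auto

lemma kernel_potential_square_linear:
  assumes g: "generalized_hermite_kernel g \<alpha>"
    and [measurable]: "u \<in> borel_measurable borel" "v \<in> borel_measurable borel"
    and fin: "(\<integral>\<^sup>+x. (kernel_potential g u x)\<^sup>2 \<partial>lborel) < \<infinity>" "(\<integral>\<^sup>+x. (kernel_potential g v x)\<^sup>2 \<partial>lborel) < \<infinity>"
    and c: "c < \<infinity>"
  shows "(\<integral>\<^sup>+x. (kernel_potential g (\<lambda>s. c * u s + v s) x)\<^sup>2 \<partial>lborel) < \<infinity>"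
proof -
  have [measurable]: "kernel_potential g u \<in> borel_measurable borel" "kernel_potential g v \<in> borel_measurable borel"
    by (intro measurable_kernel_potential[OF g]; measurable)+
  have "(\<integral>\<^sup>+x. (kernel_potential g (\<lambda>s. c * u s + v s) x)\<^sup>2 \<partial>lborel) \<le>
      (\<integral>\<^sup>+x. 4 * c\<^sup>2 * (kernel_potential g u x)\<^sup>2 + 4 * (kernel_potential g v x)\<^sup>2 \<partial>lborel)"
    unfolding kernel_potential_linear[OF g assms(2,3)]
    by (intro nn_integral_mono order_trans[OF ennreal_square_add_le]) (simp add: power_mult_distrib mult.assoc)
  also have "\<dots> = 4 * c\<^sup>2 * (\<integral>\<^sup>+x. (kernel_potential g u x)\<^sup>2 \<partial>lborel) + 4 * (\<integral>\<^sup>+x. (kernel_potential g v x)\<^sup>2 \<partial>lborel)"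
    by (subst nn_integral_add) (auto simp: nn_integral_cmult)
  also have "\<dots> < \<infinity>"
    using fin c by (auto simp: ennreal_mult_less_top power2_eq_square)
  finally show ?thesis .
qed

section \<open>Power bounds for the weight and finiteness of its potential\<close>

lemma measurable_plus_powr [measurable]: "(\<lambda>x. plus_powr x \<beta>) \<in> borel_measurable borel"
  unfolding plus_powr_def[abs_def] by measurable

text \<open>Mean value theorem; b < 1 makes the derivative largest in absolute value at the left
  end.\<close>

lemma powr_diff_le:
  fixes b x t :: real
  assumes "b < 1" "0 < x" "0 < t"
  shows "\<bar>(x + t) powr b - x powr b\<bar> \<le> t * \<bar>b\<bar> * x powr (b - 1)"
proof -
  have "\<exists>z. x < z \<and> z < x + t \<and> (x + t) powr b - x powr b = (x + t - x) * (b * z powr (b - 1))"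
    using assms by (intro MVT2) (auto intro!: derivative_eq_intros simp: powr_diff)
  then obtain z where z: "x < z" "(x + t) powr b - x powr b = t * (b * z powr (b - 1))"
    by auto
  have "z powr (b - 1) \<le> x powr (b - 1)"
    using assms z by (intro powr_mono2') auto
  then show ?thesis
    using assms by (simp add: z abs_mult mult_left_mono)
qed

text \<open>For \<open>s\<close> at least -t the two powers are bounded separately, and t - s then
  stays below 2t, whence that range. For s < -t their difference gains one order of decay. Writing
  \<open>0 - s\<close> fits the reflection lemma with p = 0.\<close>

lemma h_weight_bound:
  fixes \<beta> t s :: real
  assumes "\<beta> < 1" "\<beta> \<noteq> 0" "0 < t"
  shows "\<bar>(1 / \<beta>) * (plus_powr (t - s) \<beta> - plus_powr (- s) \<beta>)\<bar> \<le>
    (1 / \<bar>\<beta>\<bar>) * ((t - s) powr \<beta> * indicator {0<..2 * t} (t - s)) +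
    ((1 / \<bar>\<beta>\<bar>) * ((0 - s) powr \<beta> * indicator {0<..t} (0 - s)) +
     t * ((0 - s) powr (\<beta> - 1) * indicator {t<..} (0 - s)))"
proof -
  consider "t \<le> s" | "0 \<le> s" "s < t" | "- t \<le> s" "s < 0" | "s < - t"
    by linarith
  then show ?thesis
  proof cases
    case 3
    have "\<bar>(t - s) powr \<beta> - (- s) powr \<beta>\<bar> \<le> (t - s) powr \<beta> + (- s) powr \<beta>"
      using abs_triangle_ineq4[of "(t - s) powr \<beta>" "(- s) powr \<beta>"] by simp
    then show ?thesis
      using 3 assms by (simp add: plus_powr_def abs_mult divide_right_mono flip: add_divide_distrib)
  next
    case 4
    then have "\<bar>(t - s) powr \<beta> - (- s) powr \<beta>\<bar> \<le> t * \<bar>\<beta>\<bar> * (- s) powr (\<beta> - 1)"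
      using powr_diff_le[of \<beta> "- s" t] assms by simp
    then have "\<bar>(t - s) powr \<beta> - (- s) powr \<beta>\<bar> / \<bar>\<beta>\<bar> \<le> t * (- s) powr (\<beta> - 1)"
      using assms by (simp add: pos_divide_le_eq mult_ac)
    then show ?thesis
      using 4 assms by (simp add: plus_powr_def abs_mult)
  qed (use assms in \<open>auto simp: plus_powr_def abs_mult\<close>)
qed

lemma h_weight_potential_square:
  fixes g :: "real ^ 'k \<Rightarrow> real"
  assumes g: "generalized_hermite_kernel g \<alpha>" and \<beta>: "\<beta> \<noteq> 0"
    and lo: "- \<alpha> - real CARD('k) / 2 - 1 < \<beta>" and hi: "\<beta> < - \<alpha> - real CARD('k) / 2" and "0 \<le> t"
  shows "(\<integral>\<^sup>+x. (kernel_potential g (\<lambda>s. ennreal \<bar>(1 / \<beta>) * (plus_powr (t - s) \<beta> - plus_powr (- s) \<beta>)\<bar>) x)\<^sup>2 \<partial>lborel) < \<infinity>"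
proof (cases "t = 0")
  case True
  then show ?thesis
    by (simp add: kernel_potential_def)
next
  case False
  then have t: "0 < t"
    using \<open>0 \<le> t\<close> by simp
  let ?\<gamma> = "2 * \<alpha> + CARD('k)"
  have \<alpha>: "- (real CARD('k) + 1) / 2 < \<alpha>" "\<alpha> < - real CARD('k) / 2"
    using g by (auto simp: generalized_hermite_kernel_def)
  then have \<gamma>: "-1 < ?\<gamma>" "?\<gamma> < 0"
    by (auto simp: field_simps)
  define near where "near L s = ennreal (s powr \<beta>) * indicator {0<..L} s" for L s
  define far where "far s = ennreal (s powr (\<beta> - 1)) * indicator {t<..} s" for s
  have [measurable]: "near L \<in> borel_measurable borel" "far \<in> borel_measurable borel" for L
    unfolding near_def[abs_def] far_def[abs_def] by measurable
  have near: "(\<integral>\<^sup>+x. (kernel_potential g (\<lambda>s. near L (p - s)) x)\<^sup>2 \<partial>lborel) < \<infinity>" if "0 \<le> L" for L p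
  proof (rule kernel_potential_square[OF g])
    show "riesz_energy ?\<gamma> (\<lambda>s. near L (p - s)) < \<infinity>"
      unfolding riesz_energy_reflect[OF \<open>near L \<in> borel_measurable borel\<close>] unfolding near_def
      using \<gamma> lo that by (intro riesz_energy_power_near_0) (auto simp: field_simps)
  qed measurable
  have far: "(\<integral>\<^sup>+x. (kernel_potential g (\<lambda>s. far (0 - s)) x)\<^sup>2 \<partial>lborel) < \<infinity>"
  proof (rule kernel_potential_square[OF g])
    show "riesz_energy ?\<gamma> (\<lambda>s. far (0 - s)) < \<infinity>"
      unfolding riesz_energy_reflect[OF \<open>far \<in> borel_measurable borel\<close>] unfolding far_def
      using \<gamma> hi t by (intro riesz_energy_power_at_infinity) (auto simp: field_simps)
  qed measurable
  define c where "c = 1 / \<bar>\<beta>\<bar>"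
  have "0 \<le> c"
    by (simp add: c_def)
  \<comment> \<open>The final \<open>+ 0\<close> gives every summand the shape c * u + v, so one
    lemma can be applied repeatedly.\<close>
  let ?v = "\<lambda>s. ennreal c * near (2 * t) (t - s) +
      (ennreal c * near t (0 - s) + (ennreal t * far (0 - s) + 0))"
  have zero: "(\<integral>\<^sup>+x. (kernel_potential g (\<lambda>s. 0) x)\<^sup>2 \<partial>lborel) < \<infinity>"
    by (simp add: kernel_potential_def)
  have "(\<integral>\<^sup>+x. (kernel_potential g ?v x)\<^sup>2 \<partial>lborel) < \<infinity>"
    using t by (intro kernel_potential_square_linear[OF g] near far zero) auto
  moreover have "ennreal \<bar>(1 / \<beta>) * (plus_powr (t - s) \<beta> - plus_powr (- s) \<beta>)\<bar> \<le> ?v s" for s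
  proof -
    \<comment> \<open>In fact \<beta> < 1/2, since \<alpha> > -(k+1)/2.\<close>
    have "\<beta> < 1"
      using hi \<alpha> by (simp add: field_simps)
    have ind: "ennreal (indicator A x) = indicator A x" for A and x :: real
      by (simp split: split_indicator)
    have "ennreal \<bar>(1 / \<beta>) * (plus_powr (t - s) \<beta> - plus_powr (- s) \<beta>)\<bar> \<le> ennreal
       (c * ((t - s) powr \<beta> * indicator {0<..2 * t} (t - s)) +
        (c * ((0 - s) powr \<beta> * indicator {0<..t} (0 - s)) +
         t * ((0 - s) powr (\<beta> - 1) * indicator {t<..} (0 - s))))"
      unfolding c_def using h_weight_bound[OF \<open>\<beta> < 1\<close> \<beta> t] by (rule ennreal_leI)
    also have "\<dots> = ?v s"
      unfolding near_def far_def using t \<open>0 \<le> c\<close> by (simp add: ennreal_mult ind del: diff_0)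
    finally show ?thesis .
  qed
  then have "(\<integral>\<^sup>+x. (kernel_potential g (\<lambda>s. ennreal \<bar>(1 / \<beta>) * (plus_powr (t - s) \<beta> - plus_powr (- s) \<beta>)\<bar>) x)\<^sup>2 \<partial>lborel)
      \<le> (\<integral>\<^sup>+x. (kernel_potential g ?v x)\<^sup>2 \<partial>lborel)"
    by (intro nn_integral_mono power_mono kernel_potential_mono) auto
  ultimately show ?thesis
    by (rule order_le_less_trans[rotated])
qed

section \<open>Self-similarity and stationary increments\<close>

definition kernel_transform :: "(real ^ 'k \<Rightarrow> real) \<Rightarrow> (real \<Rightarrow> real) \<Rightarrow> real ^ 'k \<Rightarrow> real" where
  "kernel_transform g \<kappa> x = (\<integral>s. \<kappa> s * kernel_ext g (\<chi> i. s - x $ i) \<partial>lborel)"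

text \<open>The base point is left free so that increments of the process have weights of the same
  form, on which translations act.\<close>

definition increment_weight :: "real \<Rightarrow> real \<Rightarrow> real \<Rightarrow> real \<Rightarrow> real" where
  "increment_weight \<beta> t t' s = (1 / \<beta>) * (plus_powr (t' - s) \<beta> - plus_powr (t - s) \<beta>)"

lemma measurable_increment_weight [measurable]: "increment_weight \<beta> t t' \<in> borel_measurable borel"
  unfolding increment_weight_def[abs_def] by measurable

lemma h_kernel_eq_kernel_transform: "h_kernel g \<beta> t = kernel_transform g (increment_weight \<beta> 0 t)"
  by (simp add: fun_eq_iff h_kernel_eq_kernel_ext kernel_transform_def increment_weight_def)

lemma measurable_kernel_transform:
  assumes g: "generalized_hermite_kernel g \<alpha>" and [measurable]: "\<kappa> \<in> borel_measurable borel"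
  shows "kernel_transform g \<kappa> \<in> borel_measurable borel"
proof -
  note [measurable] = measurable_shifted_kernel_ext[OF g]
  show ?thesis
    unfolding kernel_transform_def[abs_def] by measurable
qed

text \<open>The potential dominates the transform, and a finite square integral makes it finite
  almost everywhere. The second conclusion is what permits kernel integrals to be
  subtracted.\<close>

lemma kernel_transform_square_integrable:
  fixes g :: "real ^ 'k \<Rightarrow> real"
  assumes g: "generalized_hermite_kernel g \<alpha>" and [measurable]: "\<kappa> \<in> borel_measurable borel"
    and fin: "(\<integral>\<^sup>+x. (kernel_potential g (\<lambda>s. ennreal \<bar>\<kappa> s\<bar>) x)\<^sup>2 \<partial>lborel) < \<infinity>"
  shows "square_integrable lborel (kernel_transform g \<kappa>)"
    and "AE x in lborel. integrable lborel (\<lambda>s. \<kappa> s * kernel_ext g (\<chi> i. s - x $ i))"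
proof -
  note joint [measurable] = measurable_shifted_kernel_ext[OF g]
  let ?f = "\<lambda>x s. \<kappa> s * kernel_ext g (\<chi> i. s - x $ i)" and ?P = "kernel_potential g (\<lambda>s. ennreal \<bar>\<kappa> s\<bar>)"
  have f [measurable]: "?f x \<in> borel_measurable lborel" for x
  proof -
    have "(\<lambda>s. kernel_ext g (\<chi> i. s - x $ i)) \<in> borel_measurable borel"
      using measurable_compose[OF measurable_Pair1'[of x borel borel] joint] by simp
    then show ?thesis
      by simp
  qed
  have P [measurable]: "?P \<in> borel_measurable borel"
    by (rule measurable_kernel_potential[OF g]) measurable
  have norm: "(\<integral>\<^sup>+s. ennreal (norm (?f x s)) \<partial>lborel) = ?P x" for x
    by (simp add: kernel_potential_def abs_mult ennreal_mult)
  \<comment> \<open>The bound holds at every \<open>x\<close>: where the integrand is not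
    integrable, the Bochner integral is 0 by convention.\<close>
  have le: "ennreal \<bar>kernel_transform g \<kappa> x\<bar> \<le> ?P x" for x
  proof (cases "integrable lborel (?f x)")
    case True
    then show ?thesis
      using integral_norm_bound_ennreal[OF True] by (simp add: norm[simplified] kernel_transform_def)
  qed (simp add: kernel_transform_def not_integrable_integral_eq)
  have "ennreal ((kernel_transform g \<kappa> x)\<^sup>2) \<le> (?P x)\<^sup>2" for x
    using power_mono[OF le[of x], of 2] by (simp add: ennreal_power)
  then have "sqnorm lborel (kernel_transform g \<kappa>) \<le> (\<integral>\<^sup>+x. (?P x)\<^sup>2 \<partial>lborel)"
    unfolding sqnorm_def by (intro nn_integral_mono) simp
  then have "sqnorm lborel (kernel_transform g \<kappa>) < \<infinity>"
    using fin by (rule order_le_less_trans)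
  then show "square_integrable lborel (kernel_transform g \<kappa>)"
    using measurable_kernel_transform[OF g, of \<kappa>] by (simp add: square_integrable_iff_sqnorm)
  have "AE x in lborel. (?P x)\<^sup>2 \<noteq> \<infinity>"
    using fin by (intro nn_integral_PInf_AE) auto
  then show "AE x in lborel. integrable lborel (?f x)"
  proof eventually_elim
    case (elim x)
    then have "?P x < \<infinity>"
      by (cases "?P x = top") (auto simp: less_top power2_eq_square)
    then show ?case
      by (simp only: integrable_iff_bounded norm f simp_thms)
  qed
qed

text \<open>The difference of two integrals can be merged only where both converge, hence the
  exceptional null set.\<close>

lemma h_kernel_increment:
  fixes g :: "real ^ 'k \<Rightarrow> real"
  assumes g: "generalized_hermite_kernel g \<alpha>" and \<beta>: "\<beta> \<noteq> 0"
      "- \<alpha> - real CARD('k) / 2 - 1 < \<beta>" "\<beta> < - \<alpha> - real CARD('k) / 2"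
    and "0 \<le> t" "0 \<le> t'"
  shows "AE x in lborel. h_kernel g \<beta> t' x - h_kernel g \<beta> t x = kernel_transform g (increment_weight \<beta> t t') x"
proof -
  have int: "AE x in lborel. integrable lborel (\<lambda>s. increment_weight \<beta> 0 r s * kernel_ext g (\<chi> i. s - x $ i))"
    if "0 \<le> r" for r
    using h_weight_potential_square[OF g \<beta> that]
    by (intro kernel_transform_square_integrable(2)[OF g]) (simp_all add: increment_weight_def)
  show ?thesis
    using int[OF \<open>0 \<le> t\<close>] int[OF \<open>0 \<le> t'\<close>]
  proof eventually_elim
    case (elim x)
    have "h_kernel g \<beta> t' x - h_kernel g \<beta> t x = (\<integral>s. increment_weight \<beta> 0 t' s * kernel_ext g (\<chi> i. s - x $ i) -
        increment_weight \<beta> 0 t s * kernel_ext g (\<chi> i. s - x $ i) \<partial>lborel)"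
      unfolding h_kernel_eq_kernel_transform kernel_transform_def using elim by simp
    also have "\<dots> = kernel_transform g (increment_weight \<beta> t t') x"
      unfolding kernel_transform_def increment_weight_def by (simp add: algebra_simps)
    finally show ?case .
  qed
qed

lemma h_kernel_square_integrable:
  fixes g :: "real ^ 'k \<Rightarrow> real"
  assumes g: "generalized_hermite_kernel g \<alpha>" and \<beta>: "\<beta> \<noteq> 0"
      "- \<alpha> - real CARD('k) / 2 - 1 < \<beta>" "\<beta> < - \<alpha> - real CARD('k) / 2" and "0 \<le> t"
  shows "square_integrable lborel (h_kernel g \<beta> t)"
  unfolding h_kernel_eq_kernel_transform
  using h_weight_potential_square[OF g \<beta> \<open>0 \<le> t\<close>]
  by (intro kernel_transform_square_integrable(1)[OF g]) (simp_all add: increment_weight_def)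

lemma kernel_transform_translate:
  "kernel_transform g (increment_weight \<beta> (t + u) (t' + u)) ((\<chi> i. u) + x) =
    kernel_transform g (increment_weight \<beta> t t') x"
proof -
  let ?f = "\<lambda>s. increment_weight \<beta> (t + u) (t' + u) s * kernel_ext g (\<chi> i. s - ((\<chi> i. u) + x) $ i)"
  have "integral\<^sup>L lborel ?f = \<bar>1\<bar> *\<^sub>R (\<integral>s. ?f (u + 1 * s) \<partial>lborel)"
    by (rule lborel_integral_real_affine) simp
  then show ?thesis
    by (simp add: kernel_transform_def increment_weight_def algebra_simps)
qed

text \<open>Substituting a s for \<open>s\<close> contributes 1 to the exponent through the
  Jacobian, \<alpha> through \<open>g\<close> and \<beta> through the weight.\<close>

lemma h_kernel_scale:
  assumes g: "generalized_hermite_kernel g \<alpha>" and a: "0 < a"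
  shows "h_kernel g \<beta> (a * t) (a *\<^sub>R x) = a powr (1 + \<alpha> + \<beta>) * h_kernel g \<beta> t x"
proof -
  have plus: "plus_powr (a * y) \<beta> = a powr \<beta> * plus_powr y \<beta>" for y
    using a by (auto simp: plus_powr_def powr_mult zero_less_mult_iff)
  let ?f = "\<lambda>s. increment_weight \<beta> 0 (a * t) s * kernel_ext g (\<chi> i. s - (a *\<^sub>R x) $ i)"
  have "?f (0 + a * s) = a powr (\<alpha> + \<beta>) * (increment_weight \<beta> 0 t s * kernel_ext g (\<chi> i. s - x $ i))" for s
  proof -
    have "increment_weight \<beta> 0 (a * t) (0 + a * s) = a powr \<beta> * increment_weight \<beta> 0 t s"
      using plus[of "t - s"] plus[of "- s"] by (simp add: increment_weight_def algebra_simps)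
    moreover have "(\<chi> i. (0 + a * s) - (a *\<^sub>R x) $ i) = a *\<^sub>R (\<chi> i. s - x $ i)"
      by (simp add: vec_eq_iff algebra_simps)
    ultimately show ?thesis
      by (simp only: kernel_ext_scale[OF g a]) (simp add: powr_add)
  qed
  moreover have "integral\<^sup>L lborel ?f = \<bar>a\<bar> *\<^sub>R (\<integral>s. ?f (0 + a * s) \<partial>lborel)"
    using a by (intro lborel_integral_real_affine) simp
  ultimately have "integral\<^sup>L lborel ?f = a * (a powr (\<alpha> + \<beta>) * h_kernel g \<beta> t x)"
    using a by (simp add: h_kernel_eq_kernel_transform kernel_transform_def)
  moreover have "a powr (1 + \<alpha> + \<beta>) = a * a powr (\<alpha> + \<beta>)"
    using a by (simp add: powr_add)
  ultimately show ?thesis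
    by (simp add: h_kernel_eq_kernel_transform kernel_transform_def)
qed

theorem theorem3p27:
  fixes g :: "real ^ 'k \<Rightarrow> real" and \<alpha> \<beta> :: real
    and M :: "'w measure" and W :: "real \<Rightarrow> 'w \<Rightarrow> real"
  assumes "brownian_motion M W"
    and "generalized_hermite_kernel g \<alpha>"
    and "\<beta> \<noteq> 0"
    and "- \<alpha> - real CARD('k) / 2 - 1 < \<beta>"
    and "\<beta> < - \<alpha> - real CARD('k) / 2"
  shows "sssi M (\<alpha> + \<beta> + real CARD('k) / 2 + 1) (\<lambda>t. wiener_ito M W (h_kernel g \<beta> t)) \<and>
         \<alpha> + \<beta> + real CARD('k) / 2 + 1 \<in> {0<..<1}"
proof (rule conjI)
  show "\<alpha> + \<beta> + real CARD('k) / 2 + 1 \<in> {0<..<1}"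
    using assms(4,5) by simp
  note W = assms(1) and g = assms(2)
  define H where "H = \<alpha> + \<beta> + real CARD('k) / 2 + 1"
  define Z where "Z t = wiener_ito M W (h_kernel g \<beta> t)" for t
  have Z: "is_wiener_ito M W (h_kernel g \<beta> t) (Z t)" if "0 \<le> t" for t
    unfolding Z_def using wiener_ito_is_wiener_ito[OF W h_kernel_square_integrable[OF g assms(3-5) that]] .
  have increment: "is_wiener_ito M W (kernel_transform g (increment_weight \<beta> t t')) (\<lambda>\<omega>. Z t' \<omega> - Z t \<omega>)"
    if "0 \<le> t" "0 \<le> t'" for t t'
  proof (rule is_wiener_ito_cong_AE)
    show "is_wiener_ito M W (\<lambda>x. h_kernel g \<beta> t' x - h_kernel g \<beta> t x) (\<lambda>\<omega>. Z t' \<omega> - Z t \<omega>)"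
      using is_wiener_ito_linear[OF W Z[OF that(2)] Z[OF that(1)], of 1 "-1"] by simp
    show "AE x in lborel. h_kernel g \<beta> t' x - h_kernel g \<beta> t x = kernel_transform g (increment_weight \<beta> t t') x"
      using h_kernel_increment[OF g assms(3-5) that] .
    show "kernel_transform g (increment_weight \<beta> t t') \<in> borel_measurable borel"
      by (rule measurable_kernel_transform[OF g]) measurable
  qed
  have "same_fdd M (\<lambda>t. Z (a * t)) (\<lambda>t \<omega>. a powr H * Z t \<omega>)" if a: "0 < a" for a
    unfolding same_fdd_def
  proof (intro allI impI, elim conjE)
    fix J :: "real set"
    assume J: "finite J" "J \<subseteq> {0..}"
    let ?V = "\<lambda>t \<omega>. (W (a * t + 0) \<omega> - W 0 \<omega>) / sqrt a" and ?c = "sqrt a ^ CARD('k)"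
    have V: "brownian_motion M ?V"
      by (rule brownian_motion_affine[OF W a])
    \<comment> \<open>Brownian scaling contributes a^(k/2), which completes the exponent
      1+\<alpha>+\<beta> to \<open>H\<close>.\<close>
    have "?c = a powr (real CARD('k) / 2)"
      using a by (simp add: powr_half_sqrt[symmetric] powr_powr flip: powr_realpow)
    then have c: "?c * a powr (1 + \<alpha> + \<beta>) = a powr H"
      by (simp add: H_def add_ac flip: powr_add)
    have zero: "(\<chi> i. 0) = (0 :: real ^ 'k)"
      by (simp add: vec_eq_iff)
    show "distr M (\<Pi>\<^sub>M t\<in>J. borel) (\<lambda>\<omega>. \<lambda>t\<in>J. Z (a * t) \<omega>) =
        distr M (\<Pi>\<^sub>M t\<in>J. borel) (\<lambda>\<omega>. \<lambda>t\<in>J. a powr H * Z t \<omega>)"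
    \<comment> \<open>Both families integrate the kernels a^H h_t: \<open>Z (a * t)\<close> against
      \<open>?V\<close>, and a^H \<open>Z t\<close> against \<open>W\<close>.\<close>
    proof (rule wiener_ito_same_law[OF V W J(1)])
      fix t assume "t \<in> J"
      then have t: "0 \<le> t" "0 \<le> a * t"
        using J a by auto
      have V_int: "is_wiener_ito M ?V (\<lambda>x. a powr (1 + \<alpha> + \<beta>) * h_kernel g \<beta> t x) (\<lambda>\<omega>. 1 / ?c * Z (a * t) \<omega>)"
        using is_wiener_ito_affine[OF W a Z[OF t(2)], of 0] unfolding zero by (simp add: h_kernel_scale[OF g a])
      \<comment> \<open>Multiplying by \<open>?c\<close> cancels the factor \<open>1 / ?c\<close> of
        the time change.\<close>
      show "is_wiener_ito M ?V (\<lambda>x. a powr H * h_kernel g \<beta> t x) (Z (a * t))"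
        using is_wiener_ito_linear[OF V V_int V_int, of ?c 0] a by (simp add: c mult.assoc[symmetric])
      show "is_wiener_ito M W (\<lambda>x. a powr H * h_kernel g \<beta> t x) (\<lambda>\<omega>. a powr H * Z t \<omega>)"
        using is_wiener_ito_linear[OF W Z[OF t(1)] Z[OF t(1)], of "a powr H" 0] by simp
    qed
  qed
  moreover have "same_fdd M (\<lambda>t \<omega>. Z (t + u + h) \<omega> - Z (t + u) \<omega>) (\<lambda>t \<omega>. Z (t + h) \<omega> - Z t \<omega>)"
    if "0 \<le> h" "0 \<le> u" for h u
    unfolding same_fdd_def
  proof (intro allI impI, elim conjE)
    fix J :: "real set"
    assume J: "finite J" "J \<subseteq> {0..}"
    \<comment> \<open>A pure translation; the \<open>1 *\<close> and \<open>sqrt 1\<close> keep it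
      an instance of the affine time change.\<close>
    let ?V = "\<lambda>t \<omega>. (W (1 * t + u) \<omega> - W u \<omega>) / sqrt 1"
    have V: "brownian_motion M ?V"
      by (rule brownian_motion_affine[OF W zero_less_one])
    show "distr M (\<Pi>\<^sub>M t\<in>J. borel) (\<lambda>\<omega>. \<lambda>t\<in>J. Z (t + u + h) \<omega> - Z (t + u) \<omega>) =
        distr M (\<Pi>\<^sub>M t\<in>J. borel) (\<lambda>\<omega>. \<lambda>t\<in>J. Z (t + h) \<omega> - Z t \<omega>)"
    proof (rule wiener_ito_same_law[OF V W J(1)])
      fix t assume "t \<in> J"
      then have t: "0 \<le> t" "0 \<le> t + h" "0 \<le> t + u" "0 \<le> t + u + h"
        using J that by auto
      \<comment> \<open>Both ends of the increment must read as something plus \<open>u\<close> for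
        the translation of kernels to apply.\<close>
      have shift: "t + u + h = t + h + u"
        by simp
      show "is_wiener_ito M ?V (kernel_transform g (increment_weight \<beta> t (t + h)))
          (\<lambda>\<omega>. Z (t + u + h) \<omega> - Z (t + u) \<omega>)"
        using is_wiener_ito_affine[OF W zero_less_one increment[OF t(3,4)], of u]
        unfolding shift by (simp add: kernel_transform_translate)
      show "is_wiener_ito M W (kernel_transform g (increment_weight \<beta> t (t + h))) (\<lambda>\<omega>. Z (t + h) \<omega> - Z t \<omega>)"
        by (rule increment[OF t(1,2)])
    qed
  qed
  moreover have "square_integrable M (Z t)" if "0 \<le> t" for t
    using Z[OF that] by (simp add: is_wiener_ito_def)
  ultimately have "sssi M H Z"
    by (simp add: sssi_def stationary_process_def)
  then show "sssi M (\<alpha> + \<beta> + real CARD('k) / 2 + 1) (\<lambda>t. wiener_ito M W (h_kernel g \<beta> t))"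
    by (simp add: H_def Z_def[abs_def])
qed

end
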